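(* The comparison functor $K':\mathbf{DRB}\to\mathbf{DIF}^{\mathbf T'}$ is an isomorphism of categories, i.e., $\mathbf{DRB}$ is monadic over $\mathbf{DIF}$.
   Context: Fix a commutative ring $\mathbf k$ with identity and $\lambda\in\mathbf k$. All algebras are commutative $\mathbf k$-algebras with identity, algebra homomorphisms preserve the identity, and tensor products are over $\mathbf k$. A $\lambda$-derivation on an algebra $R$ is a $\mathbf k$-linear $d:R\to R$ with $d(xy)=d(x)y+xd(y)+\lambda d(x)d(y)$ for all $x,y$ and $d(\mathbf 1_R)=0$; $(R,d)$ is then a $\lambda$-differential algebra. $\mathbf{DIF}$ is the category of these, with morphisms the algebra homomorphisms commuting with the derivations. A Rota-Baxter operator (of weight $\lambda$) on $R$ is a $\mathbf k$-linear $P:R\to R$ with $P(x)P(y)=P(xP(y))+P(yP(x))+\lambda P(xy)$. A differential Rota-Baxter algebra (of weight $\lambda$) is a triple $(R,d,P)$ with $d$ a $\lambda$-derivation, $P$ a Rota-Baxter operator, and $d\circ P=\mathrm{id}_R$; morphisms are algebra homomorphisms commuting with both operators. $\mathbf{DRB}$ is the resulting category and $U':\mathbf{DRB}\to\mathbf{DIF}$, $U'(R,d,P)=(R,d)$, the forgetful functor. For an algebra $A$, $\mathrm{Sha}(A)=\bigoplus_{i\ge1}A^{\otimes i}$ as a module, with product $\diamond$ defined for $\mathfrak a=a_0\otimes\cdots\otimes a_m$, $\mathfrak b=b_0\otimes\cdots\otimes b_n$ by: $\mathfrak a\diamond\mathfrak b=a_0b_0\otimes b_1\otimes\cdots\otimes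 b_n$ if $m=0$; $\mathfrak a\diamond\mathfrak b=a_0b_0\otimes a_1\otimes\cdots\otimes a_m$ if $n=0$; and, if $m,n>0$, recursively, $\mathfrak a\diamond\mathfrak b=(a_0b_0)\otimes\big((a_1\otimes\cdots\otimes a_m)\diamond(\mathbf 1_A\otimes b_1\otimes\cdots\otimes b_n)+(\mathbf 1_A\otimes a_1\otimes\cdots\otimes a_m)\diamond(b_1\otimes\cdots\otimes b_n)+\lambda(a_1\otimes\cdots\otimes a_m)\diamond(b_1\otimes\cdots\otimes b_n)\big)$. $P_A(x_0\otimes\cdots\otimes x_n)=\mathbf 1_A\otimes x_0\otimes\cdots\otimes x_n$. For a $\lambda$-derivation $d$ on $A$, define the linear map $\widehat d:\mathrm{Sha}(A)\to\mathrm{Sha}(A)$ by $\widehat d(x_0)=d(x_0)$ and, for $n\ge1$, $\widehat d(x_0\otimes x_1\otimes\cdots\otimes x_n)=d(x_0)\otimes x_1\otimes\cdots\otimes x_n+x_0x_1\otimes x_2\otimes\cdots\otimes x_n+\lambda d(x_0)x_1\otimes x_2\otimes\cdots\otimes x_n$. It is known that $(\mathrm{Sha}(A),\widehat d,P_A)$ with the inclusion $A\to\mathrm{Sha}(A)$ is the free differential Rota-Baxter algebra on $(A,d)$; so $F'(A,d)=(\mathrm{Sha}(A),\widehat d,P_A)$ (applying a morphism to each tensor factor) is left adjoint to $U'$, with unit $\eta'$ the inclusion and counit $\varepsilon'_{(R,D,P)}(a_0\otimes\cdots\otimes a_n)=a_0P(a_1P(\cdots P(a_n)\cdots))$. The resulting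 monad on $\mathbf{DIF}$ is $\mathbf T'=\langle T',\eta',\mu'\rangle$ with $T'=U'F':\mathbf{DIF}\to\mathbf{DIF}$ and $\mu'=U'\varepsilon'F'$. $\mathbf{DIF}^{\mathbf T'}$ is the category of $\mathbf T'$-algebras, and the comparison functor is $K'(R,D,P)=\langle(R,D),U'(\varepsilon'_{(R,D,P)})\rangle$, the identity on underlying algebra homomorphisms. *)

theory Defs
  imports "HOL-Algebra.Module" "HOL-Algebra.AbelCoset" "HOL-Algebra.RingHom"
begin

section \<open>Categories and isomorphisms of categories\<close>

text \<open>
  A category is given by a set of objects, hom-sets, identities and composition;
  \<open>cmp C X Y Z g f\<close> is the composite of \<open>f\<close> from \<open>X\<close> to \<open>Y\<close> and \<open>g\<close> from \<open>Y\<close> to \<open>Z\<close>.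
\<close>

record ('o, 'm) cat =
  Ob :: "'o set"
  Hom :: "'o \<Rightarrow> 'o \<Rightarrow> 'm set"
  idm :: "'o \<Rightarrow> 'm"
  cmp :: "'o \<Rightarrow> 'o \<Rightarrow> 'o \<Rightarrow> 'm \<Rightarrow> 'm \<Rightarrow> 'm"

definition is_category :: "('o, 'm) cat \<Rightarrow> bool" where
  "is_category C \<longleftrightarrow>
    (\<forall>X\<in>Ob C. idm C X \<in> Hom C X X) \<and>
    (\<forall>X\<in>Ob C. \<forall>Y\<in>Ob C. \<forall>Z\<in>Ob C. \<forall>f\<in>Hom C X Y. \<forall>g\<in>Hom C Y Z. cmp C X Y Z g f \<in> Hom C X Z) \<and>
    (\<forall>X\<in>Ob C. \<forall>Y\<in>Ob C. \<forall>f\<in>Hom C X Y. cmp C X X Y f (idm C X) = f \<and> cmp C X Y Y (idm C Y) f = f) \<and>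
    (\<forall>W\<in>Ob C. \<forall>X\<in>Ob C. \<forall>Y\<in>Ob C. \<forall>Z\<in>Ob C. \<forall>f\<in>Hom C W X. \<forall>g\<in>Hom C X Y. \<forall>h\<in>Hom C Y Z.
      cmp C W X Z (cmp C X Y Z h g) f = cmp C W Y Z h (cmp C W X Y g f))"

definition is_functor ::
  "('o, 'm) cat \<Rightarrow> ('p, 'n) cat \<Rightarrow> ('o \<Rightarrow> 'p) \<Rightarrow> ('o \<Rightarrow> 'o \<Rightarrow> 'm \<Rightarrow> 'n) \<Rightarrow> bool" where
  "is_functor C D Fo Fm \<longleftrightarrow>
    is_category C \<and> is_category D \<and>
    (\<forall>X\<in>Ob C. Fo X \<in> Ob D) \<and>
    (\<forall>X\<in>Ob C. \<forall>Y\<in>Ob C. \<forall>f\<in>Hom C X Y. Fm X Y f \<in> Hom D (Fo X) (Fo Y)) \<and>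
    (\<forall>X\<in>Ob C. Fm X X (idm C X) = idm D (Fo X)) \<and>
    (\<forall>X\<in>Ob C. \<forall>Y\<in>Ob C. \<forall>Z\<in>Ob C. \<forall>f\<in>Hom C X Y. \<forall>g\<in>Hom C Y Z.
      Fm X Z (cmp C X Y Z g f) = cmp D (Fo X) (Fo Y) (Fo Z) (Fm Y Z g) (Fm X Y f))"

definition is_cat_iso ::
  "('o, 'm) cat \<Rightarrow> ('p, 'n) cat \<Rightarrow> ('o \<Rightarrow> 'p) \<Rightarrow> ('o \<Rightarrow> 'o \<Rightarrow> 'm \<Rightarrow> 'n) \<Rightarrow> bool" where
  "is_cat_iso C D Fo Fm \<longleftrightarrow>
    is_functor C D Fo Fm \<and>
    (\<exists>Go Gm. is_functor D C Go Gm \<and>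
      (\<forall>X\<in>Ob C. Go (Fo X) = X) \<and>
      (\<forall>X\<in>Ob D. Fo (Go X) = X) \<and>
      (\<forall>X\<in>Ob C. \<forall>Y\<in>Ob C. \<forall>f\<in>Hom C X Y. Gm (Fo X) (Fo Y) (Fm X Y f) = f) \<and>
      (\<forall>X\<in>Ob D. \<forall>Y\<in>Ob D. \<forall>f\<in>Hom D X Y. Fm (Go X) (Go Y) (Gm X Y f) = f))"


section \<open>Differential and differential Rota-Baxter algebras\<close>

text \<open>
  Algebras are instances of the library locale \<^locale>\<open>algebra\<close> (commutative, with identity).
  Operators and morphisms are functions that are \<^const>\<open>undefined\<close> outside the carrier, so that
  equality of HOL functions is equality of the maps they represent.
\<close>

definition linear_maps ::
  "('k, 'e) ring_scheme \<Rightarrow> ('k, 'a, 'm) module_scheme \<Rightarrow> ('k, 'b, 'n) module_scheme \<Rightarrow> ('a \<Rightarrow> 'b) set" where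
  "linear_maps K M N =
    {h \<in> carrier M \<rightarrow>\<^sub>E carrier N.
      (\<forall>x\<in>carrier M. \<forall>y\<in>carrier M. h (x \<oplus>\<^bsub>M\<^esub> y) = h x \<oplus>\<^bsub>N\<^esub> h y) \<and>
      (\<forall>c\<in>carrier K. \<forall>x\<in>carrier M. h (c \<odot>\<^bsub>M\<^esub> x) = c \<odot>\<^bsub>N\<^esub> h x)}"

definition algebra_homs ::
  "('k, 'e) ring_scheme \<Rightarrow> ('k, 'a, 'm) module_scheme \<Rightarrow> ('k, 'b, 'n) module_scheme \<Rightarrow> ('a \<Rightarrow> 'b) set" where
  "algebra_homs K R S = linear_maps K R S \<inter> ring_hom R S"

record ('k, 'a) dif_alg = "('k, 'a) module" +
  der :: "'a \<Rightarrow> 'a"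

record ('k, 'a) drb_alg = "('k, 'a) dif_alg" +
  rb :: "'a \<Rightarrow> 'a"

definition is_derivation ::
  "('k, 'e) ring_scheme \<Rightarrow> 'k \<Rightarrow> ('k, 'a, 'm) module_scheme \<Rightarrow> ('a \<Rightarrow> 'a) \<Rightarrow> bool" where
  "is_derivation K lam R d \<longleftrightarrow>
    d \<in> linear_maps K R R \<and>
    (\<forall>x\<in>carrier R. \<forall>y\<in>carrier R.
      d (x \<otimes>\<^bsub>R\<^esub> y) = d x \<otimes>\<^bsub>R\<^esub> y \<oplus>\<^bsub>R\<^esub> x \<otimes>\<^bsub>R\<^esub> d y \<oplus>\<^bsub>R\<^esub> lam \<odot>\<^bsub>R\<^esub> (d x \<otimes>\<^bsub>R\<^esub> d y)) \<and>
    d \<one>\<^bsub>R\<^esub> = \<zero>\<^bsub>R\<^esub>"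

definition is_rota_baxter ::
  "('k, 'e) ring_scheme \<Rightarrow> 'k \<Rightarrow> ('k, 'a, 'm) module_scheme \<Rightarrow> ('a \<Rightarrow> 'a) \<Rightarrow> bool" where
  "is_rota_baxter K lam R P \<longleftrightarrow>
    P \<in> linear_maps K R R \<and>
    (\<forall>x\<in>carrier R. \<forall>y\<in>carrier R.
      P x \<otimes>\<^bsub>R\<^esub> P y = P (x \<otimes>\<^bsub>R\<^esub> P y) \<oplus>\<^bsub>R\<^esub> P (y \<otimes>\<^bsub>R\<^esub> P x) \<oplus>\<^bsub>R\<^esub> lam \<odot>\<^bsub>R\<^esub> P (x \<otimes>\<^bsub>R\<^esub> y))"

definition dif_algs :: "('k, 'e) ring_scheme \<Rightarrow> 'k \<Rightarrow> ('k, 'a) dif_alg set" where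
  "dif_algs K lam = {A. algebra K A \<and> is_derivation K lam A (der A)}"

definition drb_algs :: "('k, 'e) ring_scheme \<Rightarrow> 'k \<Rightarrow> ('k, 'a) drb_alg set" where
  "drb_algs K lam =
    {X. algebra K X \<and> is_derivation K lam X (der X) \<and> is_rota_baxter K lam X (rb X) \<and>
        (\<forall>x\<in>carrier X. der X (rb X x) = x)}"

definition dif_homs ::
  "('k, 'e) ring_scheme \<Rightarrow> ('k, 'a, 'm) dif_alg_scheme \<Rightarrow> ('k, 'b, 'n) dif_alg_scheme \<Rightarrow> ('a \<Rightarrow> 'b) set" where
  "dif_homs K A B = {f \<in> algebra_homs K A B. \<forall>x\<in>carrier A. f (der A x) = der B (f x)}"

definition drb_homs ::
  "('k, 'e) ring_scheme \<Rightarrow> ('k, 'a) drb_alg \<Rightarrow> ('k, 'b) drb_alg \<Rightarrow> ('a \<Rightarrow> 'b) set" where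
  "drb_homs K X Y = {f \<in> dif_homs K X Y. \<forall>x\<in>carrier X. f (rb X x) = rb Y (f x)}"

definition DRB :: "('k, 'e) ring_scheme \<Rightarrow> 'k \<Rightarrow> (('k, 'a) drb_alg, 'a \<Rightarrow> 'a) cat" where
  "DRB K lam =
    \<lparr>Ob = drb_algs K lam,
     Hom = drb_homs K,
     idm = (\<lambda>X. \<lambda>x\<in>carrier X. x),
     cmp = (\<lambda>X Y Z g f. compose (carrier X) g f)\<rparr>"

definition forget :: "('k, 'a) drb_alg \<Rightarrow> ('k, 'a) dif_alg" where
  "forget X = dif_alg.truncate X"


section \<open>Tensor powers and direct sums of modules\<close>

text \<open>
  A module is a \<^typ>\<open>('k, 'a) module\<close> record of which only the additive part and the scalar
  multiplication matter; the fields \<^const>\<open>mult\<close> and \<^const>\<open>one\<close> are then left unspecified.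
\<close>

definition free_module :: "('k, 'e) ring_scheme \<Rightarrow> 'w set \<Rightarrow> ('k, 'w \<Rightarrow> 'k) module" where
  "free_module K W =
    \<lparr>carrier = {f. (\<forall>w\<in>W. f w \<in> carrier K) \<and> (\<forall>w. w \<notin> W \<longrightarrow> f w = \<zero>\<^bsub>K\<^esub>) \<and> finite {w. f w \<noteq> \<zero>\<^bsub>K\<^esub>}},
     mult = undefined, one = undefined,
     zero = (\<lambda>w. \<zero>\<^bsub>K\<^esub>),
     add = (\<lambda>f g w. f w \<oplus>\<^bsub>K\<^esub> g w),
     smult = (\<lambda>c f w. c \<otimes>\<^bsub>K\<^esub> f w)\<rparr>"

definition free_gen :: "('k, 'e) ring_scheme \<Rightarrow> 'w \<Rightarrow> 'w \<Rightarrow> 'k" where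
  "free_gen K w = (\<lambda>v. if v = w then \<one>\<^bsub>K\<^esub> else \<zero>\<^bsub>K\<^esub>)"

definition span_module :: "('k, 'e) ring_scheme \<Rightarrow> ('k, 'a, 'm) module_scheme \<Rightarrow> 'a set \<Rightarrow> 'a set" where
  "span_module K M B = \<Inter> {H. submodule H K M \<and> B \<subseteq> H}"

definition quotient_module :: "('k, 'a, 'm) module_scheme \<Rightarrow> 'a set \<Rightarrow> ('k, 'a set) module" where
  "quotient_module M N =
    \<lparr>carrier = a_rcosets\<^bsub>M\<^esub> N,
     mult = undefined, one = undefined,
     zero = N,
     add = set_add M,
     smult = (\<lambda>c X. \<Union>x\<in>X. N +>\<^bsub>M\<^esub> (c \<odot>\<^bsub>M\<^esub> x))\<rparr>"

definition direct_sum :: "'i set \<Rightarrow> ('i \<Rightarrow> ('k, 'a) module) \<Rightarrow> ('k, 'i \<Rightarrow> 'a) module" where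
  "direct_sum I M =
    \<lparr>carrier = {x \<in> (\<Pi>\<^sub>E i\<in>I. carrier (M i)). finite {i\<in>I. x i \<noteq> \<zero>\<^bsub>M i\<^esub>}},
     mult = undefined, one = undefined,
     zero = (\<lambda>i\<in>I. \<zero>\<^bsub>M i\<^esub>),
     add = (\<lambda>x y. \<lambda>i\<in>I. x i \<oplus>\<^bsub>M i\<^esub> y i),
     smult = (\<lambda>c x. \<lambda>i\<in>I. c \<odot>\<^bsub>M i\<^esub> x i)\<rparr>"

text \<open>
  The \<open>n\<close>-th tensor power: the free module on the \<open>n\<close>-tuples of elements (lists of length
  \<open>n\<close>) modulo additivity and homogeneity in each slot.
\<close>

definition tuples :: "('k, 'a, 'm) module_scheme \<Rightarrow> nat \<Rightarrow> 'a list set" where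
  "tuples A n = {w. length w = n \<and> set w \<subseteq> carrier A}"

definition tensor_free :: "('k, 'e) ring_scheme \<Rightarrow> ('k, 'a, 'm) module_scheme \<Rightarrow> nat \<Rightarrow> ('k, 'a list \<Rightarrow> 'k) module" where
  "tensor_free K A n = free_module K (tuples A n)"

definition tensor_rels :: "('k, 'e) ring_scheme \<Rightarrow> ('k, 'a, 'm) module_scheme \<Rightarrow> nat \<Rightarrow> ('a list \<Rightarrow> 'k) set" where
  "tensor_rels K A n =
    {free_gen K (u @ (x \<oplus>\<^bsub>A\<^esub> y) # v)
        \<ominus>\<^bsub>tensor_free K A n\<^esub> (free_gen K (u @ x # v) \<oplus>\<^bsub>tensor_free K A n\<^esub> free_gen K (u @ y # v))
      | u v x y. u @ x # v \<in> tuples A n \<and> y \<in> carrier A} \<union>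
    {free_gen K (u @ (c \<odot>\<^bsub>A\<^esub> x) # v)
        \<ominus>\<^bsub>tensor_free K A n\<^esub> (c \<odot>\<^bsub>tensor_free K A n\<^esub> free_gen K (u @ x # v))
      | u v x c. u @ x # v \<in> tuples A n \<and> c \<in> carrier K}"

definition tensor_kernel :: "('k, 'e) ring_scheme \<Rightarrow> ('k, 'a, 'm) module_scheme \<Rightarrow> nat \<Rightarrow> ('a list \<Rightarrow> 'k) set" where
  "tensor_kernel K A n = span_module K (tensor_free K A n) (tensor_rels K A n)"

definition tensor_power :: "('k, 'e) ring_scheme \<Rightarrow> ('k, 'a, 'm) module_scheme \<Rightarrow> nat \<Rightarrow> ('k, ('a list \<Rightarrow> 'k) set) module" where
  "tensor_power K A n = quotient_module (tensor_free K A n) (tensor_kernel K A n)"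


section \<open>The algebra \<open>Sha(A)\<close>\<close>

type_synonym ('k, 'a) sha = "nat \<Rightarrow> ('a list \<Rightarrow> 'k) set"

definition sha_module :: "('k, 'e) ring_scheme \<Rightarrow> ('k, 'a, 'm) module_scheme \<Rightarrow> ('k, ('k, 'a) sha) module" where
  "sha_module K A = direct_sum {1..} (tensor_power K A)"

definition words :: "('k, 'a, 'm) module_scheme \<Rightarrow> 'a list set" where
  "words A = {w. w \<noteq> [] \<and> set w \<subseteq> carrier A}"

text \<open>\<open>pure K A [a\<^sub>0, \<dots>, a\<^sub>n]\<close> is the pure tensor \<open>a\<^sub>0 \<otimes> \<dots> \<otimes> a\<^sub>n\<close>, of tensor degree \<open>n + 1\<close>.\<close>

definition pure :: "('k, 'e) ring_scheme \<Rightarrow> ('k, 'a, 'm) module_scheme \<Rightarrow> 'a list \<Rightarrow> ('k, 'a) sha" where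
  "pure K A w = (\<lambda>i\<in>{1..}.
     if i = length w then tensor_kernel K A i +>\<^bsub>tensor_free K A i\<^esub> free_gen K w
     else \<zero>\<^bsub>tensor_power K A i\<^esub>)"

text \<open>
  \<open>lin_ext K A M \<phi>\<close> is the linear map from \<open>Sha(A)\<close> to \<open>M\<close> with prescribed values \<open>\<phi> w\<close> on pure
  tensors. It is unique because these span, and it exists iff \<open>\<phi>\<close> takes values in \<open>M\<close> and is
  multilinear on the words of each fixed length, as is the case wherever it is used below.
\<close>

definition lin_ext ::
  "('k, 'e) ring_scheme \<Rightarrow> ('k, 'a, 'm) module_scheme \<Rightarrow> ('k, 'b, 'n) module_scheme \<Rightarrow>
   ('a list \<Rightarrow> 'b) \<Rightarrow> ('k, 'a) sha \<Rightarrow> 'b" where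
  "lin_ext K A M \<phi> =
    (THE h. h \<in> linear_maps K (sha_module K A) M \<and> (\<forall>w\<in>words A. h (pure K A w) = \<phi> w))"

definition prepend ::
  "('k, 'e) ring_scheme \<Rightarrow> ('k, 'a, 'm) module_scheme \<Rightarrow> 'a \<Rightarrow> ('k, 'a) sha \<Rightarrow> ('k, 'a) sha" where
  "prepend K A a = lin_ext K A (sha_module K A) (\<lambda>w. pure K A (a # w))"

function sha_word_mult ::
  "('k, 'e) ring_scheme \<Rightarrow> 'k \<Rightarrow> ('k, 'a, 'm) module_scheme \<Rightarrow> 'a list \<Rightarrow> 'a list \<Rightarrow> ('k, 'a) sha" where
  "sha_word_mult K lam A [a0] (b0 # v) = pure K A ((a0 \<otimes>\<^bsub>A\<^esub> b0) # v)"
| "sha_word_mult K lam A (a0 # a1 # u) [b0] = pure K A ((a0 \<otimes>\<^bsub>A\<^esub> b0) # a1 # u)"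
| "sha_word_mult K lam A (a0 # a1 # u) (b0 # b1 # v) =
     prepend K A (a0 \<otimes>\<^bsub>A\<^esub> b0)
       (sha_word_mult K lam A (a1 # u) (\<one>\<^bsub>A\<^esub> # b1 # v)
        \<oplus>\<^bsub>sha_module K A\<^esub> sha_word_mult K lam A (\<one>\<^bsub>A\<^esub> # a1 # u) (b1 # v)
        \<oplus>\<^bsub>sha_module K A\<^esub> lam \<odot>\<^bsub>sha_module K A\<^esub> sha_word_mult K lam A (a1 # u) (b1 # v))"
| "sha_word_mult K lam A [] w = \<zero>\<^bsub>sha_module K A\<^esub>"
| "sha_word_mult K lam A (a # u) [] = \<zero>\<^bsub>sha_module K A\<^esub>"
  by pat_completeness auto
termination
  by (relation "measure (\<lambda>(K, lam, A, u, v). length u + length v)") auto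

definition sha_mult ::
  "('k, 'e) ring_scheme \<Rightarrow> 'k \<Rightarrow> ('k, 'a, 'm) module_scheme \<Rightarrow>
   ('k, 'a) sha \<Rightarrow> ('k, 'a) sha \<Rightarrow> ('k, 'a) sha" where
  "sha_mult K lam A x y =
    lin_ext K A (sha_module K A)
      (\<lambda>u. lin_ext K A (sha_module K A) (\<lambda>v. sha_word_mult K lam A u v) y) x"

fun dhat_word ::
  "('k, 'e) ring_scheme \<Rightarrow> 'k \<Rightarrow> ('k, 'a, 'm) dif_alg_scheme \<Rightarrow> 'a list \<Rightarrow> ('k, 'a) sha" where
  "dhat_word K lam A [x0] = pure K A [der A x0]"
| "dhat_word K lam A (x0 # x1 # w) =
     pure K A (der A x0 # x1 # w)
     \<oplus>\<^bsub>sha_module K A\<^esub> pure K A ((x0 \<otimes>\<^bsub>A\<^esub> x1) # w)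
     \<oplus>\<^bsub>sha_module K A\<^esub> lam \<odot>\<^bsub>sha_module K A\<^esub> pure K A ((der A x0 \<otimes>\<^bsub>A\<^esub> x1) # w)"
| "dhat_word K lam A [] = \<zero>\<^bsub>sha_module K A\<^esub>"


section \<open>The adjunction, its monad and the comparison functor\<close>

text \<open>
  The type of elements plays the role of the universe. Since \<open>Sha(A)\<close> lives on a different type
  than \<open>A\<close>, the free functor and the monad are polymorphic operations, and the categories \<open>DRB\<close>
  and \<open>DIF_T\<close> have as objects all algebras whose carrier is a subset of a given (arbitrary) type.
\<close>

definition free_drb :: "('k, 'e) ring_scheme \<Rightarrow> 'k \<Rightarrow> ('k, 'a) dif_alg \<Rightarrow> ('k, ('k, 'a) sha) drb_alg" where
  "free_drb K lam A =
    \<lparr>carrier = carrier (sha_module K A),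
     mult = sha_mult K lam A,
     one = pure K A [\<one>\<^bsub>A\<^esub>],
     zero = \<zero>\<^bsub>sha_module K A\<^esub>,
     add = add (sha_module K A),
     smult = smult (sha_module K A),
     der = lin_ext K A (sha_module K A) (dhat_word K lam A),
     rb = prepend K A \<one>\<^bsub>A\<^esub>\<rparr>"

definition free_map ::
  "('k, 'e) ring_scheme \<Rightarrow> ('k, 'a) dif_alg \<Rightarrow> ('k, 'b) dif_alg \<Rightarrow> ('a \<Rightarrow> 'b) \<Rightarrow> ('k, 'a) sha \<Rightarrow> ('k, 'b) sha" where
  "free_map K A B f = lin_ext K A (sha_module K B) (\<lambda>w. pure K B (map f w))"

definition eta :: "('k, 'e) ring_scheme \<Rightarrow> ('k, 'a) dif_alg \<Rightarrow> 'a \<Rightarrow> ('k, 'a) sha" where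
  "eta K A = (\<lambda>a\<in>carrier A. pure K A [a])"

fun counit_word :: "('k, 'a) drb_alg \<Rightarrow> 'a list \<Rightarrow> 'a" where
  "counit_word X [a] = a"
| "counit_word X (a # b # w) = a \<otimes>\<^bsub>X\<^esub> rb X (counit_word X (b # w))"
| "counit_word X [] = \<zero>\<^bsub>X\<^esub>"

definition counit :: "('k, 'e) ring_scheme \<Rightarrow> ('k, 'a) drb_alg \<Rightarrow> ('k, 'a) sha \<Rightarrow> 'a" where
  "counit K X = lin_ext K X X (counit_word X)"

definition T_obj :: "('k, 'e) ring_scheme \<Rightarrow> 'k \<Rightarrow> ('k, 'a) dif_alg \<Rightarrow> ('k, ('k, 'a) sha) dif_alg" where
  "T_obj K lam A = forget (free_drb K lam A)"

definition T_map ::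
  "('k, 'e) ring_scheme \<Rightarrow> ('k, 'a) dif_alg \<Rightarrow> ('k, 'b) dif_alg \<Rightarrow> ('a \<Rightarrow> 'b) \<Rightarrow> ('k, 'a) sha \<Rightarrow> ('k, 'b) sha" where
  "T_map K A B f = free_map K A B f"

definition mu ::
  "('k, 'e) ring_scheme \<Rightarrow> 'k \<Rightarrow> ('k, 'a) dif_alg \<Rightarrow> ('k, ('k, 'a) sha) sha \<Rightarrow> ('k, 'a) sha" where
  "mu K lam A = counit K (free_drb K lam A)"

definition T_algs ::
  "('k, 'e) ring_scheme \<Rightarrow> 'k \<Rightarrow> (('k, 'a) dif_alg \<times> (('k, 'a) sha \<Rightarrow> 'a)) set" where
  "T_algs K lam =
    {(A, h). A \<in> dif_algs K lam \<and>
      h \<in> dif_homs K (T_obj K lam A) A \<and>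
      compose (carrier A) h (eta K A) = (\<lambda>a\<in>carrier A. a) \<and>
      compose (carrier (T_obj K lam (T_obj K lam A))) h (T_map K (T_obj K lam A) A h) =
      compose (carrier (T_obj K lam (T_obj K lam A))) h (mu K lam A)}"

definition T_homs ::
  "('k, 'e) ring_scheme \<Rightarrow> 'k \<Rightarrow> ('k, 'a) dif_alg \<times> (('k, 'a) sha \<Rightarrow> 'a) \<Rightarrow>
   ('k, 'b) dif_alg \<times> (('k, 'b) sha \<Rightarrow> 'b) \<Rightarrow> ('a \<Rightarrow> 'b) set" where
  "T_homs K lam = (\<lambda>(A, h) (B, k).
    {f \<in> dif_homs K A B.
      compose (carrier (T_obj K lam A)) f h = compose (carrier (T_obj K lam A)) k (T_map K A B f)})"

definition DIF_T ::
  "('k, 'e) ring_scheme \<Rightarrow> 'k \<Rightarrow> (('k, 'a) dif_alg \<times> (('k, 'a) sha \<Rightarrow> 'a), 'a \<Rightarrow> 'a) cat" where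
  "DIF_T K lam =
    \<lparr>Ob = T_algs K lam,
     Hom = T_homs K lam,
     idm = (\<lambda>(A, h). \<lambda>x\<in>carrier A. x),
     cmp = (\<lambda>(A, h) Y Z g f. compose (carrier A) g f)\<rparr>"

definition comparison_obj ::
  "('k, 'e) ring_scheme \<Rightarrow> ('k, 'a) drb_alg \<Rightarrow> ('k, 'a) dif_alg \<times> (('k, 'a) sha \<Rightarrow> 'a)" where
  "comparison_obj K X = (forget X, counit K X)"

definition comparison_map :: "('k, 'a) drb_alg \<Rightarrow> ('k, 'a) drb_alg \<Rightarrow> ('a \<Rightarrow> 'a) \<Rightarrow> 'a \<Rightarrow> 'a" where
  "comparison_map X Y f = f"

end

theory Submission
  imports Defs
begin

text \<open>
  Write \<open>P\<close> for the operator that puts \<open>1\<close> in front of a tensor. Every pure tensor of degree at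
  least two is \<open>a \<diamondop> P t\<close> with \<open>a \<in> A\<close> and \<open>t\<close> of smaller degree, the product is \<open>A\<close>-bilinear for
  multiplication on the first factor, and on tensors starting with \<open>1\<close> its recursion reads
  \<open>P s \<diamondop> P t = P (s \<diamondop> P t + P s \<diamondop> t + lam (s \<diamondop> t))\<close>. These three facts determine everything about
  \<open>Sha(A)\<close>, once linear maps out of it can be defined on pure tensors (\<open>lin_ext\<close>).

  Associativity follows by induction on total degree: factors from \<open>A\<close> can be pulled out of a triple
  product (\<open>assoc_scale\<close>), and \<open>P s \<diamondop> P t \<diamondop> P r\<close>, bracketed either way, expands into the same seven
  triple products of smaller degree (\<open>assoc_P\<close>). The twisted Leibniz rule needs no induction.
  If it holds for \<open>(x, y)\<close> and \<open>(y, z)\<close>, then it holds for \<open>(x, y z)\<close> iff it holds for \<open>(x y, z)\<close>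
  (\<open>leibniz_shift\<close>); so it is enough to know it when one argument lies in \<open>A\<close>, and for
  \<open>(P s, P t)\<close>, where it is immediate from the product formula and \<open>d \<circ> P = id\<close>.

  Freeness holds because \<open>A\<close> generates \<open>Sha(A)\<close> under the product and \<open>P\<close>: a morphism extending \<open>f\<close>
  must send \<open>a\<^sub>0 \<otimes> \<dots> \<otimes> a\<^sub>n\<close> to \<open>f a\<^sub>0 P (f a\<^sub>1 P (\<dots>))\<close>, and this is multiplicative because the recursion
  for \<open>\<diamondop>\<close> is the Rota-Baxter identity of the target (\<open>extend_word_mult\<close>).

  For the comparison functor, a \<open>T\<close>-algebra \<open>(A, h)\<close> gets the operator \<open>x \<mapsto> h (1 \<otimes> x)\<close>. The
  multiplication law of \<open>h\<close>, applied to the word \<open>[1, s]\<close> over \<open>Sha(A)\<close>, says that \<open>h\<close> intertwines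
  \<open>P\<close> with this operator (\<open>h_P\<close>). So the Rota-Baxter identity and \<open>d \<circ> P = id\<close> descend along the
  surjective homomorphism \<open>h\<close>, and \<open>h\<close> is forced to be the counit of the algebra obtained. On
  morphisms, compatibility with \<open>h\<close> evaluated at \<open>1 \<otimes> x\<close> is compatibility with the Rota-Baxter
  operators, so the two categories have the same hom-sets.
\<close>

section \<open>Linear maps\<close>

lemma linear_mapsI:
  assumes "h \<in> carrier M \<rightarrow>\<^sub>E carrier N"
    and "\<And>x y. x \<in> carrier M \<Longrightarrow> y \<in> carrier M \<Longrightarrow> h (x \<oplus>\<^bsub>M\<^esub> y) = h x \<oplus>\<^bsub>N\<^esub> h y"
    and "\<And>c x. c \<in> carrier K \<Longrightarrow> x \<in> carrier M \<Longrightarrow> h (c \<odot>\<^bsub>M\<^esub> x) = c \<odot>\<^bsub>N\<^esub> h x"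
  shows "h \<in> linear_maps K M N"
  using assms unfolding linear_maps_def by blast

lemma linear_mapsD:
  assumes "h \<in> linear_maps K M N"
  shows "h \<in> carrier M \<rightarrow>\<^sub>E carrier N"
    and "x \<in> carrier M \<Longrightarrow> h x \<in> carrier N"
    and "x \<in> carrier M \<Longrightarrow> y \<in> carrier M \<Longrightarrow> h (x \<oplus>\<^bsub>M\<^esub> y) = h x \<oplus>\<^bsub>N\<^esub> h y"
    and "c \<in> carrier K \<Longrightarrow> x \<in> carrier M \<Longrightarrow> h (c \<odot>\<^bsub>M\<^esub> x) = c \<odot>\<^bsub>N\<^esub> h x"
  using assms unfolding linear_maps_def by auto

lemma linear_map_zero:
  assumes "module K M" "module K N" "h \<in> linear_maps K M N"
  shows "h \<zero>\<^bsub>M\<^esub> = \<zero>\<^bsub>N\<^esub>"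
proof -
  interpret M: module K M by fact
  interpret N: module K N by fact
  have "h \<zero>\<^bsub>M\<^esub> = h (\<zero>\<^bsub>K\<^esub> \<odot>\<^bsub>M\<^esub> \<zero>\<^bsub>M\<^esub>)" by simp
  also have "\<dots> = \<zero>\<^bsub>K\<^esub> \<odot>\<^bsub>N\<^esub> h \<zero>\<^bsub>M\<^esub>"
    by (rule linear_mapsD(4)[OF assms(3)]) auto
  also have "\<dots> = \<zero>\<^bsub>N\<^esub>" using linear_mapsD(2)[OF assms(3)] by simp
  finally show ?thesis .
qed

lemma linear_map_neg:
  assumes "module K M" "module K N" "h \<in> linear_maps K M N" "x \<in> carrier M"
  shows "h (\<ominus>\<^bsub>M\<^esub> x) = \<ominus>\<^bsub>N\<^esub> h x"
proof -
  interpret M: module K M by fact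
  interpret N: module K N by fact
  have "h (\<ominus>\<^bsub>M\<^esub> x) \<oplus>\<^bsub>N\<^esub> h x = h (\<ominus>\<^bsub>M\<^esub> x \<oplus>\<^bsub>M\<^esub> x)"
    using linear_mapsD(3)[OF assms(3)] assms(4) by simp
  also have "\<dots> = \<zero>\<^bsub>N\<^esub>" using linear_map_zero assms by (metis M.M.l_neg)
  finally show ?thesis
    using linear_mapsD(2)[OF assms(3)] assms(4) by (metis M.M.a_inv_closed N.M.minus_equality)
qed

lemma linear_maps_compose:
  assumes "f \<in> linear_maps K L M" "g \<in> linear_maps K M N" "module K L"
  shows "compose (carrier L) g f \<in> linear_maps K L N"
proof -
  interpret L: module K L by fact
  show ?thesis
    by (rule linear_mapsI)
      (use linear_mapsD[OF assms(1)] linear_mapsD[OF assms(2)] in \<open>auto simp: compose_def\<close>)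
qed


section \<open>Free modules, quotients and direct sums\<close>

lemma free_module_simps:
  "\<zero>\<^bsub>free_module K W\<^esub> = (\<lambda>w. \<zero>\<^bsub>K\<^esub>)"
  "f \<oplus>\<^bsub>free_module K W\<^esub> g = (\<lambda>w. f w \<oplus>\<^bsub>K\<^esub> g w)"
  "c \<odot>\<^bsub>free_module K W\<^esub> f = (\<lambda>w. c \<otimes>\<^bsub>K\<^esub> f w)"
  by (simp_all add: free_module_def)

lemma free_module_carrier:
  "f \<in> carrier (free_module K W) \<longleftrightarrow>
    (\<forall>w\<in>W. f w \<in> carrier K) \<and> (\<forall>w. w \<notin> W \<longrightarrow> f w = \<zero>\<^bsub>K\<^esub>) \<and> finite {w. f w \<noteq> \<zero>\<^bsub>K\<^esub>}"
  by (simp add: free_module_def)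

lemma free_moduleI:
  assumes "\<And>w. w \<in> W \<Longrightarrow> f w \<in> carrier K" "finite F" "F \<subseteq> W" "\<And>w. w \<notin> F \<Longrightarrow> f w = \<zero>\<^bsub>K\<^esub>"
  shows "f \<in> carrier (free_module K W)"
proof -
  have "{w. f w \<noteq> \<zero>\<^bsub>K\<^esub>} \<subseteq> F" using assms by auto
  then show ?thesis using assms by (auto simp: free_module_carrier intro: finite_subset)
qed

lemma free_module_module:
  assumes "cring K" shows "module K (free_module K W)"
proof -
  interpret K: cring K by fact
  have val: "f w \<in> carrier K" if "f \<in> carrier (free_module K W)" for f w
    using that by (cases "w \<in> W") (auto simp: free_module_carrier)
  let ?S = "\<lambda>f. {w. f w \<noteq> \<zero>\<^bsub>K\<^esub>}"
  have add: "(\<lambda>w. f w \<oplus>\<^bsub>K\<^esub> g w) \<in> carrier (free_module K W)"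
    if "f \<in> carrier (free_module K W)" "g \<in> carrier (free_module K W)" for f g
    by (rule free_moduleI[where F = "?S f \<union> ?S g"])
      (use that val in \<open>auto simp: free_module_carrier\<close>)
  have scl: "(\<lambda>w. c \<otimes>\<^bsub>K\<^esub> f w) \<in> carrier (free_module K W)"
    if "f \<in> carrier (free_module K W)" "c \<in> carrier K" for f c
    by (rule free_moduleI[where F = "?S f"]) (use that val in \<open>auto simp: free_module_carrier\<close>)
  show ?thesis
  proof (rule moduleI)
    show "abelian_group (free_module K W)"
    proof (rule abelian_groupI)
      fix x assume x: "x \<in> carrier (free_module K W)"
      have "(\<lambda>w. \<ominus>\<^bsub>K\<^esub> \<one>\<^bsub>K\<^esub> \<otimes>\<^bsub>K\<^esub> x w) \<in> carrier (free_module K W)" using scl x by simp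
      moreover have "(\<lambda>w. \<ominus>\<^bsub>K\<^esub> \<one>\<^bsub>K\<^esub> \<otimes>\<^bsub>K\<^esub> x w) \<oplus>\<^bsub>free_module K W\<^esub> x = \<zero>\<^bsub>free_module K W\<^esub>"
        using val[OF x] by (simp add: free_module_simps K.l_minus K.l_neg)
      ultimately show "\<exists>y\<in>carrier (free_module K W). y \<oplus>\<^bsub>free_module K W\<^esub> x = \<zero>\<^bsub>free_module K W\<^esub>"
        by blast
    qed (use add val in \<open>auto simp: free_module_simps free_module_carrier K.a_ac\<close>)
  qed (use assms add scl val in
    \<open>simp_all add: free_module_simps K.l_distr K.r_distr K.m_assoc\<close>)
qed

lemma free_gen_closed:
  assumes "cring K" "w \<in> W" shows "free_gen K w \<in> carrier (free_module K W)"
proof -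
  interpret K: cring K by fact
  show ?thesis
    by (rule free_moduleI[where F = "{w}"]) (use assms in \<open>auto simp: free_gen_def\<close>)
qed

text \<open>Resetting a finitely supported function to zero at one point of its support splits off a multiple
  of a generator, so the support can be emptied one point at a time.\<close>

lemma free_module_induct [consumes 2, case_names zero add gen]:
  assumes K: "cring K" and f: "f \<in> carrier (free_module K W)"
    and zero: "Q \<zero>\<^bsub>free_module K W\<^esub>"
    and add: "\<And>f g. f \<in> carrier (free_module K W) \<Longrightarrow> g \<in> carrier (free_module K W) \<Longrightarrow>
      Q f \<Longrightarrow> Q g \<Longrightarrow> Q (f \<oplus>\<^bsub>free_module K W\<^esub> g)"
    and gen: "\<And>c w. c \<in> carrier K \<Longrightarrow> w \<in> W \<Longrightarrow> Q (c \<odot>\<^bsub>free_module K W\<^esub> free_gen K w)"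
  shows "Q f"
proof -
  interpret K: cring K by fact
  interpret F: module K "free_module K W" by (rule free_module_module[OF K])
  have "Q f" if "finite F" "f \<in> carrier (free_module K W)" "{w. f w \<noteq> \<zero>\<^bsub>K\<^esub>} \<subseteq> F" for F f
    using that
  proof (induction F arbitrary: f rule: finite_induct)
    case empty
    then have "f = \<zero>\<^bsub>free_module K W\<^esub>" by (auto simp: free_module_simps)
    with zero show ?case by simp
  next
    case (insert v F)
    show ?case
    proof (cases "v \<in> W")
      case False
      then have "{w. f w \<noteq> \<zero>\<^bsub>K\<^esub>} \<subseteq> F"
        using insert.prems by (auto simp: free_module_carrier)
      with insert show ?thesis by blast
    next
      case True
      let ?g = "f(v := \<zero>\<^bsub>K\<^esub>)" and ?e = "f v \<odot>\<^bsub>free_module K W\<^esub> free_gen K v"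
      have fv: "f w \<in> carrier K" for w
        using insert.prems(1) by (cases "w \<in> W") (auto simp: free_module_carrier)
      have g: "?g \<in> carrier (free_module K W)"
        by (rule free_moduleI[where F = "{w. f w \<noteq> \<zero>\<^bsub>K\<^esub>}"])
          (use insert.prems fv in \<open>auto simp: free_module_carrier\<close>)
      have "Q ?g" by (rule insert.IH[OF g]) (use insert.prems in auto)
      moreover have "f = ?g \<oplus>\<^bsub>free_module K W\<^esub> ?e"
        using fv by (auto simp: free_module_simps free_gen_def)
      moreover have "?e \<in> carrier (free_module K W)"
        using free_gen_closed[OF K True] fv by simp
      ultimately show ?thesis using add[OF g] gen[OF fv True] by metis
    qed
  qed
  from this[of "{w. f w \<noteq> \<zero>\<^bsub>K\<^esub>}" f] f show ?thesis by (auto simp: free_module_carrier)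
qed

lemma free_module_ext:
  assumes K: "cring K" and N: "module K N" and \<phi>: "\<And>w. w \<in> W \<Longrightarrow> \<phi> w \<in> carrier N"
  shows "\<exists>h \<in> linear_maps K (free_module K W) N. \<forall>w\<in>W. h (free_gen K w) = \<phi> w"
proof -
  interpret N: module K N by fact
  interpret F: module K "free_module K W" by (rule free_module_module[OF K])
  let ?S = "\<lambda>f. {w. f w \<noteq> \<zero>\<^bsub>K\<^esub>}"
  define h where "h = (\<lambda>f\<in>carrier (free_module K W). \<Oplus>\<^bsub>N\<^esub>w\<in>?S f. f w \<odot>\<^bsub>N\<^esub> \<phi> w)"
  have supp: "?S f \<subseteq> W" "finite (?S f)" if "f \<in> carrier (free_module K W)" for f
    using that by (auto simp: free_module_carrier)
  have val: "f w \<in> carrier K" if "f \<in> carrier (free_module K W)" for f w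
    using that by (cases "w \<in> W") (auto simp: free_module_carrier)
  have h: "h f = (\<Oplus>\<^bsub>N\<^esub>w\<in>F. f w \<odot>\<^bsub>N\<^esub> \<phi> w)"
    if "f \<in> carrier (free_module K W)" "finite F" "?S f \<subseteq> F" "F \<subseteq> W" for f F
  proof -
    have "(\<Oplus>\<^bsub>N\<^esub>w\<in>?S f. f w \<odot>\<^bsub>N\<^esub> \<phi> w) = (\<Oplus>\<^bsub>N\<^esub>w\<in>F. f w \<odot>\<^bsub>N\<^esub> \<phi> w)"
      by (rule N.M.add.finprod_mono_neutral_cong_left)
        (use that val[OF that(1)] \<phi> in \<open>auto\<close>)
    then show ?thesis using that by (simp add: h_def)
  qed
  have "h \<in> linear_maps K (free_module K W) N"
  proof (rule linear_mapsI)
    show "h \<in> carrier (free_module K W) \<rightarrow>\<^sub>E carrier N"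
      unfolding h_def using supp(1) val \<phi>
      by (auto intro!: N.M.finsum_closed N.smult_closed simp: subset_eq)
  next
    fix f g assume fg: "f \<in> carrier (free_module K W)" "g \<in> carrier (free_module K W)"
    \<comment> \<open>The three supports involved differ, so all sums are taken over the union of those of \<open>f\<close> and \<open>g\<close>.\<close>
    let ?F = "?S f \<union> ?S g"
    have F: "?F \<subseteq> W" using supp(1) fg by blast
    have "h (f \<oplus>\<^bsub>free_module K W\<^esub> g) =
        (\<Oplus>\<^bsub>N\<^esub>w\<in>?F. (f \<oplus>\<^bsub>free_module K W\<^esub> g) w \<odot>\<^bsub>N\<^esub> \<phi> w)"
    proof (rule h)
      show "{w. (f \<oplus>\<^bsub>free_module K W\<^esub> g) w \<noteq> \<zero>\<^bsub>K\<^esub>} \<subseteq> ?F"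
        by (auto simp: free_module_simps)
    qed (use fg supp F in auto)
    also have "\<dots> = (\<Oplus>\<^bsub>N\<^esub>w\<in>?F. f w \<odot>\<^bsub>N\<^esub> \<phi> w \<oplus>\<^bsub>N\<^esub> g w \<odot>\<^bsub>N\<^esub> \<phi> w)"
      by (rule N.M.finsum_cong)
        (use F val[OF fg(1)] val[OF fg(2)] \<phi> in
          \<open>auto simp: free_module_simps N.smult_l_distr simp_implies_def subset_eq\<close>)
    also have "\<dots> = (\<Oplus>\<^bsub>N\<^esub>w\<in>?F. f w \<odot>\<^bsub>N\<^esub> \<phi> w) \<oplus>\<^bsub>N\<^esub> (\<Oplus>\<^bsub>N\<^esub>w\<in>?F. g w \<odot>\<^bsub>N\<^esub> \<phi> w)"
      by (rule N.M.finsum_addf) (use F val[OF fg(1)] val[OF fg(2)] \<phi> in \<open>auto simp: subset_eq\<close>)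
    also have "\<dots> = h f \<oplus>\<^bsub>N\<^esub> h g"
      using h[OF fg(1), of ?F] h[OF fg(2), of ?F] supp[OF fg(1)] supp[OF fg(2)] by simp
    finally show "h (f \<oplus>\<^bsub>free_module K W\<^esub> g) = h f \<oplus>\<^bsub>N\<^esub> h g" .
  next
    fix c f assume cf: "c \<in> carrier K" "f \<in> carrier (free_module K W)"
    have "h (c \<odot>\<^bsub>free_module K W\<^esub> f) =
        (\<Oplus>\<^bsub>N\<^esub>w\<in>?S f. (c \<odot>\<^bsub>free_module K W\<^esub> f) w \<odot>\<^bsub>N\<^esub> \<phi> w)"
    proof (rule h)
      show "{w. (c \<odot>\<^bsub>free_module K W\<^esub> f) w \<noteq> \<zero>\<^bsub>K\<^esub>} \<subseteq> ?S f"
        using cf(1) by (auto simp: free_module_simps)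
    qed (use cf supp in auto)
    also have "\<dots> = (\<Oplus>\<^bsub>N\<^esub>w\<in>?S f. c \<odot>\<^bsub>N\<^esub> (f w \<odot>\<^bsub>N\<^esub> \<phi> w))"
      by (rule N.M.finsum_cong)
        (use supp[OF cf(2)] cf val[OF cf(2)] \<phi> in
          \<open>auto simp: free_module_simps N.smult_assoc1 simp_implies_def subset_eq\<close>)
    also have "\<dots> = c \<odot>\<^bsub>N\<^esub> (\<Oplus>\<^bsub>N\<^esub>w\<in>?S f. f w \<odot>\<^bsub>N\<^esub> \<phi> w)"
      by (rule N.finsum_smult_ldistr[symmetric])
        (use supp[OF cf(2)] cf val[OF cf(2)] \<phi> in \<open>auto simp: subset_eq\<close>)
    also have "\<dots> = c \<odot>\<^bsub>N\<^esub> h f" using cf by (simp add: h_def)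
    finally show "h (c \<odot>\<^bsub>free_module K W\<^esub> f) = c \<odot>\<^bsub>N\<^esub> h f" .
  qed
  moreover have "h (free_gen K w) = \<phi> w" if w: "w \<in> W" for w
  proof -
    have "h (free_gen K w) = (\<Oplus>\<^bsub>N\<^esub>v\<in>{w}. free_gen K w v \<odot>\<^bsub>N\<^esub> \<phi> v)"
      by (rule h) (use w free_gen_closed[OF K w] in \<open>auto simp: free_gen_def\<close>)
    also have "\<dots> = \<phi> w" using \<phi>[OF w] by (simp add: free_gen_def)
    finally show ?thesis .
  qed
  ultimately show ?thesis by blast
qed

lemma span_module_submodule:
  assumes "module K M" "B \<subseteq> carrier M"
  shows "submodule (span_module K M B) K M" "B \<subseteq> span_module K M B"
proof -
  interpret M: module K M by fact
  show "submodule (span_module K M B) K M"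
  proof (rule M.submoduleI)
    show "span_module K M B \<subseteq> carrier M"
      unfolding span_module_def using M.carrier_is_submodule assms(2) by blast
    show "\<zero>\<^bsub>M\<^esub> \<in> span_module K M B"
      unfolding span_module_def using subgroup.one_closed submodule.axioms(1) by fastforce
  qed (auto simp: span_module_def dest: M.submoduleE)
  show "B \<subseteq> span_module K M B" unfolding span_module_def by blast
qed

lemma span_module_least:
  assumes "submodule H K M" "B \<subseteq> H" shows "span_module K M B \<subseteq> H"
  unfolding span_module_def using assms by blast

text \<open>The module axioms are equations, apart from inverses, which are the images of inverses.\<close>

lemma module_of_surj:
  assumes M: "module K M" and surj: "f ` carrier M = carrier Q"
    and add: "\<And>x y. x \<in> carrier M \<Longrightarrow> y \<in> carrier M \<Longrightarrow> f (x \<oplus>\<^bsub>M\<^esub> y) = f x \<oplus>\<^bsub>Q\<^esub> f y"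
    and smult: "\<And>c x. c \<in> carrier K \<Longrightarrow> x \<in> carrier M \<Longrightarrow> f (c \<odot>\<^bsub>M\<^esub> x) = c \<odot>\<^bsub>Q\<^esub> f x"
    and zero: "f \<zero>\<^bsub>M\<^esub> = \<zero>\<^bsub>Q\<^esub>"
  shows "module K Q"
proof -
  interpret M: module K M by fact
  note rules = add[symmetric] smult[symmetric] zero[symmetric]
  have cl: "x \<in> carrier M \<Longrightarrow> f x \<in> carrier Q" for x using surj by blast
  show ?thesis
  proof (rule moduleI)
    show "abelian_group Q"
    proof (rule abelian_groupI)
      fix x assume "x \<in> carrier Q"
      then obtain a where a: "a \<in> carrier M" "x = f a" using surj by blast
      have "f (\<ominus>\<^bsub>M\<^esub> a) \<oplus>\<^bsub>Q\<^esub> x = \<zero>\<^bsub>Q\<^esub>" using a by (simp add: rules M.M.l_neg)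
      then show "\<exists>y\<in>carrier Q. y \<oplus>\<^bsub>Q\<^esub> x = \<zero>\<^bsub>Q\<^esub>" using cl a by blast
    next
      show "x \<oplus>\<^bsub>Q\<^esub> y = y \<oplus>\<^bsub>Q\<^esub> x" if "x \<in> carrier Q" "y \<in> carrier Q" for x y
        using that unfolding surj[symmetric] by (auto simp: rules M.M.a_comm)
      show "x \<oplus>\<^bsub>Q\<^esub> y \<oplus>\<^bsub>Q\<^esub> z = x \<oplus>\<^bsub>Q\<^esub> (y \<oplus>\<^bsub>Q\<^esub> z)"
        if "x \<in> carrier Q" "y \<in> carrier Q" "z \<in> carrier Q" for x y z
        using that unfolding surj[symmetric] by (auto simp: rules M.M.a_assoc)
    qed (unfold surj[symmetric], auto simp: rules)
  qed (use M.R.is_cring in \<open>unfold surj[symmetric], auto simp: rules M.smult_l_distr M.smult_r_distr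
         M.smult_assoc1 simp del: M.M.a_ac\<close>)
qed

text \<open>Everything needed about \<^term>\<open>quotient_module M N\<close> follows from the projection \<open>x \<mapsto> N + x\<close>
  being a surjective linear map with kernel \<open>N\<close>.\<close>

context
  fixes K :: "('k, 'e) ring_scheme" and M :: "('k, 'a, 'm) module_scheme" and N
  assumes M: "module K M" and N: "submodule N K M"
begin

interpretation M: module K M by (rule M)
interpretation N: abelian_subgroup N M
  by (rule abelian_subgroupI3)
    (use submodule.axioms(1)[OF N] M.M.abelian_group_axioms in \<open>auto intro: additive_subgroup.intro\<close>)

lemma coset_eqI:
  assumes "x \<in> carrier M" "y \<in> carrier M" "x \<ominus>\<^bsub>M\<^esub> y \<in> N"
  shows "N +>\<^bsub>M\<^esub> x = N +>\<^bsub>M\<^esub> y"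
proof -
  have "x \<in> N +>\<^bsub>M\<^esub> y" using N.a_rcos_module_rev assms by (simp add: M.M.minus_eq)
  then show ?thesis using N.a_repr_independence' assms by metis
qed

lemma coset_eqD:
  assumes "x \<in> carrier M" "y \<in> carrier M" "N +>\<^bsub>M\<^esub> x = N +>\<^bsub>M\<^esub> y"
  shows "x \<ominus>\<^bsub>M\<^esub> y \<in> N"
  using N.a_repr_independenceD[of x y] N.a_rcos_module_imp[of y x] assms
  by (simp add: M.M.minus_eq)

lemma quotient_carrier: "carrier (quotient_module M N) = (\<lambda>x. N +>\<^bsub>M\<^esub> x) ` carrier M"
  by (auto simp: quotient_module_def A_RCOSETS_def' image_iff a_r_coset_def')

lemma quotient_zero: "\<zero>\<^bsub>quotient_module M N\<^esub> = N +>\<^bsub>M\<^esub> \<zero>\<^bsub>M\<^esub>"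
  using N.a_subset by (simp add: quotient_module_def)

lemma quotient_add:
  assumes "x \<in> carrier M" "y \<in> carrier M"
  shows "(N +>\<^bsub>M\<^esub> x) \<oplus>\<^bsub>quotient_module M N\<^esub> (N +>\<^bsub>M\<^esub> y) = N +>\<^bsub>M\<^esub> (x \<oplus>\<^bsub>M\<^esub> y)"
  using N.a_rcos_sum assms by (simp add: quotient_module_def)

lemma quotient_smult:
  assumes "c \<in> carrier K" "x \<in> carrier M"
  shows "c \<odot>\<^bsub>quotient_module M N\<^esub> (N +>\<^bsub>M\<^esub> x) = N +>\<^bsub>M\<^esub> (c \<odot>\<^bsub>M\<^esub> x)"
proof -
  have "N +>\<^bsub>M\<^esub> (c \<odot>\<^bsub>M\<^esub> y) = N +>\<^bsub>M\<^esub> (c \<odot>\<^bsub>M\<^esub> x)" if y: "y \<in> N +>\<^bsub>M\<^esub> x" for y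
  proof -
    have yc: "y \<in> carrier M" using N.a_elemrcos_carrier y assms by blast
    have "y \<ominus>\<^bsub>M\<^esub> x \<in> N" using N.a_rcos_module_imp y assms by (simp add: M.M.minus_eq)
    then have "c \<odot>\<^bsub>M\<^esub> (y \<ominus>\<^bsub>M\<^esub> x) \<in> N" using submodule.smult_closed[OF N] assms by blast
    then have "c \<odot>\<^bsub>M\<^esub> y \<ominus>\<^bsub>M\<^esub> c \<odot>\<^bsub>M\<^esub> x \<in> N"
      using assms yc by (simp add: M.M.minus_eq M.smult_r_distr M.smult_r_minus)
    then show ?thesis using assms yc by (intro coset_eqI) auto
  qed
  moreover have "x \<in> N +>\<^bsub>M\<^esub> x" using N.a_rcos_self assms by blast
  ultimately have "(\<Union>y\<in>N +>\<^bsub>M\<^esub> x. N +>\<^bsub>M\<^esub> (c \<odot>\<^bsub>M\<^esub> y)) = N +>\<^bsub>M\<^esub> (c \<odot>\<^bsub>M\<^esub> x)"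
    by (intro UN_constant_eq) blast+
  then show ?thesis by (simp add: quotient_module_def)
qed

lemma quotient_module_module: "module K (quotient_module M N)"
  by (rule module_of_surj[where f = "\<lambda>x. N +>\<^bsub>M\<^esub> x", OF M])
    (simp_all add: quotient_carrier quotient_add quotient_smult quotient_zero)

text \<open>A value on a coset is read off an arbitrary representative; two representatives differ by an
  element of \<open>N\<close>, on which \<open>h\<close> vanishes.\<close>

lemma quotient_module_ext:
  assumes h: "h \<in> linear_maps K M L" and L: "module K L" and ker: "\<And>x. x \<in> N \<Longrightarrow> h x = \<zero>\<^bsub>L\<^esub>"
  shows "\<exists>g\<in>linear_maps K (quotient_module M N) L. \<forall>x\<in>carrier M. g (N +>\<^bsub>M\<^esub> x) = h x"
proof -
  interpret L: module K L by fact
  note hD = linear_mapsD[OF h]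
  have well: "h x = h y" if "x \<in> carrier M" "y \<in> carrier M" "N +>\<^bsub>M\<^esub> x = N +>\<^bsub>M\<^esub> y" for x y
  proof -
    have "\<zero>\<^bsub>L\<^esub> = h (x \<oplus>\<^bsub>M\<^esub> \<ominus>\<^bsub>M\<^esub> y)" using ker[OF coset_eqD[OF that]] by (simp add: M.M.minus_eq)
    also have "\<dots> = h x \<oplus>\<^bsub>L\<^esub> \<ominus>\<^bsub>L\<^esub> h y"
      using that hD(3) linear_map_neg[OF M L h] by simp
    finally show ?thesis
      using that hD(2) by (metis L.M.a_inv_closed L.M.minus_equality L.M.minus_minus)
  qed
  define g where "g = (\<lambda>X\<in>carrier (quotient_module M N). h (SOME x. x \<in> carrier M \<and> X = N +>\<^bsub>M\<^esub> x))"
  have g: "g (N +>\<^bsub>M\<^esub> x) = h x" if x: "x \<in> carrier M" for x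
  proof -
    let ?y = "SOME y. y \<in> carrier M \<and> N +>\<^bsub>M\<^esub> x = N +>\<^bsub>M\<^esub> y"
    have "?y \<in> carrier M \<and> N +>\<^bsub>M\<^esub> x = N +>\<^bsub>M\<^esub> ?y" by (rule someI[of _ x]) (use x in simp)
    then show ?thesis using well[of ?y x] x by (simp add: g_def quotient_carrier)
  qed
  have "g \<in> linear_maps K (quotient_module M N) L"
  proof (rule linear_mapsI)
    have "g X = undefined" if "X \<notin> carrier (quotient_module M N)" for X using that by (simp add: g_def)
    then show "g \<in> carrier (quotient_module M N) \<rightarrow>\<^sub>E carrier L"
      using g hD(2) by (auto simp: quotient_carrier PiE_def extensional_def)
  qed (auto simp: quotient_carrier quotient_add quotient_smult g hD)
  with g show ?thesis by blast
qed

end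

text \<open>The canonical inclusion of \<open>D i\<close> into the direct sum.\<close>

definition summand :: "'i set \<Rightarrow> ('i \<Rightarrow> ('k, 'a) module) \<Rightarrow> 'i \<Rightarrow> 'a \<Rightarrow> 'i \<Rightarrow> 'a" where
  "summand I D i x = (\<lambda>j\<in>I. if j = i then x else \<zero>\<^bsub>D j\<^esub>)"

lemma direct_sum_simps:
  "\<zero>\<^bsub>direct_sum I D\<^esub> = (\<lambda>i\<in>I. \<zero>\<^bsub>D i\<^esub>)"
  "x \<oplus>\<^bsub>direct_sum I D\<^esub> y = (\<lambda>i\<in>I. x i \<oplus>\<^bsub>D i\<^esub> y i)"
  "c \<odot>\<^bsub>direct_sum I D\<^esub> x = (\<lambda>i\<in>I. c \<odot>\<^bsub>D i\<^esub> x i)"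
  by (simp_all add: direct_sum_def)

lemma direct_sum_carrier:
  "x \<in> carrier (direct_sum I D) \<longleftrightarrow>
    x \<in> (\<Pi>\<^sub>E i\<in>I. carrier (D i)) \<and> finite {i\<in>I. x i \<noteq> \<zero>\<^bsub>D i\<^esub>}"
  by (simp add: direct_sum_def)

context
  fixes K :: "('k, 'e) ring_scheme" and D :: "'i \<Rightarrow> ('k, 'a) module" and I
  assumes K: "cring K" and D: "\<And>i. i \<in> I \<Longrightarrow> module K (D i)"
begin

lemma direct_sum_add_closed:
  assumes x: "x \<in> carrier (direct_sum I D)" and y: "y \<in> carrier (direct_sum I D)"
  shows "x \<oplus>\<^bsub>direct_sum I D\<^esub> y \<in> carrier (direct_sum I D)"
proof -
  let ?S = "\<lambda>x. {i\<in>I. x i \<noteq> \<zero>\<^bsub>D i\<^esub>}"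
  have pt: "x i \<oplus>\<^bsub>D i\<^esub> y i \<in> carrier (D i) \<and>
      (x i \<oplus>\<^bsub>D i\<^esub> y i \<noteq> \<zero>\<^bsub>D i\<^esub> \<longrightarrow> x i \<noteq> \<zero>\<^bsub>D i\<^esub> \<or> y i \<noteq> \<zero>\<^bsub>D i\<^esub>)" if "i \<in> I" for i
  proof -
    interpret Di: module K "D i" by (rule D[OF that])
    have "x i \<in> carrier (D i)" "y i \<in> carrier (D i)" using x y that by (auto simp: direct_sum_carrier)
    then show ?thesis by auto
  qed
  have "finite (?S x \<union> ?S y)" using x y by (simp add: direct_sum_carrier)
  then have "finite (?S (x \<oplus>\<^bsub>direct_sum I D\<^esub> y))"
    by (rule rev_finite_subset) (use pt in \<open>auto simp: direct_sum_simps\<close>)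
  then show ?thesis using pt by (simp add: direct_sum_carrier direct_sum_simps)
qed

lemma direct_sum_smult_closed:
  assumes c: "c \<in> carrier K" and x: "x \<in> carrier (direct_sum I D)"
  shows "c \<odot>\<^bsub>direct_sum I D\<^esub> x \<in> carrier (direct_sum I D)"
proof -
  let ?S = "\<lambda>x. {i\<in>I. x i \<noteq> \<zero>\<^bsub>D i\<^esub>}"
  have pt: "c \<odot>\<^bsub>D i\<^esub> x i \<in> carrier (D i) \<and> (c \<odot>\<^bsub>D i\<^esub> x i \<noteq> \<zero>\<^bsub>D i\<^esub> \<longrightarrow> x i \<noteq> \<zero>\<^bsub>D i\<^esub>)"
    if "i \<in> I" for i
  proof -
    interpret Di: module K "D i" by (rule D[OF that])
    have "x i \<in> carrier (D i)" using x that by (auto simp: direct_sum_carrier)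
    then show ?thesis using c by auto
  qed
  have "finite (?S x)" using x by (simp add: direct_sum_carrier)
  then have "finite (?S (c \<odot>\<^bsub>direct_sum I D\<^esub> x))"
    by (rule rev_finite_subset) (use pt in \<open>auto simp: direct_sum_simps\<close>)
  then show ?thesis using pt by (simp add: direct_sum_carrier direct_sum_simps)
qed

lemma direct_sum_module: "module K (direct_sum I D)"
proof -
  interpret K: cring K by (rule K)
  have val: "x i \<in> carrier (D i)" if "x \<in> carrier (direct_sum I D)" "i \<in> I" for x i
    using that by (auto simp: direct_sum_carrier)
  have ext: "x \<in> extensional I" if "x \<in> carrier (direct_sum I D)" for x
    using that by (simp add: direct_sum_carrier PiE_def)
  have id: "(\<lambda>i\<in>I. x i) = x" if "x \<in> carrier (direct_sum I D)" for x
    using extensional_restrict[OF ext[OF that]] .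
  show ?thesis
  proof (rule moduleI)
    show "abelian_group (direct_sum I D)"
    proof (rule abelian_groupI)
      fix x assume x: "x \<in> carrier (direct_sum I D)"
      have "(\<ominus>\<^bsub>K\<^esub> \<one>\<^bsub>K\<^esub>) \<odot>\<^bsub>D i\<^esub> x i \<oplus>\<^bsub>D i\<^esub> x i = \<zero>\<^bsub>D i\<^esub>" if i: "i \<in> I" for i
      proof -
        interpret Di: module K "D i" by (rule D[OF i])
        show ?thesis using val[OF x i] by (simp add: Di.smult_l_minus Di.M.l_neg)
      qed
      then have "(\<ominus>\<^bsub>K\<^esub> \<one>\<^bsub>K\<^esub>) \<odot>\<^bsub>direct_sum I D\<^esub> x \<oplus>\<^bsub>direct_sum I D\<^esub> x = \<zero>\<^bsub>direct_sum I D\<^esub>"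
        by (simp add: direct_sum_simps cong: restrict_cong)
      then show "\<exists>y\<in>carrier (direct_sum I D). y \<oplus>\<^bsub>direct_sum I D\<^esub> x = \<zero>\<^bsub>direct_sum I D\<^esub>"
        using direct_sum_smult_closed[OF _ x] by blast
    next
      fix x assume x: "x \<in> carrier (direct_sum I D)"
      have "\<zero>\<^bsub>D i\<^esub> \<oplus>\<^bsub>D i\<^esub> x i = x i" if i: "i \<in> I" for i
        using abelian_groupE(5)[OF module.axioms(2)[OF D[OF i]]] val[OF x i] by blast
      then show "\<zero>\<^bsub>direct_sum I D\<^esub> \<oplus>\<^bsub>direct_sum I D\<^esub> x = x"
        using id[OF x] by (simp add: direct_sum_simps cong: restrict_cong)
    next
      have "\<zero>\<^bsub>D i\<^esub> \<in> carrier (D i)" if i: "i \<in> I" for i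
        using abelian_groupE(2)[OF module.axioms(2)[OF D[OF i]]] by blast
      then show "\<zero>\<^bsub>direct_sum I D\<^esub> \<in> carrier (direct_sum I D)"
        by (simp add: direct_sum_carrier direct_sum_simps)
    next
      fix x y assume xy: "x \<in> carrier (direct_sum I D)" "y \<in> carrier (direct_sum I D)"
      have "x i \<oplus>\<^bsub>D i\<^esub> y i = y i \<oplus>\<^bsub>D i\<^esub> x i" if i: "i \<in> I" for i
        using abelian_groupE(4)[OF module.axioms(2)[OF D[OF i]]] val[OF _ i] xy by blast
      then show "x \<oplus>\<^bsub>direct_sum I D\<^esub> y = y \<oplus>\<^bsub>direct_sum I D\<^esub> x"
        unfolding direct_sum_simps by (rule restrict_ext)
    next
      fix x y z assume xyz: "x \<in> carrier (direct_sum I D)" "y \<in> carrier (direct_sum I D)"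
        "z \<in> carrier (direct_sum I D)"
      have "(x i \<oplus>\<^bsub>D i\<^esub> y i) \<oplus>\<^bsub>D i\<^esub> z i = x i \<oplus>\<^bsub>D i\<^esub> (y i \<oplus>\<^bsub>D i\<^esub> z i)" if i: "i \<in> I" for i
        using abelian_groupE(3)[OF module.axioms(2)[OF D[OF i]]] val[OF _ i] xyz by blast
      then show "x \<oplus>\<^bsub>direct_sum I D\<^esub> y \<oplus>\<^bsub>direct_sum I D\<^esub> z = x \<oplus>\<^bsub>direct_sum I D\<^esub> (y \<oplus>\<^bsub>direct_sum I D\<^esub> z)"
        by (simp add: direct_sum_simps cong: restrict_cong)
    qed (rule direct_sum_add_closed)
  next
    fix x assume x: "x \<in> carrier (direct_sum I D)"
    have "\<one>\<^bsub>K\<^esub> \<odot>\<^bsub>D i\<^esub> x i = x i" if i: "i \<in> I" for i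
      using module.smult_one[OF D[OF i]] val[OF x i] by blast
    then show "\<one>\<^bsub>K\<^esub> \<odot>\<^bsub>direct_sum I D\<^esub> x = x"
      using id[OF x] by (simp add: direct_sum_simps cong: restrict_cong)
  next
    fix a b x assume abx: "a \<in> carrier K" "b \<in> carrier K" "x \<in> carrier (direct_sum I D)"
    have "(a \<oplus>\<^bsub>K\<^esub> b) \<odot>\<^bsub>D i\<^esub> x i = a \<odot>\<^bsub>D i\<^esub> x i \<oplus>\<^bsub>D i\<^esub> b \<odot>\<^bsub>D i\<^esub> x i" if i: "i \<in> I" for i
      using module.smult_l_distr[OF D[OF i]] val[OF _ i] abx by blast
    then show "(a \<oplus>\<^bsub>K\<^esub> b) \<odot>\<^bsub>direct_sum I D\<^esub> x = a \<odot>\<^bsub>direct_sum I D\<^esub> x \<oplus>\<^bsub>direct_sum I D\<^esub> b \<odot>\<^bsub>direct_sum I D\<^esub> x"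
      by (simp add: direct_sum_simps cong: restrict_cong)
    have "(a \<otimes>\<^bsub>K\<^esub> b) \<odot>\<^bsub>D i\<^esub> x i = a \<odot>\<^bsub>D i\<^esub> (b \<odot>\<^bsub>D i\<^esub> x i)" if i: "i \<in> I" for i
      using module.smult_assoc1[OF D[OF i]] val[OF _ i] abx by blast
    then show "(a \<otimes>\<^bsub>K\<^esub> b) \<odot>\<^bsub>direct_sum I D\<^esub> x = a \<odot>\<^bsub>direct_sum I D\<^esub> (b \<odot>\<^bsub>direct_sum I D\<^esub> x)"
      by (simp add: direct_sum_simps cong: restrict_cong)
  next
    fix a x y assume axy: "a \<in> carrier K" "x \<in> carrier (direct_sum I D)" "y \<in> carrier (direct_sum I D)"
    have "a \<odot>\<^bsub>D i\<^esub> (x i \<oplus>\<^bsub>D i\<^esub> y i) = a \<odot>\<^bsub>D i\<^esub> x i \<oplus>\<^bsub>D i\<^esub> a \<odot>\<^bsub>D i\<^esub> y i" if i: "i \<in> I" for i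
      using module.smult_r_distr[OF D[OF i]] val[OF _ i] axy by blast
    then show "a \<odot>\<^bsub>direct_sum I D\<^esub> (x \<oplus>\<^bsub>direct_sum I D\<^esub> y) = a \<odot>\<^bsub>direct_sum I D\<^esub> x \<oplus>\<^bsub>direct_sum I D\<^esub> a \<odot>\<^bsub>direct_sum I D\<^esub> y"
      by (simp add: direct_sum_simps cong: restrict_cong)
  qed (use K direct_sum_smult_closed in blast)+
qed

interpretation S: module K "direct_sum I D" by (rule direct_sum_module)

lemma summand_closed:
  assumes "i \<in> I" "x \<in> carrier (D i)" shows "summand I D i x \<in> carrier (direct_sum I D)"
proof -
  have "\<zero>\<^bsub>D j\<^esub> \<in> carrier (D j)" if "j \<in> I" for j
    using module.axioms(2)[OF D[OF that]] abelian_groupE(2) by blast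
  moreover have "{j\<in>I. summand I D i x j \<noteq> \<zero>\<^bsub>D j\<^esub>} \<subseteq> {i}" by (auto simp: summand_def)
  ultimately show ?thesis using assms
    by (auto simp: direct_sum_carrier summand_def intro: finite_subset)
qed

lemma direct_sum_induct [consumes 1, case_names zero add summand]:
  assumes x: "x \<in> carrier (direct_sum I D)"
    and zero: "Q \<zero>\<^bsub>direct_sum I D\<^esub>"
    and add: "\<And>x y. x \<in> carrier (direct_sum I D) \<Longrightarrow> y \<in> carrier (direct_sum I D) \<Longrightarrow>
      Q x \<Longrightarrow> Q y \<Longrightarrow> Q (x \<oplus>\<^bsub>direct_sum I D\<^esub> y)"
    and smd: "\<And>i x. i \<in> I \<Longrightarrow> x \<in> carrier (D i) \<Longrightarrow> Q (summand I D i x)"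
  shows "Q x"
proof -
  have "Q x" if "finite F" "x \<in> carrier (direct_sum I D)" "{i\<in>I. x i \<noteq> \<zero>\<^bsub>D i\<^esub>} \<subseteq> F" for F x
    using that
  proof (induction F arbitrary: x rule: finite_induct)
    case empty
    then have "x i = (\<zero>\<^bsub>direct_sum I D\<^esub>) i" for i
      by (cases "i \<in> I") (auto simp: direct_sum_simps direct_sum_carrier PiE_def extensional_def)
    with zero show ?case by (metis ext)
  next
    case (insert v F)
    show ?case
    proof (cases "v \<in> I")
      case False
      with insert show ?thesis by blast
    next
      case True
      interpret Dv: module K "D v" by (rule D[OF True])
      have z: "x i \<in> carrier (D i)" "\<zero>\<^bsub>D i\<^esub> \<oplus>\<^bsub>D i\<^esub> x i = x i" "x i \<oplus>\<^bsub>D i\<^esub> \<zero>\<^bsub>D i\<^esub> = x i" if "i \<in> I" for i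
      proof -
        interpret Di: module K "D i" by (rule D[OF that])
        show "x i \<in> carrier (D i)" using insert.prems(1) that by (auto simp: direct_sum_carrier)
        then show "\<zero>\<^bsub>D i\<^esub> \<oplus>\<^bsub>D i\<^esub> x i = x i" "x i \<oplus>\<^bsub>D i\<^esub> \<zero>\<^bsub>D i\<^esub> = x i" by simp_all
      qed
      let ?y = "x(v := \<zero>\<^bsub>D v\<^esub>)"
      have fin: "finite {i\<in>I. x i \<noteq> \<zero>\<^bsub>D i\<^esub>}" using insert.prems(1) by (simp add: direct_sum_carrier)
      have "finite {i\<in>I. ?y i \<noteq> \<zero>\<^bsub>D i\<^esub>}" by (rule finite_subset[OF _ fin]) auto
      then have y: "?y \<in> carrier (direct_sum I D)"
        using insert.prems(1) True by (auto simp: direct_sum_carrier PiE_def extensional_def)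
      have "Q ?y" by (rule insert.IH[OF y]) (use insert.prems in auto)
      moreover have "x = ?y \<oplus>\<^bsub>direct_sum I D\<^esub> summand I D v (x v)"
      proof
        fix i show "x i = (?y \<oplus>\<^bsub>direct_sum I D\<^esub> summand I D v (x v)) i"
          using z insert.prems(1)
          by (cases "i \<in> I") (auto simp: direct_sum_simps summand_def direct_sum_carrier PiE_def extensional_def)
      qed
      ultimately show ?thesis using add[OF y] smd[OF True] summand_closed[OF True] z(1)[OF True] by metis
    qed
  qed
  from this[of "{i\<in>I. x i \<noteq> \<zero>\<^bsub>D i\<^esub>}" x] x show ?thesis by (auto simp: direct_sum_carrier)
qed

lemma direct_sum_ext:
  assumes N: "module K N" and g: "\<And>i. i \<in> I \<Longrightarrow> g i \<in> linear_maps K (D i) N"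
  shows "\<exists>h\<in>linear_maps K (direct_sum I D) N. \<forall>i\<in>I. \<forall>x\<in>carrier (D i). h (summand I D i x) = g i x"
proof -
  interpret N: module K N by fact
  let ?S = "\<lambda>x. {i\<in>I. x i \<noteq> \<zero>\<^bsub>D i\<^esub>}"
  define h where "h = (\<lambda>x\<in>carrier (direct_sum I D). \<Oplus>\<^bsub>N\<^esub>i\<in>?S x. g i (x i))"
  have fin: "finite (?S x)" and val: "i \<in> I \<Longrightarrow> x i \<in> carrier (D i)"
    if "x \<in> carrier (direct_sum I D)" for x i
    using that by (auto simp: direct_sum_carrier)
  have gval: "i \<in> I \<Longrightarrow> g i (x i) \<in> carrier N" if "x \<in> carrier (direct_sum I D)" for x i
    using linear_mapsD(2)[OF g] val[OF that] by blast
  have h: "h x = (\<Oplus>\<^bsub>N\<^esub>i\<in>F. g i (x i))"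
    if x: "x \<in> carrier (direct_sum I D)" and F: "finite F" "?S x \<subseteq> F" "F \<subseteq> I" for x F
  proof -
    have "g i (x i) = \<zero>\<^bsub>N\<^esub>" if "i \<in> F - ?S x" for i
      using that F linear_map_zero[OF D N g] by auto
    then have "(\<Oplus>\<^bsub>N\<^esub>i\<in>?S x. g i (x i)) = (\<Oplus>\<^bsub>N\<^esub>i\<in>F. g i (x i))"
      by (intro N.M.add.finprod_mono_neutral_cong_left) (use F gval[OF x] in auto)
    then show ?thesis using x by (simp add: h_def)
  qed
  have "h \<in> linear_maps K (direct_sum I D) N"
  proof (rule linear_mapsI)
    show "h \<in> carrier (direct_sum I D) \<rightarrow>\<^sub>E carrier N"
      unfolding h_def using gval by (auto intro!: N.M.finsum_closed)
  next
    fix x y assume xy: "x \<in> carrier (direct_sum I D)" "y \<in> carrier (direct_sum I D)"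
    \<comment> \<open>As for free modules, all sums are taken over the union of the two supports.\<close>
    let ?F = "?S x \<union> ?S y"
    have sub: "?S (x \<oplus>\<^bsub>direct_sum I D\<^esub> y) \<subseteq> ?F"
    proof
      fix i assume i: "i \<in> ?S (x \<oplus>\<^bsub>direct_sum I D\<^esub> y)"
      then interpret Di: module K "D i" by (auto intro: D)
      show "i \<in> ?F" using i by (auto simp: direct_sum_simps)
    qed
    have "h (x \<oplus>\<^bsub>direct_sum I D\<^esub> y) = (\<Oplus>\<^bsub>N\<^esub>i\<in>?F. g i ((x \<oplus>\<^bsub>direct_sum I D\<^esub> y) i))"
      by (rule h) (use xy fin sub in auto)
    also have "\<dots> = (\<Oplus>\<^bsub>N\<^esub>i\<in>?F. g i (x i) \<oplus>\<^bsub>N\<^esub> g i (y i))"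
      by (rule N.M.finsum_cong)
        (use gval[OF xy(1)] gval[OF xy(2)] val[OF xy(1)] val[OF xy(2)] linear_mapsD(3)[OF g] in
          \<open>auto simp: direct_sum_simps simp_implies_def\<close>)
    also have "\<dots> = (\<Oplus>\<^bsub>N\<^esub>i\<in>?F. g i (x i)) \<oplus>\<^bsub>N\<^esub> (\<Oplus>\<^bsub>N\<^esub>i\<in>?F. g i (y i))"
      by (rule N.M.finsum_addf) (use gval[OF xy(1)] gval[OF xy(2)] in auto)
    also have "\<dots> = h x \<oplus>\<^bsub>N\<^esub> h y"
      using h[OF xy(1), of ?F] h[OF xy(2), of ?F] fin[OF xy(1)] fin[OF xy(2)] by auto
    finally show "h (x \<oplus>\<^bsub>direct_sum I D\<^esub> y) = h x \<oplus>\<^bsub>N\<^esub> h y" .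
  next
    fix c x assume cx: "c \<in> carrier K" "x \<in> carrier (direct_sum I D)"
    have sub: "?S (c \<odot>\<^bsub>direct_sum I D\<^esub> x) \<subseteq> ?S x"
      using cx module.smult_r_null[OF D] by (auto simp: direct_sum_simps)
    have "h (c \<odot>\<^bsub>direct_sum I D\<^esub> x) = (\<Oplus>\<^bsub>N\<^esub>i\<in>?S x. g i ((c \<odot>\<^bsub>direct_sum I D\<^esub> x) i))"
      by (rule h) (use cx fin sub in auto)
    also have "\<dots> = (\<Oplus>\<^bsub>N\<^esub>i\<in>?S x. c \<odot>\<^bsub>N\<^esub> g i (x i))"
      by (rule N.M.finsum_cong)
        (use cx gval[OF cx(2)] val[OF cx(2)] linear_mapsD(4)[OF g] in
          \<open>auto simp: direct_sum_simps simp_implies_def\<close>)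
    also have "\<dots> = c \<odot>\<^bsub>N\<^esub> (\<Oplus>\<^bsub>N\<^esub>i\<in>?S x. g i (x i))"
      by (rule N.finsum_smult_ldistr[symmetric]) (use cx fin gval[OF cx(2)] in auto)
    also have "\<dots> = c \<odot>\<^bsub>N\<^esub> h x" using cx by (simp add: h_def)
    finally show "h (c \<odot>\<^bsub>direct_sum I D\<^esub> x) = c \<odot>\<^bsub>N\<^esub> h x" .
  qed
  moreover have "h (summand I D i x) = g i x" if ix: "i \<in> I" "x \<in> carrier (D i)" for i x
  proof -
    have "h (summand I D i x) = (\<Oplus>\<^bsub>N\<^esub>j\<in>{i}. g j (summand I D i x j))"
      by (rule h) (use ix summand_closed in \<open>auto simp: summand_def\<close>)
    also have "\<dots> = g i x" using linear_mapsD(2)[OF g] ix by (simp add: summand_def)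
    finally show ?thesis .
  qed
  ultimately show ?thesis by blast
qed

end


lemma summand_linear:
  assumes K: "cring K" and D: "\<And>i. i \<in> I \<Longrightarrow> module K (D i)"
  shows "x \<in> carrier (D i) \<Longrightarrow> y \<in> carrier (D i) \<Longrightarrow>
      summand I D i (x \<oplus>\<^bsub>D i\<^esub> y) = summand I D i x \<oplus>\<^bsub>direct_sum I D\<^esub> summand I D i y"
    and "c \<in> carrier K \<Longrightarrow>
      summand I D i (c \<odot>\<^bsub>D i\<^esub> x) = c \<odot>\<^bsub>direct_sum I D\<^esub> summand I D i x"
    and "summand I D i \<zero>\<^bsub>D i\<^esub> = \<zero>\<^bsub>direct_sum I D\<^esub>"
proof -
  have z: "\<zero>\<^bsub>D j\<^esub> \<oplus>\<^bsub>D j\<^esub> \<zero>\<^bsub>D j\<^esub> = \<zero>\<^bsub>D j\<^esub>" "c \<in> carrier K \<Longrightarrow> c \<odot>\<^bsub>D j\<^esub> \<zero>\<^bsub>D j\<^esub> = \<zero>\<^bsub>D j\<^esub>" if "j \<in> I" for j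
  proof -
    interpret Dj: module K "D j" by (rule D[OF that])
    show "\<zero>\<^bsub>D j\<^esub> \<oplus>\<^bsub>D j\<^esub> \<zero>\<^bsub>D j\<^esub> = \<zero>\<^bsub>D j\<^esub>" "c \<in> carrier K \<Longrightarrow> c \<odot>\<^bsub>D j\<^esub> \<zero>\<^bsub>D j\<^esub> = \<zero>\<^bsub>D j\<^esub>" by simp_all
  qed
  show "summand I D i (x \<oplus>\<^bsub>D i\<^esub> y) = summand I D i x \<oplus>\<^bsub>direct_sum I D\<^esub> summand I D i y"
    using z by (auto simp: summand_def direct_sum_simps intro!: restrict_ext)
  show "summand I D i (c \<odot>\<^bsub>D i\<^esub> x) = c \<odot>\<^bsub>direct_sum I D\<^esub> summand I D i x" if "c \<in> carrier K"
    using z that by (auto simp: summand_def direct_sum_simps intro!: restrict_ext)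
  show "summand I D i \<zero>\<^bsub>D i\<^esub> = \<zero>\<^bsub>direct_sum I D\<^esub>"
    by (auto simp: summand_def direct_sum_simps intro!: restrict_ext)
qed


section \<open>The universal property of the module \<open>Sha(A)\<close>\<close>

text \<open>Words of all positive lengths are treated together, since \<open>Sha(A)\<close> contains all tensor powers; the
  slot is the letter between \<open>u\<close> and \<open>v\<close>, so the length is constant in each equation.\<close>

definition multilinear ::
  "('k, 'e) ring_scheme \<Rightarrow> ('k, 'a, 'm) module_scheme \<Rightarrow> ('k, 'b, 'n) module_scheme \<Rightarrow> ('a list \<Rightarrow> 'b) \<Rightarrow> bool" where
  "multilinear K A N \<phi> \<longleftrightarrow>
    (\<forall>w\<in>words A. \<phi> w \<in> carrier N) \<and>
    (\<forall>u v. \<forall>x\<in>carrier A. set u \<subseteq> carrier A \<longrightarrow> set v \<subseteq> carrier A \<longrightarrow>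
      (\<forall>y\<in>carrier A. \<phi> (u @ (x \<oplus>\<^bsub>A\<^esub> y) # v) = \<phi> (u @ x # v) \<oplus>\<^bsub>N\<^esub> \<phi> (u @ y # v)) \<and>
      (\<forall>c\<in>carrier K. \<phi> (u @ (c \<odot>\<^bsub>A\<^esub> x) # v) = c \<odot>\<^bsub>N\<^esub> \<phi> (u @ x # v)))"

lemma multilinearI:
  assumes "\<And>w. w \<in> words A \<Longrightarrow> \<phi> w \<in> carrier N"
    and "\<And>u v x y. set u \<subseteq> carrier A \<Longrightarrow> set v \<subseteq> carrier A \<Longrightarrow> x \<in> carrier A \<Longrightarrow> y \<in> carrier A \<Longrightarrow>
      \<phi> (u @ (x \<oplus>\<^bsub>A\<^esub> y) # v) = \<phi> (u @ x # v) \<oplus>\<^bsub>N\<^esub> \<phi> (u @ y # v)"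
    and "\<And>u v x c. set u \<subseteq> carrier A \<Longrightarrow> set v \<subseteq> carrier A \<Longrightarrow> x \<in> carrier A \<Longrightarrow> c \<in> carrier K \<Longrightarrow>
      \<phi> (u @ (c \<odot>\<^bsub>A\<^esub> x) # v) = c \<odot>\<^bsub>N\<^esub> \<phi> (u @ x # v)"
  shows "multilinear K A N \<phi>"
  using assms unfolding multilinear_def by blast

lemma multilinearD:
  assumes "multilinear K A N \<phi>"
  shows "w \<in> words A \<Longrightarrow> \<phi> w \<in> carrier N"
    and "set u \<subseteq> carrier A \<Longrightarrow> set v \<subseteq> carrier A \<Longrightarrow> x \<in> carrier A \<Longrightarrow> y \<in> carrier A \<Longrightarrow>
      \<phi> (u @ (x \<oplus>\<^bsub>A\<^esub> y) # v) = \<phi> (u @ x # v) \<oplus>\<^bsub>N\<^esub> \<phi> (u @ y # v)"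
    and "set u \<subseteq> carrier A \<Longrightarrow> set v \<subseteq> carrier A \<Longrightarrow> x \<in> carrier A \<Longrightarrow> c \<in> carrier K \<Longrightarrow>
      \<phi> (u @ (c \<odot>\<^bsub>A\<^esub> x) # v) = c \<odot>\<^bsub>N\<^esub> \<phi> (u @ x # v)"
  using assms unfolding multilinear_def by blast+

lemma words_Cons [simp]: "a # w \<in> words A \<longleftrightarrow> a \<in> carrier A \<and> set w \<subseteq> carrier A"
  by (auto simp: words_def)

lemma words_append_Cons [simp]:
  "u @ a # w \<in> words A \<longleftrightarrow> set u \<subseteq> carrier A \<and> a \<in> carrier A \<and> set w \<subseteq> carrier A"
  by (auto simp: words_def)

lemma words_cases:
  assumes "w \<in> words A"
  obtains (single) a where "w = [a]" "a \<in> carrier A"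
    | (Cons) a b v where "w = a # b # v" "a \<in> carrier A" "b # v \<in> words A"
  using assms by (cases w rule: remdups_adj.cases) (auto simp: words_def)

context
  fixes K :: "('k, 'e) ring_scheme" and A :: "('k, 'a, 'm) module_scheme"
  assumes A: "module K A"
begin

interpretation A: module K A by (rule A)

lemma tensor_free_module: "module K (tensor_free K A n)"
  unfolding tensor_free_def by (rule free_module_module[OF A.R.is_cring])

lemma tensor_gen_closed: "w \<in> tuples A n \<Longrightarrow> free_gen K w \<in> carrier (tensor_free K A n)"
  unfolding tensor_free_def by (rule free_gen_closed[OF A.R.is_cring])

lemma tensor_rels_closed: "tensor_rels K A n \<subseteq> carrier (tensor_free K A n)"
proof
  fix r assume r: "r \<in> tensor_rels K A n"
  interpret F: module K "tensor_free K A n" by (rule tensor_free_module)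
  show "r \<in> carrier (tensor_free K A n)"
    using r unfolding tensor_rels_def
  proof (elim UnE CollectE exE conjE, goal_cases)
    case (1 u v x y)
    then have "u @ (x \<oplus>\<^bsub>A\<^esub> y) # v \<in> tuples A n" "u @ y # v \<in> tuples A n"
      by (auto simp: tuples_def)
    with 1 show ?case by (simp add: tensor_gen_closed)
  next
    case (2 u v x c)
    then have "u @ (c \<odot>\<^bsub>A\<^esub> x) # v \<in> tuples A n" by (auto simp: tuples_def)
    with 2 show ?case by (simp add: tensor_gen_closed)
  qed
qed

lemma tensor_kernel_submodule: "submodule (tensor_kernel K A n) K (tensor_free K A n)"
  and tensor_rels_kernel: "tensor_rels K A n \<subseteq> tensor_kernel K A n"
  unfolding tensor_kernel_def
  by (rule span_module_submodule[OF tensor_free_module tensor_rels_closed])+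

lemma tensor_power_module: "module K (tensor_power K A n)"
  unfolding tensor_power_def by (rule quotient_module_module[OF tensor_free_module tensor_kernel_submodule])

lemma sha_module_module: "module K (sha_module K A)"
  unfolding sha_module_def by (rule direct_sum_module[OF A.R.is_cring tensor_power_module])

abbreviation (input) tcoset where
  "tcoset n f \<equiv> tensor_kernel K A n +>\<^bsub>tensor_free K A n\<^esub> f"

lemma pure_eq_summand:
  "pure K A w = summand {1..} (tensor_power K A) (length w) (tcoset (length w) (free_gen K w))"
  unfolding pure_def summand_def by (rule restrict_ext) simp

lemma words_tuples: "w \<in> words A \<longleftrightarrow> w \<in> tuples A (length w) \<and> length w \<in> {1..}"
  by (cases w) (auto simp: words_def tuples_def)

lemma tcoset_closed: "f \<in> carrier (tensor_free K A n) \<Longrightarrow> tcoset n f \<in> carrier (tensor_power K A n)"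
  by (simp add: tensor_power_def quotient_carrier[OF tensor_free_module tensor_kernel_submodule])

lemmas tcoset_add = quotient_add[OF tensor_free_module tensor_kernel_submodule, folded tensor_power_def]
lemmas tcoset_smult = quotient_smult[OF tensor_free_module tensor_kernel_submodule, folded tensor_power_def]
lemmas tcoset_zero = quotient_zero[OF tensor_free_module tensor_kernel_submodule, folded tensor_power_def]
lemmas tsummand = summand_linear[where I = "{1..}" and D = "tensor_power K A",
  OF A.R.is_cring tensor_power_module, folded sha_module_def]

lemma tsummand_closed:
  "n \<in> {1..} \<Longrightarrow> x \<in> carrier (tensor_power K A n) \<Longrightarrow>
    summand {1..} (tensor_power K A) n x \<in> carrier (sha_module K A)"
  unfolding sha_module_def by (rule summand_closed[OF A.R.is_cring tensor_power_module])

lemma pure_closed [intro]: "w \<in> words A \<Longrightarrow> pure K A w \<in> carrier (sha_module K A)"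
  unfolding pure_eq_summand sha_module_def
  by (rule summand_closed[OF A.R.is_cring tensor_power_module])
    (use words_tuples tcoset_closed tensor_gen_closed in auto)

lemma pure_multilinear: "multilinear K A (sha_module K A) (pure K A)"
proof (rule multilinearI)
  fix u v x y assume a: "set u \<subseteq> carrier A" "set v \<subseteq> carrier A" "x \<in> carrier A" "y \<in> carrier A"
  define n where "n = length (u @ x # v)"
  have len: "length (u @ (x \<oplus>\<^bsub>A\<^esub> y) # v) = n" "length (u @ x # v) = n" "length (u @ y # v) = n"
    by (simp_all add: n_def)
  have t: "u @ (x \<oplus>\<^bsub>A\<^esub> y) # v \<in> tuples A n" "u @ x # v \<in> tuples A n" "u @ y # v \<in> tuples A n"
    using a by (auto simp: tuples_def n_def)
  interpret F: module K "tensor_free K A n" by (rule tensor_free_module)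
  note g = t[THEN tensor_gen_closed]
  have "free_gen K (u @ (x \<oplus>\<^bsub>A\<^esub> y) # v) \<ominus>\<^bsub>tensor_free K A n\<^esub>
      (free_gen K (u @ x # v) \<oplus>\<^bsub>tensor_free K A n\<^esub> free_gen K (u @ y # v)) \<in> tensor_rels K A n"
    unfolding tensor_rels_def using t a by blast
  then have "tcoset n (free_gen K (u @ (x \<oplus>\<^bsub>A\<^esub> y) # v)) =
      tcoset n (free_gen K (u @ x # v) \<oplus>\<^bsub>tensor_free K A n\<^esub> free_gen K (u @ y # v))"
    using g tensor_rels_kernel by (intro coset_eqI[OF tensor_free_module tensor_kernel_submodule]) auto
  also have "\<dots> = tcoset n (free_gen K (u @ x # v)) \<oplus>\<^bsub>tensor_power K A n\<^esub> tcoset n (free_gen K (u @ y # v))"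
    using g by (simp add: tcoset_add)
  finally show "pure K A (u @ (x \<oplus>\<^bsub>A\<^esub> y) # v) = pure K A (u @ x # v) \<oplus>\<^bsub>sha_module K A\<^esub> pure K A (u @ y # v)"
    unfolding pure_eq_summand len using g tcoset_closed by (simp add: tsummand del: One_nat_def)
next
  fix u v x c assume a: "set u \<subseteq> carrier A" "set v \<subseteq> carrier A" "x \<in> carrier A" "c \<in> carrier K"
  define n where "n = length (u @ x # v)"
  have len: "length (u @ (c \<odot>\<^bsub>A\<^esub> x) # v) = n" "length (u @ x # v) = n"
    by (simp_all add: n_def)
  have t: "u @ (c \<odot>\<^bsub>A\<^esub> x) # v \<in> tuples A n" "u @ x # v \<in> tuples A n"
    using a by (auto simp: tuples_def n_def)
  interpret F: module K "tensor_free K A n" by (rule tensor_free_module)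
  note g = t[THEN tensor_gen_closed]
  have "free_gen K (u @ (c \<odot>\<^bsub>A\<^esub> x) # v) \<ominus>\<^bsub>tensor_free K A n\<^esub>
      (c \<odot>\<^bsub>tensor_free K A n\<^esub> free_gen K (u @ x # v)) \<in> tensor_rels K A n"
    unfolding tensor_rels_def using t a by blast
  then have "tcoset n (free_gen K (u @ (c \<odot>\<^bsub>A\<^esub> x) # v)) =
      tcoset n (c \<odot>\<^bsub>tensor_free K A n\<^esub> free_gen K (u @ x # v))"
    using g a tensor_rels_kernel by (intro coset_eqI[OF tensor_free_module tensor_kernel_submodule]) auto
  also have "\<dots> = c \<odot>\<^bsub>tensor_power K A n\<^esub> tcoset n (free_gen K (u @ x # v))"
    using g a by (simp add: tcoset_smult)
  finally show "pure K A (u @ (c \<odot>\<^bsub>A\<^esub> x) # v) = c \<odot>\<^bsub>sha_module K A\<^esub> pure K A (u @ x # v)"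
    unfolding pure_eq_summand len using a by (simp add: tsummand del: One_nat_def)
qed (rule pure_closed)

text \<open>Pure tensors span: an element has finitely many nonzero components, and each component is the
  coset of a finite combination of words.\<close>

lemma sha_induct [consumes 1, case_names zero add pure]:
  assumes x: "x \<in> carrier (sha_module K A)"
    and zero: "Q \<zero>\<^bsub>sha_module K A\<^esub>"
    and add: "\<And>x y. x \<in> carrier (sha_module K A) \<Longrightarrow> y \<in> carrier (sha_module K A) \<Longrightarrow>
      Q x \<Longrightarrow> Q y \<Longrightarrow> Q (x \<oplus>\<^bsub>sha_module K A\<^esub> y)"
    and pure: "\<And>c w. c \<in> carrier K \<Longrightarrow> w \<in> words A \<Longrightarrow> Q (c \<odot>\<^bsub>sha_module K A\<^esub> pure K A w)"
  shows "Q x"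
proof -
  have "x \<in> carrier (direct_sum {1..} (tensor_power K A))" using x by (simp add: sha_module_def)
  then show ?thesis
  proof (induction rule: direct_sum_induct[OF A.R.is_cring tensor_power_module, consumes 1, case_names zero add summand])
    case (summand n X)
    then obtain f where f: "f \<in> carrier (tensor_free K A n)" and X: "X = tcoset n f"
      by (auto simp: tensor_power_def quotient_carrier[OF tensor_free_module tensor_kernel_submodule])
    let ?s = "summand {1..} (tensor_power K A) n"
    interpret F: module K "tensor_free K A n" by (rule tensor_free_module)
    have "f \<in> carrier (free_module K (tuples A n))" using f by (simp add: tensor_free_def)
    from A.R.is_cring this have "Q (?s (tcoset n f))"
    proof (induction rule: free_module_induct)
      case zero
      show ?case using \<open>Q \<zero>\<^bsub>sha_module K A\<^esub>\<close>
        by (simp add: tensor_free_def[symmetric] tcoset_zero[symmetric] tsummand del: One_nat_def)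
    next
      case (add f g)
      note cl = add.hyps[folded tensor_free_def]
      have "?s (tcoset n f) \<in> carrier (sha_module K A)" "?s (tcoset n g) \<in> carrier (sha_module K A)"
        using cl \<open>n \<in> {1..}\<close> tcoset_closed tsummand_closed by blast+
      then have "Q (?s (tcoset n f) \<oplus>\<^bsub>sha_module K A\<^esub> ?s (tcoset n g))"
        by (rule assms(3)) (use add.IH in auto)
      then show ?case using cl tcoset_closed
        by (simp add: tensor_free_def[symmetric] tcoset_add[symmetric] tsummand(1)[symmetric] del: One_nat_def)
    next
      case (gen c w)
      then have len: "length w = n" and w: "w \<in> words A"
        using \<open>n \<in> {1..}\<close> words_tuples by (auto simp: tuples_def)
      have "?s (tcoset n (c \<odot>\<^bsub>tensor_free K A n\<^esub> free_gen K w)) = c \<odot>\<^bsub>sha_module K A\<^esub> pure K A w"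
        using gen tensor_gen_closed by (simp add: tcoset_smult[symmetric] tsummand pure_eq_summand len del: One_nat_def)
      then show ?case using pure[OF gen(1) w] by (simp add: tensor_free_def)
    qed
    then show ?case by (simp add: X)
  qed (use zero add in \<open>simp_all add: sha_module_def\<close>)
qed

lemma linear_map_eqI:
  assumes N: "module K N" and f: "f \<in> linear_maps K (sha_module K A) N" and g: "g \<in> linear_maps K (sha_module K A) N"
    and eq: "\<And>w. w \<in> words A \<Longrightarrow> f (pure K A w) = g (pure K A w)"
  shows "f = g"
proof (rule extensionalityI)
  show "f \<in> extensional (carrier (sha_module K A))" "g \<in> extensional (carrier (sha_module K A))"
    using linear_mapsD(1)[OF f] linear_mapsD(1)[OF g] by (auto simp: PiE_def)
  fix x assume "x \<in> carrier (sha_module K A)"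
  then show "f x = g x"
  proof (induction rule: sha_induct)
    case zero show ?case using linear_map_zero[OF sha_module_module N f] linear_map_zero[OF sha_module_module N g] by simp
  qed (use linear_mapsD[OF f] linear_mapsD[OF g] eq pure_closed in auto)
qed

text \<open>The elements annihilated by \<open>h\<close> form a submodule, and it contains the defining relations of the
  tensor power because \<open>\<phi>\<close> is multilinear.\<close>

lemma multilinear_kernel:
  assumes N: "module K N" and h: "h \<in> linear_maps K (tensor_free K A n) N" and \<phi>: "multilinear K A N \<phi>"
    and eq: "\<And>w. w \<in> tuples A n \<Longrightarrow> h (free_gen K w) = \<phi> w" and n: "n \<ge> 1"
    and x: "x \<in> tensor_kernel K A n"
  shows "h x = \<zero>\<^bsub>N\<^esub>"
proof -
  interpret N: module K N by fact
  interpret F: module K "tensor_free K A n" by (rule tensor_free_module)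
  note hD = linear_mapsD[OF h]
  let ?H = "{x \<in> carrier (tensor_free K A n). h x = \<zero>\<^bsub>N\<^esub>}"
  have "submodule ?H K (tensor_free K A n)"
    by (rule F.submoduleI)
      (use hD linear_map_zero[OF tensor_free_module N h] linear_map_neg[OF tensor_free_module N h] in auto)
  moreover have "tensor_rels K A n \<subseteq> ?H"
  proof
    fix r assume r: "r \<in> tensor_rels K A n"
    have diff: "h (f \<ominus>\<^bsub>tensor_free K A n\<^esub> g) = \<zero>\<^bsub>N\<^esub>"
      if "f \<in> carrier (tensor_free K A n)" "g \<in> carrier (tensor_free K A n)" "h f = h g" for f g
      using that hD linear_map_neg[OF tensor_free_module N h] by (simp add: F.M.minus_eq N.M.r_neg)
    have "h r = \<zero>\<^bsub>N\<^esub>"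
      using r unfolding tensor_rels_def
    proof (elim UnE CollectE exE conjE, goal_cases)
      case (1 u v x y)
      then have uv: "set u \<subseteq> carrier A" "set v \<subseteq> carrier A" "x \<in> carrier A" by (auto simp: tuples_def)
      have t: "u @ (x \<oplus>\<^bsub>A\<^esub> y) # v \<in> tuples A n" "u @ y # v \<in> tuples A n"
        using 1 by (auto simp: tuples_def)
      show ?case unfolding 1
        by (rule diff) (use t 1 uv tensor_gen_closed hD eq multilinearD(2)[OF \<phi>] in auto)
    next
      case (2 u v x c)
      then have uv: "set u \<subseteq> carrier A" "set v \<subseteq> carrier A" "x \<in> carrier A" by (auto simp: tuples_def)
      have t: "u @ (c \<odot>\<^bsub>A\<^esub> x) # v \<in> tuples A n"
        using 2 by (auto simp: tuples_def)
      show ?case unfolding 2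
        by (rule diff) (use t 2 uv tensor_gen_closed hD eq multilinearD(3)[OF \<phi>] in auto)
    qed
    then show "r \<in> ?H" using r tensor_rels_closed by blast
  qed
  ultimately show ?thesis using x span_module_least unfolding tensor_kernel_def by blast
qed

text \<open>The three universal properties combine: a multilinear \<open>\<phi>\<close> extends over the free modules, hence
  over their quotients, hence over the direct sum.\<close>

lemma multilinear_ext:
  assumes N: "module K N" and \<phi>: "multilinear K A N \<phi>"
  shows "\<exists>h\<in>linear_maps K (sha_module K A) N. \<forall>w\<in>words A. h (pure K A w) = \<phi> w"
proof -
  have "\<exists>g\<in>linear_maps K (tensor_power K A n) N. \<forall>w\<in>tuples A n. g (tcoset n (free_gen K w)) = \<phi> w"
    if n: "n \<in> {1..}" for n
  proof -
    have "\<phi> w \<in> carrier N" if "w \<in> tuples A n" for w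
      using that n multilinearD(1)[OF \<phi>] words_tuples by (auto simp: tuples_def)
    then obtain h where h: "h \<in> linear_maps K (tensor_free K A n) N"
        "\<And>w. w \<in> tuples A n \<Longrightarrow> h (free_gen K w) = \<phi> w"
      using free_module_ext[OF A.R.is_cring N, of "tuples A n" \<phi>] unfolding tensor_free_def by blast
    have "h x = \<zero>\<^bsub>N\<^esub>" if "x \<in> tensor_kernel K A n" for x
      using multilinear_kernel[OF N h(1) \<phi> h(2) _ that] n by auto
    then obtain g where "g \<in> linear_maps K (tensor_power K A n) N"
        "\<And>x. x \<in> carrier (tensor_free K A n) \<Longrightarrow> g (tcoset n x) = h x"
      using quotient_module_ext[OF tensor_free_module tensor_kernel_submodule h(1) N]
      unfolding tensor_power_def by blast
    then show ?thesis using h tensor_gen_closed by (intro bexI[of _ g]) auto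
  qed
  then obtain g where g: "\<And>n. n \<in> {1..} \<Longrightarrow> g n \<in> linear_maps K (tensor_power K A n) N"
      "\<And>n w. n \<in> {1..} \<Longrightarrow> w \<in> tuples A n \<Longrightarrow> g n (tcoset n (free_gen K w)) = \<phi> w"
    by metis
  obtain h where h: "h \<in> linear_maps K (sha_module K A) N"
      "\<And>n x. n \<in> {1..} \<Longrightarrow> x \<in> carrier (tensor_power K A n) \<Longrightarrow>
        h (summand {1..} (tensor_power K A) n x) = g n x"
    using direct_sum_ext[where I = "{1..}" and D = "tensor_power K A" and g = g,
        OF A.R.is_cring tensor_power_module N g(1)]
    unfolding sha_module_def by blast
  have "h (pure K A w) = \<phi> w" if "w \<in> words A" for w
    using that words_tuples h(2) g(2) tcoset_closed tensor_gen_closed by (simp add: pure_eq_summand del: One_nat_def)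
  with h show ?thesis by blast
qed

text \<open>The definite description is legitimate: existence is \<open>multilinear_ext\<close>, and uniqueness is
  \<open>linear_map_eqI\<close>, that is, spanning by pure tensors.\<close>

lemma lin_ext:
  assumes N: "module K N" and \<phi>: "multilinear K A N \<phi>"
  shows "lin_ext K A N \<phi> \<in> linear_maps K (sha_module K A) N"
    and "w \<in> words A \<Longrightarrow> lin_ext K A N \<phi> (pure K A w) = \<phi> w"
proof -
  have "\<exists>!h. h \<in> linear_maps K (sha_module K A) N \<and> (\<forall>w\<in>words A. h (pure K A w) = \<phi> w)"
    using multilinear_ext[OF N \<phi>] linear_map_eqI[OF N] by (metis (no_types, lifting))
  from theI'[OF this] show "lin_ext K A N \<phi> \<in> linear_maps K (sha_module K A) N"
    and "w \<in> words A \<Longrightarrow> lin_ext K A N \<phi> (pure K A w) = \<phi> w"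
    unfolding lin_ext_def by blast+
qed

end


section \<open>The product on \<open>Sha(A)\<close>\<close>

lemma linear_add:
  assumes N: "module K N" and f: "(\<lambda>x\<in>carrier M. f x) \<in> linear_maps K M N" and g: "(\<lambda>x\<in>carrier M. g x) \<in> linear_maps K M N"
    and M: "module K M"
  shows "(\<lambda>x\<in>carrier M. f x \<oplus>\<^bsub>N\<^esub> g x) \<in> linear_maps K M N"
proof -
  interpret M: module K M by fact
  interpret N: module K N by fact
  have fg: "x \<in> carrier M \<Longrightarrow> f x \<in> carrier N" "x \<in> carrier M \<Longrightarrow> g x \<in> carrier N" for x
    using linear_mapsD(2)[OF f, of x] linear_mapsD(2)[OF g, of x] by simp_all
  show ?thesis
  proof (rule linear_mapsI)
    fix x y assume xy: "x \<in> carrier M" "y \<in> carrier M"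
    have "f (x \<oplus>\<^bsub>M\<^esub> y) = f x \<oplus>\<^bsub>N\<^esub> f y" "g (x \<oplus>\<^bsub>M\<^esub> y) = g x \<oplus>\<^bsub>N\<^esub> g y"
      using linear_mapsD(3)[OF f, of x y] linear_mapsD(3)[OF g, of x y] xy by simp_all
    then show "(\<lambda>x\<in>carrier M. f x \<oplus>\<^bsub>N\<^esub> g x) (x \<oplus>\<^bsub>M\<^esub> y) =
        (\<lambda>x\<in>carrier M. f x \<oplus>\<^bsub>N\<^esub> g x) x \<oplus>\<^bsub>N\<^esub> (\<lambda>x\<in>carrier M. f x \<oplus>\<^bsub>N\<^esub> g x) y"
      using xy fg by (simp add: N.M.a_ac)
  next
    fix c x assume cx: "c \<in> carrier K" "x \<in> carrier M"
    have "f (c \<odot>\<^bsub>M\<^esub> x) = c \<odot>\<^bsub>N\<^esub> f x" "g (c \<odot>\<^bsub>M\<^esub> x) = c \<odot>\<^bsub>N\<^esub> g x"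
      using linear_mapsD(4)[OF f, of c x] linear_mapsD(4)[OF g, of c x] cx by simp_all
    then show "(\<lambda>x\<in>carrier M. f x \<oplus>\<^bsub>N\<^esub> g x) (c \<odot>\<^bsub>M\<^esub> x) = c \<odot>\<^bsub>N\<^esub> (\<lambda>x\<in>carrier M. f x \<oplus>\<^bsub>N\<^esub> g x) x"
      using cx fg by (simp add: N.smult_r_distr)
  qed (use fg in auto)
qed

lemma linear_comp:
  assumes h: "h \<in> linear_maps K N L" and f: "(\<lambda>x\<in>carrier M. f x) \<in> linear_maps K M N" and M: "module K M"
  shows "(\<lambda>x\<in>carrier M. h (f x)) \<in> linear_maps K M L"
  using linear_maps_compose[OF f h M] by (simp add: compose_def cong: restrict_cong)

lemma linear_smult_map:
  assumes N: "module K N" and c: "c \<in> carrier K"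
  shows "(\<lambda>x\<in>carrier N. c \<odot>\<^bsub>N\<^esub> x) \<in> linear_maps K N N"
proof -
  interpret N: module K N by fact
  show ?thesis
    by (rule linear_mapsI)
      (use c in \<open>auto simp: N.smult_r_distr N.smult_assoc1[symmetric] N.R.m_comm\<close>)
qed

lemma linear_smult:
  assumes N: "module K N" and c: "c \<in> carrier K" and f: "(\<lambda>x\<in>carrier M. f x) \<in> linear_maps K M N" and M: "module K M"
  shows "(\<lambda>x\<in>carrier M. c \<odot>\<^bsub>N\<^esub> f x) \<in> linear_maps K M N"
proof -
  have "f x \<in> carrier N" if "x \<in> carrier M" for x using linear_mapsD(2)[OF f that] that by simp
  then show ?thesis
    using linear_comp[OF linear_smult_map[OF N c] f M] by (simp cong: restrict_cong)
qed

lemma linear_slotI: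
  assumes "multilinear K A N \<phi>" "module K A" "set u \<subseteq> carrier A" "set v \<subseteq> carrier A"
  shows "(\<lambda>x\<in>carrier A. \<phi> (u @ x # v)) \<in> linear_maps K A N"
proof -
  interpret A: module K A by fact
  show ?thesis by (rule linear_mapsI) (use assms multilinearD[OF assms(1)] in auto)
qed

text \<open>Multilinearity in this form is obtained by composing linear maps, so that additivity and
  homogeneity need not be treated separately.\<close>

lemma multilinear_slotsI:
  assumes A: "module K A"
    and slot: "\<And>u v. set u \<subseteq> carrier A \<Longrightarrow> set v \<subseteq> carrier A \<Longrightarrow>
      (\<lambda>x\<in>carrier A. \<phi> (u @ x # v)) \<in> linear_maps K A N"
  shows "multilinear K A N \<phi>"
proof -
  interpret A: module K A by fact
  show ?thesis
  proof (rule multilinearI)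
    fix w assume "w \<in> words A"
    then show "\<phi> w \<in> carrier N"
      using linear_mapsD(2)[OF slot[of "[]" "tl w"], of "hd w"] by (cases w) (auto simp: words_def)
  next
    fix u v x y assume a: "set u \<subseteq> carrier A" "set v \<subseteq> carrier A" "x \<in> carrier A" "y \<in> carrier A"
    show "\<phi> (u @ (x \<oplus>\<^bsub>A\<^esub> y) # v) = \<phi> (u @ x # v) \<oplus>\<^bsub>N\<^esub> \<phi> (u @ y # v)"
      using linear_mapsD(3)[OF slot[OF a(1,2)] a(3,4)] a by simp
  next
    fix u v x c assume a: "set u \<subseteq> carrier A" "set v \<subseteq> carrier A" "x \<in> carrier A" "c \<in> carrier K"
    show "\<phi> (u @ (c \<odot>\<^bsub>A\<^esub> x) # v) = c \<odot>\<^bsub>N\<^esub> \<phi> (u @ x # v)"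
      using linear_mapsD(4)[OF slot[OF a(1,2)] a(4,3)] a by simp
  qed
qed

locale weighted_algebra = A: algebra K A
  for K :: "('k, 'e) ring_scheme" and A :: "('k, 'a, 'm) module_scheme" +
  fixes lam :: 'k
  assumes lam [simp, intro]: "lam \<in> carrier K"
begin

abbreviation S where "S \<equiv> sha_module K A"
abbreviation pr where "pr \<equiv> pure K A"
abbreviation wm where "wm \<equiv> sha_word_mult K lam A"
abbreviation pre where "pre \<equiv> prepend K A"
abbreviation mul (infixl "\<diamondop>" 70) where "x \<diamondop> y \<equiv> sha_mult K lam A x y"

lemma A_module: "module K A" by (rule A.module)

sublocale S: module K S by (rule sha_module_module[OF A_module])

lemma linear_pure_slot:
  assumes "(\<lambda>x\<in>carrier A. f x) \<in> linear_maps K A A" "set u \<subseteq> carrier A" "set v \<subseteq> carrier A"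
  shows "(\<lambda>x\<in>carrier A. pr (u @ f x # v)) \<in> linear_maps K A S"
proof -
  have "f x \<in> carrier A" if "x \<in> carrier A" for x using linear_mapsD(2)[OF assms(1) that] that by simp
  then show ?thesis
    using linear_comp[OF linear_slotI[OF pure_multilinear[OF A_module] A_module assms(2,3)] assms(1) A_module]
    by (simp cong: restrict_cong)
qed

lemma linear_id: "(\<lambda>x\<in>carrier A. x) \<in> linear_maps K A A"
  by (rule linear_mapsI) auto

lemma linear_lmult: "a \<in> carrier A \<Longrightarrow> (\<lambda>x\<in>carrier A. a \<otimes>\<^bsub>A\<^esub> x) \<in> linear_maps K A A"
  by (rule linear_mapsI) (auto simp: A.r_distr A.smult_assoc2 A.m_comm[of a])

lemmas pure_closed' [simp, intro] = pure_closed[OF A_module]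

lemma prepend_multilinear: "a \<in> carrier A \<Longrightarrow> multilinear K A S (\<lambda>w. pr (a # w))"
  by (rule multilinear_slotsI[OF A_module])
    (use linear_pure_slot[OF linear_id, of "a # _"] in simp)

lemma prepend_linear: "a \<in> carrier A \<Longrightarrow> pre a \<in> linear_maps K S S"
  and prepend_pure [simp]: "a \<in> carrier A \<Longrightarrow> w \<in> words A \<Longrightarrow> pre a (pr w) = pr (a # w)"
  unfolding prepend_def using lin_ext[OF A_module S.module_axioms prepend_multilinear] by blast+

lemma prepend_simps [simp]:
  assumes a: "a \<in> carrier A"
  shows "x \<in> carrier S \<Longrightarrow> pre a x \<in> carrier S"
    and "x \<in> carrier S \<Longrightarrow> y \<in> carrier S \<Longrightarrow> pre a (x \<oplus>\<^bsub>S\<^esub> y) = pre a x \<oplus>\<^bsub>S\<^esub> pre a y"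
    and "c \<in> carrier K \<Longrightarrow> x \<in> carrier S \<Longrightarrow> pre a (c \<odot>\<^bsub>S\<^esub> x) = c \<odot>\<^bsub>S\<^esub> pre a x"
    and "pre a \<zero>\<^bsub>S\<^esub> = \<zero>\<^bsub>S\<^esub>"
  using linear_mapsD[OF prepend_linear[OF a]]
    linear_map_zero[OF S.module_axioms S.module_axioms prepend_linear[OF a]] by auto

lemmas S_induct = sha_induct[OF A_module, consumes 1, case_names zero add pure]

lemma smult_left_commute:
  "c \<in> carrier K \<Longrightarrow> d \<in> carrier K \<Longrightarrow> x \<in> carrier S \<Longrightarrow> c \<odot>\<^bsub>S\<^esub> (d \<odot>\<^bsub>S\<^esub> x) = d \<odot>\<^bsub>S\<^esub> (c \<odot>\<^bsub>S\<^esub> x)"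
  by (simp add: S.smult_assoc1[symmetric] A.R.m_comm)

text \<open>The recursion for the product prepends \<open>a\<^sub>0 b\<^sub>0\<close>; this is what makes it linear in the first letters.\<close>

lemma prepend_linear_left: "s \<in> carrier S \<Longrightarrow> (\<lambda>a\<in>carrier A. pre a s) \<in> linear_maps K A S"
proof (induction rule: S_induct)
  case zero
  show ?case by (rule linear_mapsI) auto
next
  case (add x y)
  have "(\<lambda>a\<in>carrier A. pre a x \<oplus>\<^bsub>S\<^esub> pre a y) \<in> linear_maps K A S"
    by (rule linear_add[OF S.module_axioms add.IH A_module])
  then show ?case using add by (simp add: restrict_def cong: if_cong)
next
  case (pure c w)
  have "(\<lambda>a\<in>carrier A. pr ([] @ a # w)) \<in> linear_maps K A S"
    by (rule linear_pure_slot[OF linear_id]) (use pure in \<open>auto simp: words_def\<close>)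
  then have "(\<lambda>a\<in>carrier A. c \<odot>\<^bsub>S\<^esub> pr ([] @ a # w)) \<in> linear_maps K A S"
    using linear_smult[OF S.module_axioms pure(1)] A_module by blast
  then show ?case using pure by (simp add: restrict_def cong: if_cong)
qed

text \<open>Keeping the tails whole shows that the three products on the right have smaller total length,
  which is the measure for all inductions on the product.\<close>

lemma word_mult_Cons:
  assumes "s \<noteq> []" "t \<noteq> []"
  shows "wm (a # s) (b # t) = pre (a \<otimes>\<^bsub>A\<^esub> b)
    (wm s (\<one>\<^bsub>A\<^esub> # t) \<oplus>\<^bsub>S\<^esub> wm (\<one>\<^bsub>A\<^esub> # s) t \<oplus>\<^bsub>S\<^esub> lam \<odot>\<^bsub>S\<^esub> wm s t)"
  using assms by (cases s; cases t) auto

lemma word_mult_single: "wm [a] (b # t) = pr ((a \<otimes>\<^bsub>A\<^esub> b) # t)" "wm (a # s) [b] = pr ((a \<otimes>\<^bsub>A\<^esub> b) # s)"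
  by simp (cases s; simp)

lemma word_mult_closed: "u \<in> words A \<Longrightarrow> v \<in> words A \<Longrightarrow> wm u v \<in> carrier S"
proof (induction "length u + length v" arbitrary: u v rule: less_induct)
  case less
  from less.prems obtain a s b t where uv: "u = a # s" "v = b # t" "a \<in> carrier A" "b \<in> carrier A"
      "set s \<subseteq> carrier A" "set t \<subseteq> carrier A"
    by (cases u; cases v) (auto simp: words_def)
  show ?case
  proof (cases "s = [] \<or> t = []")
    case True
    then show ?thesis using uv by (auto simp: word_mult_single)
  next
    case False
    then have w: "s \<in> words A" "t \<in> words A" "\<one>\<^bsub>A\<^esub> # s \<in> words A" "\<one>\<^bsub>A\<^esub> # t \<in> words A"
      using uv by (auto simp: words_def)
    have "wm s (\<one>\<^bsub>A\<^esub> # t) \<in> carrier S" "wm (\<one>\<^bsub>A\<^esub> # s) t \<in> carrier S" "wm s t \<in> carrier S"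
      by (rule less.hyps; use w uv in simp)+
    then show ?thesis using False uv by (simp add: word_mult_Cons)
  qed
qed

text \<open>Exchanging the arguments exchanges the first two of the three recursive summands.\<close>

lemma word_mult_commute: "u \<in> words A \<Longrightarrow> v \<in> words A \<Longrightarrow> wm u v = wm v u"
proof (induction "length u + length v" arbitrary: u v rule: less_induct)
  case less
  from less.prems obtain a s b t where uv: "u = a # s" "v = b # t" "a \<in> carrier A" "b \<in> carrier A"
      "set s \<subseteq> carrier A" "set t \<subseteq> carrier A"
    by (cases u; cases v) (auto simp: words_def)
  show ?case
  proof (cases "s = [] \<or> t = []")
    case True
    then show ?thesis using uv by (auto simp: word_mult_single A.m_comm)
  next
    case False
    then have w: "s \<in> words A" "t \<in> words A" "\<one>\<^bsub>A\<^esub> # s \<in> words A" "\<one>\<^bsub>A\<^esub> # t \<in> words A"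
      using uv by (auto simp: words_def)
    have "wm s (\<one>\<^bsub>A\<^esub> # t) = wm (\<one>\<^bsub>A\<^esub> # t) s" "wm (\<one>\<^bsub>A\<^esub> # s) t = wm t (\<one>\<^bsub>A\<^esub> # s)" "wm s t = wm t s"
      by (rule less.hyps; use w uv in simp)+
    then show ?thesis using False uv w word_mult_closed
      by (simp add: word_mult_Cons A.m_comm S.M.a_comm)
  qed
qed

text \<open>If the varying letter is the head of the second word, it enters through \<open>a \<otimes> x\<close> only. Otherwise it
  lies in the tail, and the three recursive products are linear in it by induction. Linearity in the
  letters of the first word then follows by commutativity.\<close>

lemma word_mult_slot:
  "u \<in> words A \<Longrightarrow> set p \<subseteq> carrier A \<Longrightarrow> set q \<subseteq> carrier A \<Longrightarrow>
    (\<lambda>x\<in>carrier A. wm u (p @ x # q)) \<in> linear_maps K A S"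
proof (induction "length u + length p + length q" arbitrary: u p q rule: less_induct)
  case less
  then obtain a s where u: "u = a # s" "a \<in> carrier A" "set s \<subseteq> carrier A"
    by (cases u) (auto simp: words_def)
  show ?case
  proof (cases p)
    case p: Nil
    show ?thesis
    proof (cases "s = [] \<or> q = []")
      case True
      then have "wm u (p @ x # q) = pr ([] @ (a \<otimes>\<^bsub>A\<^esub> x) # s @ q)" for x
        using u p by (auto simp: word_mult_single)
      then show ?thesis using linear_pure_slot[OF linear_lmult, of a "[]" "s @ q"] u less.prems by simp
    next
      case False
      let ?X = "wm s (\<one>\<^bsub>A\<^esub> # q) \<oplus>\<^bsub>S\<^esub> wm (\<one>\<^bsub>A\<^esub> # s) q \<oplus>\<^bsub>S\<^esub> lam \<odot>\<^bsub>S\<^esub> wm s q"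
      have w: "s \<in> words A" "q \<in> words A" using False u less.prems by (auto simp: words_def)
      have X: "?X \<in> carrier S" using w u less.prems word_mult_closed by auto
      have "(\<lambda>x\<in>carrier A. (\<lambda>c\<in>carrier A. pre c ?X) (a \<otimes>\<^bsub>A\<^esub> x)) \<in> linear_maps K A S"
        by (rule linear_comp[OF prepend_linear_left[OF X] linear_lmult[OF u(2)] A_module])
      then show ?thesis using u p False by (simp add: word_mult_Cons cong: restrict_cong)
    qed
  next
    case p: (Cons b p')
    show ?thesis
    proof (cases "s = []")
      case True
      then have "wm u (p @ x # q) = pr (((a \<otimes>\<^bsub>A\<^esub> b) # p') @ x # q)" for x
        using u p by (auto simp: word_mult_single)
      then show ?thesis using linear_pure_slot[OF linear_id, of "(a \<otimes>\<^bsub>A\<^esub> b) # p'" q] u p less.prems by simp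
    next
      case False
      have w: "s \<in> words A" using False u by (auto simp: words_def)
      have "(\<lambda>x\<in>carrier A. wm s ((\<one>\<^bsub>A\<^esub> # p') @ x # q)) \<in> linear_maps K A S"
           "(\<lambda>x\<in>carrier A. wm (\<one>\<^bsub>A\<^esub> # s) (p' @ x # q)) \<in> linear_maps K A S"
           "(\<lambda>x\<in>carrier A. wm s (p' @ x # q)) \<in> linear_maps K A S"
        by (rule less.hyps; use w u p less.prems in simp)+
      then have "(\<lambda>x\<in>carrier A. pre (a \<otimes>\<^bsub>A\<^esub> b) (wm s ((\<one>\<^bsub>A\<^esub> # p') @ x # q) \<oplus>\<^bsub>S\<^esub>
          wm (\<one>\<^bsub>A\<^esub> # s) (p' @ x # q) \<oplus>\<^bsub>S\<^esub> lam \<odot>\<^bsub>S\<^esub> wm s (p' @ x # q))) \<in> linear_maps K A S"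
        by (intro linear_comp[OF prepend_linear] linear_add linear_smult)
          (use p u less.prems A_module S.module_axioms in auto)
      then show ?thesis using u p False by (simp add: word_mult_Cons cong: restrict_cong)
    qed
  qed
qed

lemma word_mult_multilinear_right: "u \<in> words A \<Longrightarrow> multilinear K A S (wm u)"
  by (rule multilinear_slotsI[OF A_module]) (rule word_mult_slot)

lemma word_mult_multilinear_left:
  assumes "v \<in> words A" shows "multilinear K A S (\<lambda>u. wm u v)"
proof (rule multilinear_slotsI[OF A_module])
  fix p q assume "set p \<subseteq> carrier A" "set q \<subseteq> carrier A"
  with word_mult_slot[OF assms this]
  show "(\<lambda>x\<in>carrier A. wm (p @ x # q) v) \<in> linear_maps K A S"
    using word_mult_commute[OF _ assms] by (simp cong: restrict_cong)
qed

lemmas word_act = lin_ext[OF A_module S.module_axioms word_mult_multilinear_right]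

text \<open>The product is defined by two nested linear extensions; this licenses the outer one.\<close>

lemma word_act_multilinear:
  assumes "y \<in> carrier S" shows "multilinear K A S (\<lambda>u. lin_ext K A S (wm u) y)"
proof (rule multilinear_slotsI[OF A_module])
  fix p q assume pq: "set p \<subseteq> carrier A" "set q \<subseteq> carrier A"
  let ?L = "\<lambda>x. lin_ext K A S (wm (p @ x # q))"
  have L: "?L x \<in> linear_maps K S S" if "x \<in> carrier A" for x
    using word_act(1) pq that by simp
  show "(\<lambda>x\<in>carrier A. ?L x y) \<in> linear_maps K A S"
    using assms
  proof (induction rule: S_induct)
    case zero
    show ?case
      using linear_map_zero[OF S.module_axioms S.module_axioms L]
      by (intro linear_mapsI) auto
  next
    case (add y z)
    have "(\<lambda>x\<in>carrier A. ?L x y \<oplus>\<^bsub>S\<^esub> ?L x z) \<in> linear_maps K A S"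
      by (rule linear_add[OF S.module_axioms add.IH A_module])
    then show ?case using add linear_mapsD(3)[OF L] by (simp add: restrict_def cong: if_cong)
  next
    case (pure c w)
    have "(\<lambda>x\<in>carrier A. c \<odot>\<^bsub>S\<^esub> wm (p @ x # q) w) \<in> linear_maps K A S"
      by (intro linear_smult[OF S.module_axioms pure(1) _ A_module]
          linear_slotI[OF word_mult_multilinear_left[OF pure(2)] A_module pq])
    then show ?case using pure pq linear_mapsD(4)[OF L] word_act(2)
      by (simp add: restrict_def cong: if_cong)
  qed
qed

lemma mul_linear_left: "y \<in> carrier S \<Longrightarrow> (\<lambda>x. x \<diamondop> y) \<in> linear_maps K S S"
  and mul_word_left: "y \<in> carrier S \<Longrightarrow> u \<in> words A \<Longrightarrow> pr u \<diamondop> y = lin_ext K A S (wm u) y"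
  unfolding sha_mult_def using lin_ext[OF A_module S.module_axioms word_act_multilinear] by auto

lemma mul_left_simps [simp]:
  assumes y: "y \<in> carrier S"
  shows "x \<in> carrier S \<Longrightarrow> x \<diamondop> y \<in> carrier S"
    and "x \<in> carrier S \<Longrightarrow> z \<in> carrier S \<Longrightarrow> (x \<oplus>\<^bsub>S\<^esub> z) \<diamondop> y = x \<diamondop> y \<oplus>\<^bsub>S\<^esub> z \<diamondop> y"
    and "c \<in> carrier K \<Longrightarrow> x \<in> carrier S \<Longrightarrow> (c \<odot>\<^bsub>S\<^esub> x) \<diamondop> y = c \<odot>\<^bsub>S\<^esub> (x \<diamondop> y)"
    and "\<zero>\<^bsub>S\<^esub> \<diamondop> y = \<zero>\<^bsub>S\<^esub>"
  using linear_mapsD[OF mul_linear_left[OF y]]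
    linear_map_zero[OF S.module_axioms S.module_axioms mul_linear_left[OF y]] by auto

lemma pure_mul [simp]: "u \<in> words A \<Longrightarrow> v \<in> words A \<Longrightarrow> pr u \<diamondop> pr v = wm u v"
  using mul_word_left word_act(2) by simp

lemma mul_add_right [simp]:
  "x \<in> carrier S \<Longrightarrow> y \<in> carrier S \<Longrightarrow> z \<in> carrier S \<Longrightarrow> x \<diamondop> (y \<oplus>\<^bsub>S\<^esub> z) = x \<diamondop> y \<oplus>\<^bsub>S\<^esub> x \<diamondop> z"
proof (induction x rule: S_induct)
  case (add x x')
  then show ?case by (simp add: S.M.a_ac)
next
  case (pure c w)
  then show ?case using linear_mapsD(3)[OF word_act(1)] linear_mapsD(2)[OF word_act(1)]
    by (simp add: mul_word_left S.smult_r_distr)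
qed simp

lemma mul_smult_right [simp]:
  "x \<in> carrier S \<Longrightarrow> y \<in> carrier S \<Longrightarrow> c \<in> carrier K \<Longrightarrow> x \<diamondop> (c \<odot>\<^bsub>S\<^esub> y) = c \<odot>\<^bsub>S\<^esub> (x \<diamondop> y)"
proof (induction x rule: S_induct)
  case (add x x')
  then show ?case by (simp add: S.smult_r_distr)
next
  case (pure d w)
  then show ?case using linear_mapsD(4)[OF word_act(1)] linear_mapsD(2)[OF word_act(1)]
    by (simp add: mul_word_left smult_left_commute[of c])
qed simp

lemma mul_zero_right [simp]: "x \<in> carrier S \<Longrightarrow> x \<diamondop> \<zero>\<^bsub>S\<^esub> = \<zero>\<^bsub>S\<^esub>"
  using mul_smult_right[of x "\<zero>\<^bsub>S\<^esub>" "\<zero>\<^bsub>K\<^esub>"] by simp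

lemma mul_commute: "x \<in> carrier S \<Longrightarrow> y \<in> carrier S \<Longrightarrow> x \<diamondop> y = y \<diamondop> x"
proof (induction x rule: S_induct)
  case (pure c u)
  from pure(3) have "pr u \<diamondop> y = y \<diamondop> pr u"
    by (induction y rule: S_induct) (use pure in \<open>simp_all add: word_mult_commute\<close>)
  then show ?case using pure by simp
qed simp_all

lemma single_mul_prepend [simp]:
  assumes "a \<in> carrier A" "b \<in> carrier A"
  shows "s \<in> carrier S \<Longrightarrow> pr [a] \<diamondop> pre b s = pre (a \<otimes>\<^bsub>A\<^esub> b) s"
proof (induction rule: S_induct)
  case (pure c w)
  then show ?case using assms by (cases w) (auto simp: words_def)
qed (use assms in simp_all)

lemma one_mul [simp]: "s \<in> carrier S \<Longrightarrow> pr [\<one>\<^bsub>A\<^esub>] \<diamondop> s = s"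
proof (induction rule: S_induct)
  case (pure c w)
  then show ?case by (cases w) (auto simp: words_def)
qed simp_all

text \<open>Multiplication by \<open>a \<in> A\<close> only touches the first tensor factor, and the first factors of a product
  are multiplied in \<open>A\<close>.\<close>

lemma single_mul_assoc:
  assumes a: "a \<in> carrier A"
  shows "s \<in> carrier S \<Longrightarrow> t \<in> carrier S \<Longrightarrow> (pr [a] \<diamondop> s) \<diamondop> t = pr [a] \<diamondop> (s \<diamondop> t)"
proof (induction s rule: S_induct)
  case (pure c u)
  from pure(3) have "(pr [a] \<diamondop> pr u) \<diamondop> t = pr [a] \<diamondop> (pr u \<diamondop> t)"
  proof (induction t rule: S_induct)
    case (pure d v)
    from pure \<open>u \<in> words A\<close> obtain b s e t where uv: "u = b # s" "v = e # t" "b \<in> carrier A" "e \<in> carrier A"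
        "set s \<subseteq> carrier A" "set t \<subseteq> carrier A"
      by (cases u; cases v) (auto simp: words_def)
    show ?case
    proof (cases "s = [] \<or> t = []")
      case True
      then show ?thesis using uv a pure by (auto simp: word_mult_single A.m_assoc)
    next
      case False
      then have w: "s \<in> words A" "t \<in> words A" "\<one>\<^bsub>A\<^esub> # s \<in> words A" "\<one>\<^bsub>A\<^esub> # t \<in> words A"
        using uv by (auto simp: words_def)
      then show ?thesis using False uv a pure
        by (simp add: word_mult_Cons word_mult_single word_mult_closed A.m_assoc)
    qed
  qed (use pure a in \<open>simp_all del: pure_mul\<close>)
  then show ?case using pure a by (simp del: pure_mul)
qed (use a in simp_all)

abbreviation P where "P \<equiv> pre \<one>\<^bsub>A\<^esub>"

text \<open>On words with first letter \<open>1\<close> the recursion for the product is the Rota-Baxter identity; both sides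
  are bilinear.\<close>

lemma P_mul:
  "s \<in> carrier S \<Longrightarrow> t \<in> carrier S \<Longrightarrow>
    P s \<diamondop> P t = P (s \<diamondop> P t \<oplus>\<^bsub>S\<^esub> P s \<diamondop> t \<oplus>\<^bsub>S\<^esub> lam \<odot>\<^bsub>S\<^esub> (s \<diamondop> t))"
proof (induction s rule: S_induct)
  case (add s s')
  then show ?case by (simp add: S.smult_r_distr S.M.a_ac)
next
  case (pure c u)
  from pure(3) have "P (pr u) \<diamondop> P t = P (pr u \<diamondop> P t \<oplus>\<^bsub>S\<^esub> P (pr u) \<diamondop> t \<oplus>\<^bsub>S\<^esub> lam \<odot>\<^bsub>S\<^esub> (pr u \<diamondop> t))"
  proof (induction t rule: S_induct)
    case (add t t')
    then show ?case using pure by (simp add: S.smult_r_distr S.M.a_ac del: prepend_pure)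
  next
    case (pure d v)
    have w: "u \<noteq> []" "v \<noteq> []" "set u \<subseteq> carrier A" "set v \<subseteq> carrier A"
      using pure \<open>u \<in> words A\<close> by (auto simp: words_def)
    then have "P (pr u) \<diamondop> P (pr v) = P (pr u \<diamondop> P (pr v) \<oplus>\<^bsub>S\<^esub> P (pr u) \<diamondop> pr v \<oplus>\<^bsub>S\<^esub> lam \<odot>\<^bsub>S\<^esub> (pr u \<diamondop> pr v))"
      using pure \<open>u \<in> words A\<close> by (simp add: word_mult_Cons)
    then show ?case using pure \<open>u \<in> words A\<close>
      by (simp add: S.smult_r_distr smult_left_commute[of lam] del: prepend_pure pure_mul)
  qed (use pure in \<open>simp_all del: prepend_pure\<close>)
  then show ?case using pure
    by (simp add: S.smult_r_distr smult_left_commute[of lam] del: prepend_pure)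
qed simp_all

text \<open>A word of length at least two is an element of \<open>A\<close> times \<open>P\<close> of a shorter word. Arguments about the
  product use this form and never look inside a word.\<close>

lemma word_decompose:
  assumes "w \<in> words A"
  obtains (single) a where "a \<in> carrier A" "w = [a]"
    | (prepend) a v where "a \<in> carrier A" "v \<in> words A" "length w = Suc (length v)" "pr w = pr [a] \<diamondop> P (pr v)"
proof (cases rule: words_cases[OF assms])
  case (1 a)
  then show ?thesis using single by blast
next
  case (2 a b v)
  then show ?thesis using prepend[of a "b # v"] by (simp add: word_mult_single)
qed

text \<open>By \<open>single_mul_assoc\<close> and commutativity, a factor from \<open>A\<close> can be pulled out of any position of a
  triple product, for either bracketing.\<close>

lemma assoc_scale:
  assumes "a \<in> carrier A" "s \<in> carrier S" "t \<in> carrier S" "r \<in> carrier S"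
    and "(s \<diamondop> t) \<diamondop> r = s \<diamondop> (t \<diamondop> r)"
  shows "((pr [a] \<diamondop> s) \<diamondop> t) \<diamondop> r = (pr [a] \<diamondop> s) \<diamondop> (t \<diamondop> r)"
    and "(s \<diamondop> (pr [a] \<diamondop> t)) \<diamondop> r = s \<diamondop> ((pr [a] \<diamondop> t) \<diamondop> r)"
    and "(s \<diamondop> t) \<diamondop> (pr [a] \<diamondop> r) = s \<diamondop> (t \<diamondop> (pr [a] \<diamondop> r))"
proof -
  have pull: "x \<diamondop> (pr [a] \<diamondop> y) = pr [a] \<diamondop> (x \<diamondop> y)" if "x \<in> carrier S" "y \<in> carrier S" for x y
  proof -
    have "x \<diamondop> (pr [a] \<diamondop> y) = (pr [a] \<diamondop> y) \<diamondop> x" by (rule mul_commute) (use that assms in auto)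
    also have "\<dots> = pr [a] \<diamondop> (y \<diamondop> x)" by (rule single_mul_assoc) (use that assms in auto)
    finally show ?thesis using mul_commute that by simp
  qed
  show "((pr [a] \<diamondop> s) \<diamondop> t) \<diamondop> r = (pr [a] \<diamondop> s) \<diamondop> (t \<diamondop> r)"
    using assms by (simp add: single_mul_assoc)
  show "(s \<diamondop> (pr [a] \<diamondop> t)) \<diamondop> r = s \<diamondop> ((pr [a] \<diamondop> t) \<diamondop> r)"
    using assms by (simp add: pull single_mul_assoc)
  show "(s \<diamondop> t) \<diamondop> (pr [a] \<diamondop> r) = s \<diamondop> (t \<diamondop> (pr [a] \<diamondop> r))"
    using assms by (simp add: pull)
qed

text \<open>Applying \<open>P_mul\<close> twice on either side yields \<open>P\<close> of the same seven terms: those obtained from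
  \<open>P s \<diamondop> P t \<diamondop> P r\<close> by removing \<open>P\<close> from a nonempty set of factors, with a power of \<open>lam\<close> that is one less
  than the number of factors changed.\<close>

lemma assoc_P:
  assumes S: "s \<in> carrier S" "t \<in> carrier S" "r \<in> carrier S"
    and "(s \<diamondop> P t) \<diamondop> P r = s \<diamondop> (P t \<diamondop> P r)" "(P s \<diamondop> t) \<diamondop> P r = P s \<diamondop> (t \<diamondop> P r)"
    and "(P s \<diamondop> P t) \<diamondop> r = P s \<diamondop> (P t \<diamondop> r)"
    and "(s \<diamondop> t) \<diamondop> P r = s \<diamondop> (t \<diamondop> P r)" "(s \<diamondop> P t) \<diamondop> r = s \<diamondop> (P t \<diamondop> r)"
    and "(P s \<diamondop> t) \<diamondop> r = P s \<diamondop> (t \<diamondop> r)" "(s \<diamondop> t) \<diamondop> r = s \<diamondop> (t \<diamondop> r)"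
  shows "(P s \<diamondop> P t) \<diamondop> P r = P s \<diamondop> (P t \<diamondop> P r)"
proof -
  let ?X = "s \<diamondop> P t \<oplus>\<^bsub>S\<^esub> P s \<diamondop> t \<oplus>\<^bsub>S\<^esub> lam \<odot>\<^bsub>S\<^esub> (s \<diamondop> t)"
  let ?Y = "t \<diamondop> P r \<oplus>\<^bsub>S\<^esub> P t \<diamondop> r \<oplus>\<^bsub>S\<^esub> lam \<odot>\<^bsub>S\<^esub> (t \<diamondop> r)"
  have st: "P s \<diamondop> P t = P ?X" and tr: "P t \<diamondop> P r = P ?Y" using S by (simp_all only: P_mul)
  \<comment> \<open>The inner \<open>P ?X\<close> is folded back to \<open>P s \<diamondop> P t\<close>, so that the triple products can be reassociated.\<close>
  have "(P s \<diamondop> P t) \<diamondop> P r = P (?X \<diamondop> P r \<oplus>\<^bsub>S\<^esub> P ?X \<diamondop> r \<oplus>\<^bsub>S\<^esub> lam \<odot>\<^bsub>S\<^esub> (?X \<diamondop> r))"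
    unfolding st by (rule P_mul) (use S in simp_all)
  also have "\<dots> = P (?X \<diamondop> P r \<oplus>\<^bsub>S\<^esub> (P s \<diamondop> P t) \<diamondop> r \<oplus>\<^bsub>S\<^esub> lam \<odot>\<^bsub>S\<^esub> (?X \<diamondop> r))"
    by (simp only: st)
  also have "\<dots> = P (s \<diamondop> (P t \<diamondop> P r) \<oplus>\<^bsub>S\<^esub> P s \<diamondop> ?Y \<oplus>\<^bsub>S\<^esub> lam \<odot>\<^bsub>S\<^esub> (s \<diamondop> ?Y))"
    using assms by (simp add: S.smult_r_distr S.M.a_ac del: prepend_simps(2,3))
  also have "\<dots> = P (s \<diamondop> P ?Y \<oplus>\<^bsub>S\<^esub> P s \<diamondop> ?Y \<oplus>\<^bsub>S\<^esub> lam \<odot>\<^bsub>S\<^esub> (s \<diamondop> ?Y))"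
    by (simp only: tr)
  also have "\<dots> = P s \<diamondop> (P t \<diamondop> P r)"
    unfolding tr by (rule P_mul[symmetric]) (use S in simp_all)
  finally show ?thesis .
qed

text \<open>If one of the words is a single letter, associativity is \<open>A\<close>-bilinearity. Otherwise the letters in
  front are stripped by \<open>assoc_scale\<close>, and each triple in \<open>assoc_P\<close> has smaller total length.\<close>

lemma word_mul_assoc:
  "u \<in> words A \<Longrightarrow> v \<in> words A \<Longrightarrow> w \<in> words A \<Longrightarrow> (pr u \<diamondop> pr v) \<diamondop> pr w = pr u \<diamondop> (pr v \<diamondop> pr w)"
proof (induction "length u + length v + length w" arbitrary: u v w rule: less_induct)
  case less
  note wd = less.prems
  note cl = wd[THEN pure_closed']
  show ?case
  proof (cases rule: word_decompose[OF wd(1)])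
    case (1 a)
    then show ?thesis using single_mul_assoc cl by blast
  next
    case u: (2 a u')
    show ?thesis
    proof (cases rule: word_decompose[OF wd(2)])
      case (1 b)
      have b: "pr [b] \<in> carrier S" using 1 by simp
      have "(pr u \<diamondop> pr v) \<diamondop> pr w = (pr [b] \<diamondop> pr u) \<diamondop> pr w" using mul_commute[OF cl(1) b] 1 by simp
      also have "\<dots> = pr [b] \<diamondop> (pr u \<diamondop> pr w)" using single_mul_assoc[OF 1(1)] cl by blast
      also have "\<dots> = pr [b] \<diamondop> (pr w \<diamondop> pr u)" using mul_commute[OF cl(1,3)] by simp
      also have "\<dots> = (pr [b] \<diamondop> pr w) \<diamondop> pr u" using single_mul_assoc[OF 1(1)] cl by simp
      also have "\<dots> = pr u \<diamondop> (pr [b] \<diamondop> pr w)" by (rule mul_commute) (use cl b in simp_all)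
      finally show ?thesis using 1 by simp
    next
      case v: (2 b v')
      show ?thesis
      proof (cases rule: word_decompose[OF wd(3)])
        case (1 c)
        have c: "pr [c] \<in> carrier S" using 1 by simp
        have "(pr u \<diamondop> pr v) \<diamondop> pr w = pr [c] \<diamondop> (pr u \<diamondop> pr v)"
          unfolding 1 by (rule mul_commute) (use cl c in simp_all)
        also have "\<dots> = pr [c] \<diamondop> (pr v \<diamondop> pr u)" using mul_commute[OF cl(1,2)] by simp
        also have "\<dots> = (pr [c] \<diamondop> pr v) \<diamondop> pr u" using single_mul_assoc[OF 1(1)] cl by simp
        also have "\<dots> = pr u \<diamondop> (pr [c] \<diamondop> pr v)" by (rule mul_commute) (use cl c in simp_all)
        also have "\<dots> = pr u \<diamondop> (pr v \<diamondop> pr [c])" using mul_commute[OF cl(2) c] by simp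
        finally show ?thesis using 1 by simp
      next
        case w: (2 c w')
        note cl' = u(2)[THEN pure_closed'] v(2)[THEN pure_closed'] w(2)[THEN pure_closed']
        have Pw: "P (pr z) = pr (\<one>\<^bsub>A\<^esub> # z)" "\<one>\<^bsub>A\<^esub> # z \<in> words A" if "z \<in> words A" for z
          using that by (auto simp: words_def)
        note Pw1 = u(2)[THEN Pw(1)] v(2)[THEN Pw(1)] w(2)[THEN Pw(1)]
        note Pw2 = u(2)[THEN Pw(2)] v(2)[THEN Pw(2)] w(2)[THEN Pw(2)]
        have IH: "(pr x \<diamondop> pr y) \<diamondop> pr z = pr x \<diamondop> (pr y \<diamondop> pr z)"
          if "x \<in> words A" "y \<in> words A" "z \<in> words A"
            "length x + length y + length z < length u + length v + length w" for x y z
          using less.hyps that by blast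
        have "(P (pr u') \<diamondop> P (pr v')) \<diamondop> P (pr w') = P (pr u') \<diamondop> (P (pr v') \<diamondop> P (pr w'))"
          by (rule assoc_P, unfold Pw1)
            ((rule cl' | (rule IH; (rule Pw2 u(2) v(2) w(2) | simp add: u(3) v(3) w(3))))+)
        moreover have "P (pr u') \<in> carrier S" "P (pr v') \<in> carrier S" "P (pr w') \<in> carrier S"
          using cl' by (simp_all only: prepend_simps(1) A.one_closed)
        ultimately show ?thesis
          unfolding u(4) v(4) w(4)
          by (intro assoc_scale mul_left_simps(1))
            (use u(1) v(1) w(1) in \<open>simp_all del: prepend_pure\<close>)
      qed
    qed
  qed
qed

lemma mul_assoc:
  assumes "x \<in> carrier S" "y \<in> carrier S" "z \<in> carrier S"
  shows "(x \<diamondop> y) \<diamondop> z = x \<diamondop> (y \<diamondop> z)"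
  using assms(1)
proof (induction x rule: S_induct)
  case (pure c u)
  from assms(2) have "(pr u \<diamondop> y) \<diamondop> z = pr u \<diamondop> (y \<diamondop> z)"
  proof (induction y rule: S_induct)
    case (pure d v)
    from assms(3) have "(pr u \<diamondop> pr v) \<diamondop> z = pr u \<diamondop> (pr v \<diamondop> z)"
    proof (induction z rule: S_induct)
      case (pure e w)
      then show ?case using \<open>u \<in> words A\<close> \<open>v \<in> words A\<close> word_mul_assoc by (simp del: pure_mul)
    qed (use \<open>u \<in> words A\<close> \<open>v \<in> words A\<close> in \<open>simp_all del: pure_mul\<close>)
    then show ?case using \<open>u \<in> words A\<close> pure assms(3) by (simp del: pure_mul)
  qed (use pure assms(3) in simp_all)
  then show ?case using pure assms by simp
qed (use assms in simp_all)


text \<open>The ring structure lives on any record with these fields; the one of interest, \<open>free_drb\<close>, is formed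
  once \<open>A\<close> carries a derivation.\<close>

lemma sha_algebra:
  assumes F: "carrier F = carrier S" "mult F = sha_mult K lam A" "one F = pr [\<one>\<^bsub>A\<^esub>]"
    "zero F = \<zero>\<^bsub>S\<^esub>" "add F = add S" "smult F = smult S"
  shows "algebra K F"
proof (rule algebraI)
  show "cring F"
  proof (rule cringI)
    show "abelian_group F"
      by (rule abelian_groupI)
        (use S.M.a_closed S.M.a_comm S.M.a_assoc S.M.l_neg S.M.a_inv_closed in \<open>auto simp: F\<close>)
    show "comm_monoid F"
      by (rule comm_monoidI) (auto simp: F mul_assoc intro: mul_commute)
  qed (simp add: F)
qed (simp_all add: F S.smult_l_distr S.smult_r_distr S.smult_assoc1 A.R.is_cring)

lemma P_rota_baxter:
  assumes F: "carrier F = carrier S" "mult F = sha_mult K lam A" "add F = add S" "smult F = smult S"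
  shows "is_rota_baxter K lam F P"
  unfolding is_rota_baxter_def
proof (intro conjI ballI)
  show "P \<in> linear_maps K F F" using prepend_linear[of "\<one>\<^bsub>A\<^esub>"] by (simp add: linear_maps_def F)
next
  fix x y assume "x \<in> carrier F" "y \<in> carrier F"
  then show "P x \<otimes>\<^bsub>F\<^esub> P y =
      P (x \<otimes>\<^bsub>F\<^esub> P y) \<oplus>\<^bsub>F\<^esub> P (y \<otimes>\<^bsub>F\<^esub> P x) \<oplus>\<^bsub>F\<^esub> lam \<odot>\<^bsub>F\<^esub> P (x \<otimes>\<^bsub>F\<^esub> y)"
    by (simp add: F P_mul mul_commute[of y "P x"])
qed

end

section \<open>The derivation on \<open>Sha(A)\<close>\<close>

text \<open>Here \<open>l\<close> stands for \<open>lam \<odot> 1\<close>. Both sides are the symmetric expansion of the twisted derivative of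
  \<open>x y z\<close>; the two groupings of the factors give the same terms.\<close>

lemma (in cring) leibniz_shift_identity:
  assumes "x \<in> carrier R" "y \<in> carrier R" "z \<in> carrier R" "dx \<in> carrier R" "dy \<in> carrier R" "dz \<in> carrier R"
    "l \<in> carrier R"
  shows "dx \<otimes> (y \<otimes> z) \<oplus> x \<otimes> (dy \<otimes> z \<oplus> y \<otimes> dz \<oplus> l \<otimes> (dy \<otimes> dz)) \<oplus>
      l \<otimes> (dx \<otimes> (dy \<otimes> z \<oplus> y \<otimes> dz \<oplus> l \<otimes> (dy \<otimes> dz)))
    = (dx \<otimes> y \<oplus> x \<otimes> dy \<oplus> l \<otimes> (dx \<otimes> dy)) \<otimes> z \<oplus> (x \<otimes> y) \<otimes> dz \<oplus>
      l \<otimes> ((dx \<otimes> y \<oplus> x \<otimes> dy \<oplus> l \<otimes> (dx \<otimes> dy)) \<otimes> dz)"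
  using assms by algebra

text \<open>The ring computation behind the Leibniz rule for \<open>a\<close> and \<open>b P s\<close>, with \<open>p = P s\<close>: the left side is the
  derivative of \<open>(a b) P s\<close> and the right side comes from that of \<open>b P s\<close>.\<close>

lemma (in cring) leibniz_single_identity:
  assumes "a \<in> carrier R" "b \<in> carrier R" "da \<in> carrier R" "db \<in> carrier R" "s \<in> carrier R" "p \<in> carrier R"
    "l \<in> carrier R"
  shows "(da \<otimes> b \<oplus> a \<otimes> db \<oplus> l \<otimes> (da \<otimes> db)) \<otimes> p \<oplus> (a \<otimes> b) \<otimes> s \<oplus>
      l \<otimes> ((da \<otimes> b \<oplus> a \<otimes> db \<oplus> l \<otimes> (da \<otimes> db)) \<otimes> s)
    = da \<otimes> (b \<otimes> p) \<oplus> a \<otimes> (db \<otimes> p \<oplus> b \<otimes> s \<oplus> l \<otimes> (db \<otimes> s)) \<oplus>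
      l \<otimes> (da \<otimes> (db \<otimes> p \<oplus> b \<otimes> s \<oplus> l \<otimes> (db \<otimes> s)))"
  using assms by algebra

locale weighted_dif_algebra =
  fixes K :: "('k, 'e) ring_scheme" and lam :: 'k and A :: "('k, 'a) dif_alg"
  assumes A: "A \<in> dif_algs K lam" and lam_closed: "lam \<in> carrier K"
begin

sublocale weighted_algebra K A lam
  using A lam_closed by (auto simp: weighted_algebra_def weighted_algebra_axioms_def dif_algs_def)

lemma der: "is_derivation K lam A (der A)"
  using A by (simp add: dif_algs_def)

lemma der_linear: "der A \<in> linear_maps K A A"
  and der_mult: "x \<in> carrier A \<Longrightarrow> y \<in> carrier A \<Longrightarrow> der A (x \<otimes>\<^bsub>A\<^esub> y) =
    der A x \<otimes>\<^bsub>A\<^esub> y \<oplus>\<^bsub>A\<^esub> x \<otimes>\<^bsub>A\<^esub> der A y \<oplus>\<^bsub>A\<^esub> lam \<odot>\<^bsub>A\<^esub> (der A x \<otimes>\<^bsub>A\<^esub> der A y)"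
  and der_one: "der A \<one>\<^bsub>A\<^esub> = \<zero>\<^bsub>A\<^esub>"
  using der by (auto simp: is_derivation_def)

lemmas der_closed [simp, intro] = linear_mapsD(2)[OF der_linear]

text \<open>The clauses for \<open>dhat_word\<close> treat the first two letters specially, so the slot may be the only
  letter, the first of several, the second, or a later one.\<close>

lemma dhat_word_slot:
  assumes p: "set p \<subseteq> carrier A" and q: "set q \<subseteq> carrier A"
  shows "(\<lambda>x\<in>carrier A. dhat_word K lam A (p @ x # q)) \<in> linear_maps K A S"
proof -
  note add = linear_add[OF S.module_axioms _ _ A_module] linear_smult[OF S.module_axioms lam _ A_module]
  have der_l: "(\<lambda>x\<in>carrier A. der A x) \<in> linear_maps K A A"
    using der_linear linear_mapsD(1)[OF der_linear] by (simp add: extensional_restrict PiE_def)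
  have rmult: "(\<lambda>x\<in>carrier A. x \<otimes>\<^bsub>A\<^esub> c) \<in> linear_maps K A A" if "c \<in> carrier A" for c
    using linear_lmult[OF that] that by (simp add: A.m_comm[of c] cong: restrict_cong)
  have der_rmult: "(\<lambda>x\<in>carrier A. der A x \<otimes>\<^bsub>A\<^esub> c) \<in> linear_maps K A A" if "c \<in> carrier A" for c
    using linear_comp[OF rmult[OF that] der_l A_module] by (simp cong: restrict_cong)
  consider (a) "p = []" "q = []" | (b) c q' where "p = []" "q = c # q'" | (c) b where "p = [b]"
    | (d) b c p' where "p = b # c # p'"
    by (metis neq_Nil_conv)
  then show ?thesis
  proof cases
    case a
    then show ?thesis using linear_pure_slot[OF der_l, of "[]" "[]"] by simp
  next
    case b
    then show ?thesis
      using add(1)[OF add(1)[OF linear_pure_slot[OF der_l, of "[]" q] linear_pure_slot[OF rmult, of c "[]" q']]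
          add(2)[OF linear_pure_slot[OF der_rmult, of c "[]" q']]] q by simp
  next
    case c
    then show ?thesis
      using add(1)[OF add(1)[OF linear_pure_slot[OF linear_id, of "[der A b]" q] linear_pure_slot[OF linear_lmult, of b "[]" q]]
          add(2)[OF linear_pure_slot[OF linear_lmult, of "der A b" "[]" q]]] p q by simp
  next
    case d
    then show ?thesis
      using add(1)[OF add(1)[OF linear_pure_slot[OF linear_id, of "der A b # c # p'" q]
            linear_pure_slot[OF linear_id, of "(b \<otimes>\<^bsub>A\<^esub> c) # p'" q]]
          add(2)[OF linear_pure_slot[OF linear_id, of "(der A b \<otimes>\<^bsub>A\<^esub> c) # p'" q]]] p q by simp
  qed
qed

abbreviation dhat where "dhat \<equiv> lin_ext K A S (dhat_word K lam A)"

lemmas dhat_linear = lin_ext(1)[OF A_module S.module_axioms multilinear_slotsI[OF A_module dhat_word_slot]]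
  and dhat_pure [simp] = lin_ext(2)[OF A_module S.module_axioms multilinear_slotsI[OF A_module dhat_word_slot]]

lemma dhat_simps [simp]:
  shows "x \<in> carrier S \<Longrightarrow> dhat x \<in> carrier S"
    and "x \<in> carrier S \<Longrightarrow> y \<in> carrier S \<Longrightarrow> dhat (x \<oplus>\<^bsub>S\<^esub> y) = dhat x \<oplus>\<^bsub>S\<^esub> dhat y"
    and "c \<in> carrier K \<Longrightarrow> x \<in> carrier S \<Longrightarrow> dhat (c \<odot>\<^bsub>S\<^esub> x) = c \<odot>\<^bsub>S\<^esub> dhat x"
    and "dhat \<zero>\<^bsub>S\<^esub> = \<zero>\<^bsub>S\<^esub>"
  using linear_mapsD[OF dhat_linear]
    linear_map_zero[OF S.module_axioms S.module_axioms dhat_linear] by auto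

text \<open>The defining formula for words of length at least two, with the tail replaced by an arbitrary tensor:
  multiplying the first letter of the tail by \<open>x\<close> is the product with \<open>x\<close>.\<close>

lemma dhat_prepend:
  assumes a: "a \<in> carrier A"
  shows "s \<in> carrier S \<Longrightarrow>
    dhat (pre a s) = pre (der A a) s \<oplus>\<^bsub>S\<^esub> pr [a] \<diamondop> s \<oplus>\<^bsub>S\<^esub> lam \<odot>\<^bsub>S\<^esub> (pr [der A a] \<diamondop> s)"
proof (induction rule: S_induct)
  case (add s t)
  then show ?case using a by (simp add: S.smult_r_distr S.M.a_ac)
next
  case (pure c w)
  then obtain b v where w: "w = b # v" by (cases w) (auto simp: words_def)
  show ?case using pure a by (simp add: w S.smult_r_distr smult_left_commute[of lam])
qed (use a in simp_all)

lemma prepend_zero_left: "s \<in> carrier S \<Longrightarrow> pre \<zero>\<^bsub>A\<^esub> s = \<zero>\<^bsub>S\<^esub>"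
  using linear_map_zero[OF A_module S.module_axioms prepend_linear_left] by simp

lemma pure_zero: "pr [\<zero>\<^bsub>A\<^esub>] = \<zero>\<^bsub>S\<^esub>"
  using linear_map_zero[OF A_module S.module_axioms linear_pure_slot[OF linear_id, of "[]" "[]"]] by simp

text \<open>Since \<open>d 1 = 0\<close>, only the middle one of the three terms in \<open>dhat_prepend\<close> survives.\<close>

lemma dhat_P: "s \<in> carrier S \<Longrightarrow> dhat (P s) = s"
proof -
  assume s: "s \<in> carrier S"
  show ?thesis using s dhat_prepend[of "\<one>\<^bsub>A\<^esub>" s] by (simp add: der_one pure_zero prepend_zero_left)
qed


abbreviation F where "F \<equiv> free_drb K lam A"

lemma F_simps:
  "carrier F = carrier S" "mult F = sha_mult K lam A" "one F = pr [\<one>\<^bsub>A\<^esub>]"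
  "zero F = \<zero>\<^bsub>S\<^esub>" "add F = add S" "smult F = smult S" "der F = dhat" "rb F = P"
  by (simp_all add: free_drb_def)

sublocale F: algebra K F by (rule sha_algebra) (simp_all add: F_simps)

lemma pure_single:
  assumes a: "a \<in> carrier A" and b: "b \<in> carrier A"
  shows "pr [a \<otimes>\<^bsub>A\<^esub> b] = pr [a] \<otimes>\<^bsub>F\<^esub> pr [b]" "pr [a \<oplus>\<^bsub>A\<^esub> b] = pr [a] \<oplus>\<^bsub>F\<^esub> pr [b]"
    "c \<in> carrier K \<Longrightarrow> pr [c \<odot>\<^bsub>A\<^esub> a] = c \<odot>\<^bsub>F\<^esub> pr [a]"
proof -
  have L: "(\<lambda>x\<in>carrier A. pr [x]) \<in> linear_maps K A S"
    using linear_pure_slot[OF linear_id, of "[]" "[]"] by simp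
  show "pr [a \<otimes>\<^bsub>A\<^esub> b] = pr [a] \<otimes>\<^bsub>F\<^esub> pr [b]" using a b by (simp add: F_simps)
  show "pr [a \<oplus>\<^bsub>A\<^esub> b] = pr [a] \<oplus>\<^bsub>F\<^esub> pr [b]"
    using linear_mapsD(3)[OF L a b] a b by (simp add: F_simps)
  show "c \<in> carrier K \<Longrightarrow> pr [c \<odot>\<^bsub>A\<^esub> a] = c \<odot>\<^bsub>F\<^esub> pr [a]"
    using linear_mapsD(4)[OF L _ a] a by (simp add: F_simps)
qed

definition leibniz where
  "leibniz x y \<longleftrightarrow> dhat (x \<diamondop> y) = dhat x \<diamondop> y \<oplus>\<^bsub>S\<^esub> x \<diamondop> dhat y \<oplus>\<^bsub>S\<^esub> lam \<odot>\<^bsub>S\<^esub> (dhat x \<diamondop> dhat y)"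

text \<open>Replacing the scalar \<open>lam\<close> by an element of \<open>Sha(A)\<close> turns Leibniz rules into identities of
  commutative rings.\<close>

abbreviation lamF where "lamF \<equiv> lam \<odot>\<^bsub>F\<^esub> \<one>\<^bsub>F\<^esub>"

lemma lamF_mult: "x \<in> carrier F \<Longrightarrow> lam \<odot>\<^bsub>F\<^esub> x = lamF \<otimes>\<^bsub>F\<^esub> x"
  by (simp add: F.smult_assoc2)

lemma leibniz_iff:
  assumes "x \<in> carrier S" "y \<in> carrier S"
  shows "leibniz x y \<longleftrightarrow>
    dhat (x \<otimes>\<^bsub>F\<^esub> y) = dhat x \<otimes>\<^bsub>F\<^esub> y \<oplus>\<^bsub>F\<^esub> x \<otimes>\<^bsub>F\<^esub> dhat y \<oplus>\<^bsub>F\<^esub> lamF \<otimes>\<^bsub>F\<^esub> (dhat x \<otimes>\<^bsub>F\<^esub> dhat y)"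
  using assms lamF_mult[of "dhat x \<otimes>\<^bsub>F\<^esub> dhat y"] by (simp add: leibniz_def F_simps)

lemma leibniz_commute:
  assumes "x \<in> carrier S" "y \<in> carrier S" shows "leibniz x y \<longleftrightarrow> leibniz y x"
  using assms mul_commute[of x y] mul_commute[of "dhat x" y] mul_commute[of x "dhat y"] mul_commute[of "dhat x" "dhat y"]
  by (simp add: leibniz_def S.M.a_comm[of "y \<diamondop> dhat x"])

text \<open>Under the hypotheses both rules compute the derivative of \<open>x \<diamondop> y \<diamondop> z\<close> by the same expression.\<close>

lemma leibniz_shift:
  assumes S: "x \<in> carrier S" "y \<in> carrier S" "z \<in> carrier S" and xy: "leibniz x y" and yz: "leibniz y z"
  shows "leibniz x (y \<diamondop> z) \<longleftrightarrow> leibniz (x \<diamondop> y) z"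
proof -
  have cl: "x \<in> carrier F" "y \<in> carrier F" "z \<in> carrier F" "dhat x \<in> carrier F" "dhat y \<in> carrier F"
      "dhat z \<in> carrier F" "lamF \<in> carrier F"
    using S by (simp_all add: F_simps)
  have "dhat x \<otimes>\<^bsub>F\<^esub> (y \<otimes>\<^bsub>F\<^esub> z) \<oplus>\<^bsub>F\<^esub> x \<otimes>\<^bsub>F\<^esub> dhat (y \<otimes>\<^bsub>F\<^esub> z) \<oplus>\<^bsub>F\<^esub> lamF \<otimes>\<^bsub>F\<^esub> (dhat x \<otimes>\<^bsub>F\<^esub> dhat (y \<otimes>\<^bsub>F\<^esub> z))
      = dhat (x \<otimes>\<^bsub>F\<^esub> y) \<otimes>\<^bsub>F\<^esub> z \<oplus>\<^bsub>F\<^esub> (x \<otimes>\<^bsub>F\<^esub> y) \<otimes>\<^bsub>F\<^esub> dhat z \<oplus>\<^bsub>F\<^esub> lamF \<otimes>\<^bsub>F\<^esub> (dhat (x \<otimes>\<^bsub>F\<^esub> y) \<otimes>\<^bsub>F\<^esub> dhat z)"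
    unfolding xy[unfolded leibniz_iff[OF S(1,2)]] yz[unfolded leibniz_iff[OF S(2,3)]]
    by (rule F.leibniz_shift_identity) (rule cl)+
  moreover have "(x \<otimes>\<^bsub>F\<^esub> y) \<otimes>\<^bsub>F\<^esub> z = x \<otimes>\<^bsub>F\<^esub> (y \<otimes>\<^bsub>F\<^esub> z)" by (rule F.m_assoc) (rule cl)+
  moreover have "leibniz x (y \<diamondop> z) \<longleftrightarrow> dhat (x \<otimes>\<^bsub>F\<^esub> (y \<otimes>\<^bsub>F\<^esub> z)) = dhat x \<otimes>\<^bsub>F\<^esub> (y \<otimes>\<^bsub>F\<^esub> z) \<oplus>\<^bsub>F\<^esub> x \<otimes>\<^bsub>F\<^esub> dhat (y \<otimes>\<^bsub>F\<^esub> z)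
      \<oplus>\<^bsub>F\<^esub> lamF \<otimes>\<^bsub>F\<^esub> (dhat x \<otimes>\<^bsub>F\<^esub> dhat (y \<otimes>\<^bsub>F\<^esub> z))"
    using leibniz_iff[of x "y \<otimes>\<^bsub>F\<^esub> z"] S by (simp only: F_simps mul_left_simps)
  moreover have "leibniz (x \<diamondop> y) z \<longleftrightarrow> dhat ((x \<otimes>\<^bsub>F\<^esub> y) \<otimes>\<^bsub>F\<^esub> z) = dhat (x \<otimes>\<^bsub>F\<^esub> y) \<otimes>\<^bsub>F\<^esub> z \<oplus>\<^bsub>F\<^esub> (x \<otimes>\<^bsub>F\<^esub> y) \<otimes>\<^bsub>F\<^esub> dhat z
      \<oplus>\<^bsub>F\<^esub> lamF \<otimes>\<^bsub>F\<^esub> (dhat (x \<otimes>\<^bsub>F\<^esub> y) \<otimes>\<^bsub>F\<^esub> dhat z)"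
    using leibniz_iff[of "x \<otimes>\<^bsub>F\<^esub> y" z] S by (simp only: F_simps mul_left_simps)
  ultimately show ?thesis by simp
qed

lemma leibniz_induct:
  assumes x: "x \<in> carrier S" and t: "t \<in> carrier S"
    and single: "\<And>b. b \<in> carrier A \<Longrightarrow> leibniz x (pr [b])"
    and cons: "\<And>b s. b \<in> carrier A \<Longrightarrow> s \<in> carrier S \<Longrightarrow> leibniz x (pr [b] \<diamondop> P s)"
  shows "leibniz x t"
  using t
proof (induction rule: S_induct)
  case zero
  then show ?case using x by (simp add: leibniz_def)
next
  case (add y z)
  then show ?case using x by (simp add: leibniz_def S.smult_r_distr S.M.a_ac)
next
  case (pure c w)
  have "leibniz x (pr w)"
  proof (cases rule: word_decompose[OF pure(2)])
    case (1 a)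
    then show ?thesis using single by simp
  next
    case (2 a v)
    then show ?thesis using cons[of a "pr v"] by simp
  qed
  then show ?case using x pure by (simp add: leibniz_def S.smult_r_distr smult_left_commute[of lam] del: dhat_pure pure_mul)
qed

text \<open>This is the Leibniz rule of \<open>A\<close>, since multiplying by \<open>a\<close> replaces the first letter \<open>b\<close> by \<open>a b\<close>.\<close>

lemma leibniz_single:
  assumes a: "a \<in> carrier A" and t: "t \<in> carrier S"
  shows "leibniz (pr [a]) t"
proof (rule leibniz_induct[OF _ t])
  fix b assume b: "b \<in> carrier A"
  have D: "pr [der A (a \<otimes>\<^bsub>A\<^esub> b)] = pr [der A a] \<otimes>\<^bsub>F\<^esub> pr [b] \<oplus>\<^bsub>F\<^esub> pr [a] \<otimes>\<^bsub>F\<^esub> pr [der A b]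
      \<oplus>\<^bsub>F\<^esub> lam \<odot>\<^bsub>F\<^esub> (pr [der A a] \<otimes>\<^bsub>F\<^esub> pr [der A b])"
    using a b by (simp add: der_mult pure_single del: pure_mul)
  then show "leibniz (pr [a]) (pr [b])"
    using a b by (simp add: leibniz_def F_simps)
  fix s assume s: "s \<in> carrier S"
  have cl: "pr [a] \<in> carrier F" "pr [b] \<in> carrier F" "pr [der A a] \<in> carrier F" "pr [der A b] \<in> carrier F"
      "s \<in> carrier F" "P s \<in> carrier F" "lamF \<in> carrier F"
    using a b s by (simp_all add: F_simps)
  have pre: "pre c s = pr [c] \<otimes>\<^bsub>F\<^esub> P s" if "c \<in> carrier A" for c using that s by (simp add: F_simps)
  have dpre: "dhat (pre c s) = pr [der A c] \<otimes>\<^bsub>F\<^esub> P s \<oplus>\<^bsub>F\<^esub> pr [c] \<otimes>\<^bsub>F\<^esub> s \<oplus>\<^bsub>F\<^esub> lamF \<otimes>\<^bsub>F\<^esub> (pr [der A c] \<otimes>\<^bsub>F\<^esub> s)"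
    if "c \<in> carrier A" for c
    using dhat_prepend[OF that s] that s lamF_mult[of "pr [der A c] \<otimes>\<^bsub>F\<^esub> s"] by (simp add: F_simps)
  have D': "pr [der A (a \<otimes>\<^bsub>A\<^esub> b)] = pr [der A a] \<otimes>\<^bsub>F\<^esub> pr [b] \<oplus>\<^bsub>F\<^esub> pr [a] \<otimes>\<^bsub>F\<^esub> pr [der A b]
      \<oplus>\<^bsub>F\<^esub> lamF \<otimes>\<^bsub>F\<^esub> (pr [der A a] \<otimes>\<^bsub>F\<^esub> pr [der A b])"
    by (simp only: D lamF_mult[OF F.m_closed[OF cl(3) cl(4)]])
  have da: "dhat (pr [a]) = pr [der A a]" using a by simp
  have "dhat (pr [a] \<otimes>\<^bsub>F\<^esub> (pr [b] \<otimes>\<^bsub>F\<^esub> P s)) = dhat (pre (a \<otimes>\<^bsub>A\<^esub> b) s)"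
    using a b s by (simp add: F_simps)
  also have "\<dots> = dhat (pr [a]) \<otimes>\<^bsub>F\<^esub> (pr [b] \<otimes>\<^bsub>F\<^esub> P s) \<oplus>\<^bsub>F\<^esub> pr [a] \<otimes>\<^bsub>F\<^esub> dhat (pr [b] \<otimes>\<^bsub>F\<^esub> P s)
      \<oplus>\<^bsub>F\<^esub> lamF \<otimes>\<^bsub>F\<^esub> (dhat (pr [a]) \<otimes>\<^bsub>F\<^esub> dhat (pr [b] \<otimes>\<^bsub>F\<^esub> P s))"
    unfolding dpre[OF A.m_closed[OF a b]] dpre[OF b, unfolded pre[OF b]] da pure_single(1)[OF a b] D'
    by (rule F.leibniz_single_identity) (rule cl)+
  finally show "leibniz (pr [a]) (pr [b] \<diamondop> P s)"
    using leibniz_iff[of "pr [a]" "pr [b] \<otimes>\<^bsub>F\<^esub> P s"] a b s by (simp only: F_simps mul_left_simps pure_closed' prepend_simps words_Cons list.set empty_subsetI simp_thms A.one_closed)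
qed (use a in simp)

text \<open>By \<open>d \<circ> P = id\<close>, deriving the product formula \<open>P_mul\<close> strips its outer \<open>P\<close> and leaves the Leibniz rule.\<close>

lemma leibniz_P:
  assumes "s \<in> carrier S" "t \<in> carrier S"
  shows "leibniz (P s) (P t)"
  using assms by (simp add: leibniz_def P_mul dhat_P S.M.a_ac del: prepend_simps(2,3))

text \<open>Both arguments are decomposed as \<open>b \<diamondop> P s\<close> and the factors from \<open>A\<close> are moved across by
  \<open>leibniz_shift\<close>, which leaves the cases \<open>leibniz_single\<close> and \<open>leibniz_P\<close>.\<close>

lemma leibniz_all:
  assumes x: "x \<in> carrier S" and y: "y \<in> carrier S"
  shows "leibniz x y"
proof -
  have xP: "leibniz x (P t)" if x: "x \<in> carrier S" and t: "t \<in> carrier S" for x t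
  proof -
    have "leibniz (P t) x"
    proof (rule leibniz_induct[OF _ x])
      fix b assume b: "b \<in> carrier A"
      show "leibniz (P t) (pr [b])" using leibniz_single[OF b] leibniz_commute b t by simp
      fix s assume s: "s \<in> carrier S"
      have "leibniz (pr [b] \<diamondop> P s) (P t)"
        using leibniz_shift[of "pr [b]" "P s" "P t"] leibniz_single[OF b] leibniz_P[OF s t] b s t
        by (simp del: single_mul_prepend)
      then show "leibniz (P t) (pr [b] \<diamondop> P s)" using leibniz_commute b s t by simp
    qed (use t in simp)
    then show ?thesis using leibniz_commute x t by simp
  qed
  show ?thesis
  proof (rule leibniz_induct[OF x y])
    fix b assume b: "b \<in> carrier A"
    show xb: "leibniz x (pr [b])" using leibniz_single[OF b] leibniz_commute b x by simp
    fix s assume s: "s \<in> carrier S"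
    show "leibniz x (pr [b] \<diamondop> P s)"
      using leibniz_shift[of x "pr [b]" "P s"] xb leibniz_single[OF b, of "P s"] xP[of "x \<diamondop> pr [b]" s] b s x
      by (simp del: single_mul_prepend)
  qed
qed

theorem free_drb_in_drb_algs: "F \<in> drb_algs K lam"
proof -
  have "is_derivation K lam F (der F)"
    unfolding is_derivation_def
    using dhat_linear leibniz_all
    by (auto simp: F_simps linear_maps_def leibniz_def der_one pure_zero)
  moreover have "is_rota_baxter K lam F (rb F)"
    using P_rota_baxter[of F] by (simp add: F_simps)
  ultimately show ?thesis
    using F.algebra_axioms dhat_P by (simp add: drb_algs_def F_simps)
qed

end


section \<open>Freeness\<close>

lemma forget_simps [simp]:
  "carrier (forget X) = carrier X" "mult (forget X) = mult X" "one (forget X) = one X"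
  "zero (forget X) = zero X" "add (forget X) = add X" "smult (forget X) = smult X" "der (forget X) = der X"
  by (simp_all add: forget_def dif_alg.truncate_def)

lemma dif_homs_forget:
  "dif_homs K A (forget X) = dif_homs K A X" "dif_homs K (forget X) B = dif_homs K X B"
  by (auto simp: dif_homs_def algebra_homs_def linear_maps_def ring_hom_def)

lemma algebra_cong:
  fixes X :: "('k, 'a, 'm) module_scheme" and Y :: "('k, 'a, 'n) module_scheme"
  assumes "algebra K X"
    and Y: "carrier Y = carrier X" "mult Y = mult X" "one Y = one X" "zero Y = zero X" "add Y = add X"
      "smult Y = smult X"
  shows "algebra K Y"
proof -
  interpret X: algebra K X by fact
  show ?thesis
  proof (rule algebraI)
    show "cring Y"
    proof (rule cringI)
      show "abelian_group Y"
        by (rule abelian_groupI)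
          (use X.M.a_closed X.M.a_comm X.M.a_assoc X.M.l_neg X.M.a_inv_closed in \<open>auto simp: Y\<close>)
      show "comm_monoid Y"
        by (rule comm_monoidI) (auto simp: Y X.m_assoc intro: X.m_comm)
    qed (simp add: Y X.l_distr)
  qed (simp_all add: Y X.smult_l_distr X.smult_r_distr X.smult_assoc1 X.smult_assoc2 X.R.is_cring)
qed

lemma forget_in_dif_algs: "X \<in> drb_algs K lam \<Longrightarrow> forget X \<in> dif_algs K lam"
  using algebra_cong[of K X "forget X"]
  by (auto simp: drb_algs_def dif_algs_def is_derivation_def linear_maps_def)

lemma dif_homsI:
  assumes "f \<in> linear_maps K A B"
    and "\<And>x y. x \<in> carrier A \<Longrightarrow> y \<in> carrier A \<Longrightarrow> f (x \<otimes>\<^bsub>A\<^esub> y) = f x \<otimes>\<^bsub>B\<^esub> f y"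
    and "f \<one>\<^bsub>A\<^esub> = \<one>\<^bsub>B\<^esub>"
    and "\<And>x. x \<in> carrier A \<Longrightarrow> f (der A x) = der B (f x)"
  shows "f \<in> dif_homs K A B"
  using assms linear_mapsD[OF assms(1)] by (auto simp: dif_homs_def algebra_homs_def ring_hom_def)

lemma dif_homsD:
  assumes "f \<in> dif_homs K A B"
  shows "f \<in> linear_maps K A B"
    and "x \<in> carrier A \<Longrightarrow> y \<in> carrier A \<Longrightarrow> f (x \<otimes>\<^bsub>A\<^esub> y) = f x \<otimes>\<^bsub>B\<^esub> f y"
    and "f \<one>\<^bsub>A\<^esub> = \<one>\<^bsub>B\<^esub>"
    and "x \<in> carrier A \<Longrightarrow> f (der A x) = der B (f x)"
    and "x \<in> carrier A \<Longrightarrow> f x \<in> carrier B"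
    and "x \<in> carrier A \<Longrightarrow> y \<in> carrier A \<Longrightarrow> f (x \<oplus>\<^bsub>A\<^esub> y) = f x \<oplus>\<^bsub>B\<^esub> f y"
    and "c \<in> carrier K \<Longrightarrow> x \<in> carrier A \<Longrightarrow> f (c \<odot>\<^bsub>A\<^esub> x) = c \<odot>\<^bsub>B\<^esub> f x"
    and "f \<in> carrier A \<rightarrow>\<^sub>E carrier B"
  using assms by (auto simp: dif_homs_def algebra_homs_def ring_hom_def linear_maps_def)

lemma multilinear_map:
  assumes A: "module K A" and B: "module K B" and f: "f \<in> linear_maps K A B" and \<phi>: "multilinear K B N \<phi>"
  shows "multilinear K A N (\<lambda>w. \<phi> (map f w))"
proof (rule multilinear_slotsI[OF A])
  fix u v assume uv: "set u \<subseteq> carrier A" "set v \<subseteq> carrier A"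
  have f': "(\<lambda>x\<in>carrier A. f x) \<in> linear_maps K A B"
    using f linear_mapsD(1)[OF f] by (simp add: extensional_restrict PiE_def)
  have "set (map f u) \<subseteq> carrier B" "set (map f v) \<subseteq> carrier B" using uv linear_mapsD(2)[OF f] by auto
  from linear_comp[OF linear_slotI[OF \<phi> B this] f' A]
  show "(\<lambda>x\<in>carrier A. \<phi> (map f (u @ x # v))) \<in> linear_maps K A N"
    using linear_mapsD(2)[OF f] by (simp cong: restrict_cong)
qed

lemma map_words: "f \<in> linear_maps K A B \<Longrightarrow> w \<in> words A \<Longrightarrow> map f w \<in> words B"
  using linear_mapsD(2) by (fastforce simp: words_def)

locale weighted_drb_algebra =
  fixes K :: "('k, 'e) ring_scheme" and lam :: 'k and X :: "('k, 'a) drb_alg"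
  assumes X: "X \<in> drb_algs K lam" and lam_closed: "lam \<in> carrier K"
begin

sublocale X: algebra K X
  using X by (simp add: drb_algs_def)

lemma X_module: "module K X" by (rule X.module)

lemma rb_linear: "rb X \<in> linear_maps K X X"
  and rb_mult: "x \<in> carrier X \<Longrightarrow> y \<in> carrier X \<Longrightarrow> rb X x \<otimes>\<^bsub>X\<^esub> rb X y =
    rb X (x \<otimes>\<^bsub>X\<^esub> rb X y) \<oplus>\<^bsub>X\<^esub> rb X (y \<otimes>\<^bsub>X\<^esub> rb X x) \<oplus>\<^bsub>X\<^esub> lam \<odot>\<^bsub>X\<^esub> rb X (x \<otimes>\<^bsub>X\<^esub> y)"
  and der_rb [simp]: "x \<in> carrier X \<Longrightarrow> der X (rb X x) = x"
  and X_der_linear: "der X \<in> linear_maps K X X"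
  and X_der_mult: "x \<in> carrier X \<Longrightarrow> y \<in> carrier X \<Longrightarrow> der X (x \<otimes>\<^bsub>X\<^esub> y) =
    der X x \<otimes>\<^bsub>X\<^esub> y \<oplus>\<^bsub>X\<^esub> x \<otimes>\<^bsub>X\<^esub> der X y \<oplus>\<^bsub>X\<^esub> lam \<odot>\<^bsub>X\<^esub> (der X x \<otimes>\<^bsub>X\<^esub> der X y)"
  using X by (auto simp: drb_algs_def is_rota_baxter_def is_derivation_def)

lemmas rb_simps [simp] = linear_mapsD(2-4)[OF rb_linear] linear_map_zero[OF X_module X_module rb_linear]
lemmas X_der_simps [simp] = linear_mapsD(2-4)[OF X_der_linear] linear_map_zero[OF X_module X_module X_der_linear]

lemma counit_word_Cons: "w \<noteq> [] \<Longrightarrow> counit_word X (a # w) = a \<otimes>\<^bsub>X\<^esub> rb X (counit_word X w)"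
  by (cases w) auto

lemma counit_word_closed: "w \<in> words X \<Longrightarrow> counit_word X w \<in> carrier X"
proof (induction w)
  case (Cons a w)
  then show ?case by (cases w) (auto simp: words_def)
qed (simp add: words_def)

lemma counit_word_slot:
  "set p \<subseteq> carrier X \<Longrightarrow> set q \<subseteq> carrier X \<Longrightarrow>
    (\<lambda>x\<in>carrier X. counit_word X (p @ x # q)) \<in> linear_maps K X X"
proof (induction p)
  case Nil
  show ?case
  proof (cases "q = []")
    case True
    then show ?thesis by (auto intro: linear_mapsI)
  next
    case False
    then have "counit_word X q \<in> carrier X" using Nil by (intro counit_word_closed) (auto simp: words_def)
    then show ?thesis using False
      by (auto intro!: linear_mapsI simp: counit_word_Cons X.l_distr X.smult_assoc2)
  qed
next
  case (Cons b p)
  then have b: "b \<in> carrier X" by simp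
  have "(\<lambda>y\<in>carrier X. b \<otimes>\<^bsub>X\<^esub> rb X y) \<in> linear_maps K X X"
    using b by (auto intro!: linear_mapsI simp: X.r_distr X.m_comm[of b] X.smult_assoc2)
  from linear_comp[OF this Cons.IH X_module]
  have "(\<lambda>x\<in>carrier X. (\<lambda>y\<in>carrier X. b \<otimes>\<^bsub>X\<^esub> rb X y) (counit_word X (p @ x # q))) \<in> linear_maps K X X"
    using Cons.prems by simp
  moreover have "(\<lambda>x\<in>carrier X. (\<lambda>y\<in>carrier X. b \<otimes>\<^bsub>X\<^esub> rb X y) (counit_word X (p @ x # q))) =
      (\<lambda>x\<in>carrier X. counit_word X ((b # p) @ x # q))"
    using Cons.prems by (intro restrict_ext) (simp add: counit_word_Cons counit_word_closed)
  ultimately have "(\<lambda>x\<in>carrier X. counit_word X ((b # p) @ x # q)) \<in> linear_maps K X X" by metis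
  then show ?case by (simp add: restrict_def)
qed

lemma counit_word_multilinear: "multilinear K X X (counit_word X)"
  by (rule multilinear_slotsI[OF X_module]) (rule counit_word_slot)

lemma forget_dif_alg: "weighted_dif_algebra K lam (forget X)"
  by (unfold_locales) (rule forget_in_dif_algs[OF X] lam_closed)+

end

locale drb_target = A: weighted_dif_algebra K lam A + X: weighted_drb_algebra K lam X
  for K :: "('k, 'e) ring_scheme" and lam :: 'k and A :: "('k, 'a) dif_alg" and X :: "('k, 'b) drb_alg"
begin

abbreviation S where "S \<equiv> sha_module K A"
abbreviation F where "F \<equiv> free_drb K lam A"

text \<open>As \<open>A\<close> generates \<open>Sha(A)\<close>, an extension of \<open>f\<close> is forced to send \<open>a\<^sub>0 \<otimes> \<dots> \<otimes> a\<^sub>n\<close> to \<open>f a\<^sub>0 \<cdot> P (f a\<^sub>1 \<cdot> P (\<dots> P (f a\<^sub>n)))\<close>.\<close>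

definition extend :: "('a \<Rightarrow> 'b) \<Rightarrow> ('k, 'a) sha \<Rightarrow> 'b" where
  "extend f = lin_ext K A X (\<lambda>w. counit_word X (map f w))"

context
  fixes f assumes f: "f \<in> dif_homs K A X"
begin

lemmas f_linear = dif_homsD(1)[OF f] and f_mult = dif_homsD(2)[OF f] and f_one = dif_homsD(3)[OF f]
  and f_der = dif_homsD(4)[OF f] and f_closed [simp, intro] = dif_homsD(5)[OF f]

lemma extend_linear: "extend f \<in> linear_maps K S X"
  and extend_pure: "w \<in> words A \<Longrightarrow> extend f (pure K A w) = counit_word X (map f w)"
  unfolding extend_def
  using lin_ext[OF A.A_module X.X_module multilinear_map[OF A.A_module X.X_module f_linear X.counit_word_multilinear]]
  by auto

lemmas extend_simps [simp] = linear_mapsD(2-4)[OF extend_linear]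
  linear_map_zero[OF A.S.module_axioms X.X_module extend_linear]

lemma extend_single [simp]: "a \<in> carrier A \<Longrightarrow> extend f (pure K A [a]) = f a"
  by (simp add: extend_pure)

lemma extend_prepend [simp]:
  assumes a: "a \<in> carrier A"
  shows "s \<in> carrier S \<Longrightarrow> extend f (prepend K A a s) = f a \<otimes>\<^bsub>X\<^esub> rb X (extend f s)"
proof (induction rule: A.S_induct)
  case (add s t)
  then show ?case using a by (simp add: X.X.r_distr)
next
  case (pure c w)
  have "extend f (prepend K A a (pure K A w)) = f a \<otimes>\<^bsub>X\<^esub> rb X (extend f (pure K A w))"
    using a pure extend_pure[of "a # w"] by (auto simp: extend_pure words_def X.counit_word_Cons)
  then show ?case using a pure
    by (simp add: X.X.m_comm[of "f a"] X.X.smult_assoc2 del: A.prepend_pure)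
qed (use a in simp_all)

lemma extend_single_mult:
  assumes a: "a \<in> carrier A"
  shows "s \<in> carrier S \<Longrightarrow> extend f (sha_mult K lam A (pure K A [a]) s) = f a \<otimes>\<^bsub>X\<^esub> extend f s"
proof (induction rule: A.S_induct)
  case (add s t)
  then show ?case using a by (simp add: X.X.r_distr)
next
  case (pure c w)
  have "extend f (sha_mult K lam A (pure K A [a]) (pure K A w)) = f a \<otimes>\<^bsub>X\<^esub> extend f (pure K A w)"
  proof (cases rule: A.word_decompose[OF pure(2)])
    case (1 b)
    then show ?thesis using a by (simp add: f_mult)
  next
    case (2 b v)
    then have "pure K A w = prepend K A b (pure K A v)" by (simp del: A.prepend_pure)
    then show ?thesis using a 2 by (simp add: f_mult X.X.m_assoc del: A.prepend_pure)
  qed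
  then show ?case using a pure by (simp add: X.X.m_comm[of "f a"] X.X.smult_assoc2 del: A.pure_mul)
qed (use a in simp_all)

text \<open>With \<open>u = a P u'\<close> and \<open>v = b P v'\<close>, both sides are \<open>f a f b\<close> times a product of two values of \<open>P\<close>.
  Expanding it in \<open>Sha(A)\<close> by \<open>P_mul\<close> and in \<open>X\<close> by the Rota-Baxter identity gives terms that agree by
  induction on the total length.\<close>

lemma extend_word_mult:
  "u \<in> words A \<Longrightarrow> v \<in> words A \<Longrightarrow>
    extend f (sha_mult K lam A (pure K A u) (pure K A v)) = extend f (pure K A u) \<otimes>\<^bsub>X\<^esub> extend f (pure K A v)"
proof (induction "length u + length v" arbitrary: u v rule: less_induct)
  case less
  note wd = less.prems
  note cl = wd[THEN A.pure_closed']
  show ?case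
  proof (cases rule: A.word_decompose[OF wd(1)])
    case (1 a)
    then show ?thesis using extend_single_mult cl by simp
  next
    case u: (2 a u')
    show ?thesis
    proof (cases rule: A.word_decompose[OF wd(2)])
      case (1 b)
      then have "sha_mult K lam A (pure K A u) (pure K A v) = sha_mult K lam A (pure K A [b]) (pure K A u)"
        using A.mul_commute cl by simp
      then show ?thesis using 1 extend_single_mult[of b "pure K A u"] cl
        by (simp add: X.X.m_comm del: A.pure_mul)
    next
      case v: (2 b v')
      let ?s = "pure K A u'" and ?t = "pure K A v'"
      have st: "?s \<in> carrier S" "?t \<in> carrier S" using u v by auto
      have Pw: "A.P (pure K A z) = pure K A (\<one>\<^bsub>A\<^esub> # z)" "\<one>\<^bsub>A\<^esub> # z \<in> words A" if "z \<in> words A" for z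
        using that by (auto simp: words_def)
      have eP: "extend f (A.P s) = rb X (extend f s)" if "s \<in> carrier S" for s
        using that by (simp add: f_one)
      have IH1: "extend f (sha_mult K lam A ?s (A.P ?t)) = extend f ?s \<otimes>\<^bsub>X\<^esub> rb X (extend f ?t)"
        unfolding eP[OF st(2), symmetric] Pw(1)[OF v(2)]
        by (rule less.hyps) (use u v Pw(2)[OF v(2)] in simp_all)
      have IH2: "extend f (sha_mult K lam A (A.P ?s) ?t) = rb X (extend f ?s) \<otimes>\<^bsub>X\<^esub> extend f ?t"
        unfolding eP[OF st(1), symmetric] Pw(1)[OF u(2)]
        by (rule less.hyps) (use u v Pw(2)[OF u(2)] in simp_all)
      have IH3: "extend f (sha_mult K lam A ?s ?t) = extend f ?s \<otimes>\<^bsub>X\<^esub> extend f ?t"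
        by (rule less.hyps) (use u v in simp_all)
      have PP: "extend f (sha_mult K lam A (A.P ?s) (A.P ?t)) = rb X (extend f ?s) \<otimes>\<^bsub>X\<^esub> rb X (extend f ?t)"
        using st by (simp add: A.P_mul eP f_one IH1 IH2 IH3 X.rb_mult X.X.m_comm[of "extend f ?t"]
            del: A.prepend_pure A.pure_mul A.prepend_simps(2,3))
      have cl': "A.P ?s \<in> carrier S" "A.P ?t \<in> carrier S" "pure K A [a] \<in> carrier S" "pure K A [b] \<in> carrier S"
        using st u(1) v(1) by (simp_all del: A.prepend_pure)
      have "sha_mult K lam A (pure K A u) (pure K A v) =
          sha_mult K lam A (pure K A [a]) (sha_mult K lam A (pure K A [b]) (sha_mult K lam A (A.P ?s) (A.P ?t)))"
        unfolding u(4) v(4)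
        using A.F.m_assoc[of "pure K A [a]" "A.P ?s"] A.F.m_lcomm[of "A.P ?s" "pure K A [b]"] cl'
        by (simp only: A.F_simps A.mul_left_simps)
      then show ?thesis
        using u(1) v(1) cl' st
        by (simp only: u(4) v(4) extend_single_mult PP A.mul_left_simps)
          (simp add: eP f_one X.X.m_ac del: A.prepend_pure A.single_mul_prepend)
    qed
  qed
qed

lemma extend_mult:
  assumes "s \<in> carrier S" "t \<in> carrier S"
  shows "extend f (sha_mult K lam A s t) = extend f s \<otimes>\<^bsub>X\<^esub> extend f t"
  using assms(1)
proof (induction s rule: A.S_induct)
  case (add x y)
  then show ?case using assms by (simp add: X.X.l_distr)
next
  case (pure c u)
  from assms(2) have "extend f (sha_mult K lam A (pure K A u) t) = extend f (pure K A u) \<otimes>\<^bsub>X\<^esub> extend f t"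
  proof (induction t rule: A.S_induct)
    case (add x y)
    then show ?case using pure by (simp add: X.X.r_distr)
  next
    case (pure d v)
    then show ?case using \<open>u \<in> words A\<close>
      by (simp add: extend_word_mult X.X.m_comm[of "extend f (pure K A u)"] X.X.smult_assoc2 del: A.pure_mul)
  qed (use pure in simp_all)
  then show ?case using pure assms by (simp add: X.X.smult_assoc2)
qed (use assms in simp_all)

text \<open>For \<open>a P s\<close>, the Leibniz rule in \<open>X\<close> with \<open>d \<circ> P = id\<close> gives the three terms of \<open>dhat_prepend\<close>.\<close>

lemma extend_dhat: "s \<in> carrier S \<Longrightarrow> extend f (A.dhat s) = der X (extend f s)"
proof (induction rule: A.S_induct)
  case (pure c w)
  have "extend f (A.dhat (pure K A w)) = der X (extend f (pure K A w))"
  proof (cases rule: A.word_decompose[OF pure(2)])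
    case (1 a)
    then show ?thesis by (simp add: f_der)
  next
    case (2 a v)
    then have eq: "pure K A w = prepend K A a (pure K A v)" by (simp del: A.prepend_pure)
    show ?thesis unfolding eq using 2
      by (simp add: A.dhat_prepend extend_single_mult f_der X.X_der_mult del: A.prepend_pure A.pure_mul)
  qed
  then show ?case using pure by (simp del: A.dhat_pure)
qed simp_all

lemma extend_drb_hom: "extend f \<in> drb_homs K F X"
proof -
  have "extend f \<in> dif_homs K F X"
    by (rule dif_homsI)
      (use extend_linear in \<open>simp_all add: A.F_simps linear_maps_def extend_mult f_one extend_dhat\<close>)
  then show ?thesis by (simp add: drb_homs_def A.F_simps f_one)
qed

end

text \<open>\<open>A\<close> generates \<open>Sha(A)\<close> under the product and \<open>P\<close>, which are preserved by \<open>g\<close>.\<close>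

lemma drb_hom_eq_extend:
  assumes g: "g \<in> drb_homs K F X" and f: "f \<in> dif_homs K A X"
    and gf: "\<And>a. a \<in> carrier A \<Longrightarrow> g (pure K A [a]) = f a"
  shows "g = extend f"
proof (rule linear_map_eqI[OF A.A_module X.X_module _ extend_linear[OF f]])
  have gd: "g \<in> dif_homs K F X" using g by (simp add: drb_homs_def)
  show gl: "g \<in> linear_maps K S X" using dif_homsD(1)[OF gd] by (simp add: linear_maps_def A.F_simps)
  fix w assume "w \<in> words A"
  then show "g (pure K A w) = extend f (pure K A w)"
  proof (induction w)
    case (Cons a w)
    show ?case
    proof (cases "w = []")
      case True
      then show ?thesis using Cons gf f by simp
    next
      case False
      then have w: "w \<in> words A" "a \<in> carrier A" using Cons.prems by (auto simp: words_def)
      have "pure K A (a # w) = prepend K A a (pure K A w)" using w by simp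
      also have "\<dots> = pure K A [a] \<otimes>\<^bsub>F\<^esub> A.P (pure K A w)"
        using w by (simp add: A.F_simps del: A.prepend_pure)
      finally have "pure K A (a # w) = pure K A [a] \<otimes>\<^bsub>F\<^esub> A.P (pure K A w)" .
      then have "g (pure K A (a # w)) = g (pure K A [a]) \<otimes>\<^bsub>X\<^esub> g (A.P (pure K A w))"
        using dif_homsD(2)[OF gd, of "pure K A [a]" "A.P (pure K A w)"] w by (simp add: A.F_simps del: A.prepend_pure)
      also have "g (A.P (pure K A w)) = rb X (g (pure K A w))"
        using g w by (simp add: drb_homs_def A.F_simps del: A.prepend_pure)
      also have "\<dots> = rb X (extend f (pure K A w))" using Cons.IH[OF w(1)] by simp
      also have "g (pure K A [a]) \<otimes>\<^bsub>X\<^esub> rb X (extend f (pure K A w)) = extend f (pure K A (a # w))"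
        using extend_prepend[OF f w(2), of "pure K A w"] w gf by simp
      finally show ?thesis .
    qed
  qed (simp add: words_def)
qed

end

lemma compose_dif_homs:
  assumes A: "A \<in> dif_algs K lam" and f: "f \<in> dif_homs K A B" and g: "g \<in> dif_homs K B C"
  shows "compose (carrier A) g f \<in> dif_homs K A C"
proof -
  interpret A: algebra K A using A by (simp add: dif_algs_def)
  have d: "der A x \<in> carrier A" if "x \<in> carrier A" for x
    using A that by (auto simp: dif_algs_def is_derivation_def linear_maps_def)
  show ?thesis
  proof (rule dif_homsI)
    show "compose (carrier A) g f \<in> linear_maps K A C"
      by (rule linear_maps_compose[OF dif_homsD(1)[OF f] dif_homsD(1)[OF g] A.module])
  qed (simp_all add: compose_def dif_homsD(2-5)[OF f] dif_homsD(2-5)[OF g] d)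
qed

lemma (in weighted_dif_algebra) eta_dif_hom: "eta K A \<in> dif_homs K A F"
proof (rule dif_homsI)
  show "eta K A \<in> linear_maps K A F"
    by (rule linear_mapsI) (auto simp: eta_def pure_single F_simps)
qed (simp_all add: eta_def pure_single F_simps del: pure_mul)

lemma (in drb_target) universal_property:
  "bij_betw (\<lambda>g. compose (carrier A) g (eta K A)) (drb_homs K F X) (dif_homs K A (forget X))"
proof (rule bij_betw_byWitness[where f' = extend])
  have comp: "compose (carrier A) g (eta K A) \<in> dif_homs K A X" if "g \<in> drb_homs K F X" for g
    using compose_dif_homs[OF A.A A.eta_dif_hom, of g X] that by (simp add: drb_homs_def)
  show "\<forall>g\<in>drb_homs K F X. extend (compose (carrier A) g (eta K A)) = g"
    using drb_hom_eq_extend[OF _ comp] by (simp add: compose_def eta_def)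
  show "\<forall>f\<in>dif_homs K A (forget X). compose (carrier A) (extend f) (eta K A) = f"
  proof
    fix f assume "f \<in> dif_homs K A (forget X)"
    then have f: "f \<in> dif_homs K A X" by (simp add: dif_homs_forget)
    then have "f \<in> extensional (carrier A)" using dif_homsD(8)[OF f] by (simp add: PiE_def)
    then show "compose (carrier A) (extend f) (eta K A) = f"
      by (rule extensionalityI[OF compose_extensional]) (simp add: compose_def eta_def f)
  qed
  show "(\<lambda>g. compose (carrier A) g (eta K A)) ` drb_homs K F X \<subseteq> dif_homs K A (forget X)"
    using comp by (auto simp: dif_homs_forget)
  show "extend ` dif_homs K A (forget X) \<subseteq> drb_homs K F X"
    using extend_drb_hom by (auto simp: dif_homs_forget)
qed


section \<open>Rota-Baxter algebras as algebras over the monad\<close>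

text \<open>Tensor powers see the module structure only, so \<open>Sha\<close> does not distinguish \<open>X\<close> from its underlying
  differential algebra. The counit is defined with the former, the monad with the latter.\<close>

lemma tensor_power_forget: "tensor_power K (forget X) n = tensor_power K X n"
  by (simp add: tensor_power_def tensor_kernel_def tensor_rels_def tensor_free_def tuples_def)

lemma sha_forget:
  "sha_module K (forget X) = sha_module K X" "pure K (forget X) = pure K X" "words (forget X) = words X"
  by (auto simp: sha_module_def pure_def words_def tensor_power_forget[abs_def] tensor_kernel_def
      tensor_rels_def tensor_free_def tuples_def fun_eq_iff)

lemma lin_ext_forget: "lin_ext K (forget X) N \<phi> = lin_ext K X N \<phi>"
  by (simp add: lin_ext_def sha_forget)

lemma lin_ext_cong: "(\<And>w. w \<in> words A \<Longrightarrow> \<phi> w = \<psi> w) \<Longrightarrow> lin_ext K A N \<phi> = lin_ext K A N \<psi>"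
  by (simp add: lin_ext_def cong: ball_cong)

text \<open>The counit is natural because \<open>counit_word\<close> is built from the product and the Rota-Baxter operator.\<close>

lemma counit_word_hom:
  assumes f: "f \<in> drb_homs K X Y" and X: "X \<in> drb_algs K lam" and lam: "lam \<in> carrier K"
  shows "w \<in> words X \<Longrightarrow> f (counit_word X w) = counit_word Y (map f w)"
proof (induction w)
  case (Cons a w)
  interpret X: weighted_drb_algebra K lam X using X lam by unfold_locales
  have fd: "f \<in> dif_homs K X Y" using f by (simp add: drb_homs_def)
  show ?case
  proof (cases "w = []")
    case False
    then have "w \<in> words X" "a \<in> carrier X" using Cons.prems by (auto simp: words_def)
    then show ?thesis using Cons.IH False f dif_homsD(2)[OF fd, of a "rb X (counit_word X w)"] X.counit_word_closed
      by (simp add: X.counit_word_Cons drb_homs_def)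
        (cases w; simp)
  qed simp
qed (simp add: words_def)

context weighted_drb_algebra
begin

interpretation A: weighted_dif_algebra K lam "forget X" by (rule forget_dif_alg)
interpretation C: drb_target K lam "forget X" X by unfold_locales

text \<open>The counit is the extension of the identity, hence a morphism by freeness. The identity is
  restricted to the carrier, as hom-sets consist of functions undefined outside it.\<close>

lemma counit_eq: "counit K X = C.extend (\<lambda>x\<in>carrier X. x)"
proof -
  have "map (\<lambda>x\<in>carrier X. x) w = w" if "w \<in> words X" for w
    using that by (intro map_idI) (auto simp: words_def)
  then show ?thesis
    unfolding counit_def C.extend_def lin_ext_forget[symmetric]
    by (intro lin_ext_cong) (simp add: sha_forget)
qed

lemma id_dif_hom: "(\<lambda>x\<in>carrier X. x) \<in> dif_homs K (forget X) X"
  by (rule dif_homsI) (auto intro!: linear_mapsI)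

lemma counit_drb_hom: "counit K X \<in> drb_homs K (free_drb K lam (forget X)) X"
  unfolding counit_eq by (rule C.extend_drb_hom[OF id_dif_hom])

lemma counit_pure: "w \<in> words X \<Longrightarrow> counit K X (pure K X w) = counit_word X w"
  using lin_ext(2)[OF X_module X_module counit_word_multilinear] by (simp add: counit_def)

lemma counit_linear: "counit K X \<in> linear_maps K (sha_module K X) X"
  using lin_ext(1)[OF X_module X_module counit_word_multilinear] by (simp add: counit_def)

end

lemma T_obj_simps:
  "carrier (T_obj K lam A) = carrier (sha_module K A)"
  by (simp add: T_obj_def free_drb_def)

lemma T_map:
  assumes A: "algebra K A" and B: "algebra K B" and f: "f \<in> linear_maps K A B"
  shows "T_map K A B f \<in> linear_maps K (sha_module K A) (sha_module K B)"
    and "w \<in> words A \<Longrightarrow> T_map K A B f (pure K A w) = pure K B (map f w)"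
proof -
  note A' = algebra.module[OF A] and B' = algebra.module[OF B]
  note ext = lin_ext[OF A' sha_module_module[OF B'] multilinear_map[OF A' B' f pure_multilinear[OF B']]]
  show "T_map K A B f \<in> linear_maps K (sha_module K A) (sha_module K B)"
    and "w \<in> words A \<Longrightarrow> T_map K A B f (pure K A w) = pure K B (map f w)"
    unfolding T_map_def free_map_def using ext by auto
qed

lemma compose_eqD:
  "compose C f g = compose C f' g' \<Longrightarrow> x \<in> C \<Longrightarrow> f (g x) = f' (g' x)"
  by (metis compose_eq)

text \<open>The laws of a monad algebra and of its morphisms are equations of this form; they are checked on
  pure tensors.\<close>

lemma sha_map_eqI:
  assumes A: "module K A" and N: "module K N"
    and "f \<in> linear_maps K (sha_module K A) M" "g \<in> linear_maps K M N"
      "f' \<in> linear_maps K (sha_module K A) M'" "g' \<in> linear_maps K M' N"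
    and "\<And>w. w \<in> words A \<Longrightarrow> g (f (pure K A w)) = g' (f' (pure K A w))"
  shows "compose (carrier (sha_module K A)) g f = compose (carrier (sha_module K A)) g' f'"
  using linear_map_eqI[OF A N linear_maps_compose[OF assms(3,4) sha_module_module[OF A]]
      linear_maps_compose[OF assms(5,6) sha_module_module[OF A]]] assms(7)
  by (simp add: compose_def pure_closed[OF A])

text \<open>The multiplication law says that \<open>counit_word\<close> commutes with the counit of \<open>X\<close>, which is a morphism of
  differential Rota-Baxter algebras.\<close>

lemma comparison_obj_T_alg:
  assumes X: "X \<in> drb_algs K lam" and lam: "lam \<in> carrier K"
  shows "comparison_obj K X \<in> T_algs K lam"
proof -
  interpret X: weighted_drb_algebra K lam X using X lam by unfold_locales
  interpret A: weighted_dif_algebra K lam "forget X" by (rule X.forget_dif_alg)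
  let ?F = "free_drb K lam (forget X)"
  interpret F: weighted_drb_algebra K lam ?F
    using A.free_drb_in_drb_algs lam by unfold_locales
  interpret TF: weighted_dif_algebra K lam "forget ?F" by (rule F.forget_dif_alg)
  have T: "T_obj K lam (forget X) = forget ?F" by (simp add: T_obj_def)
  have hd: "counit K X \<in> dif_homs K ?F X" using X.counit_drb_hom by (simp add: drb_homs_def)
  have hl: "counit K X \<in> linear_maps K (forget ?F) (forget X)"
    using dif_homsD(1)[OF hd] by (simp add: linear_maps_def)
  have "compose (carrier (sha_module K (forget ?F))) (counit K X) (T_map K (forget ?F) (forget X) (counit K X)) =
      compose (carrier (sha_module K (forget ?F))) (counit K X) (counit K ?F)"
  proof (rule sha_map_eqI[OF TF.A_module X.X_module T_map(1)[OF TF.A.algebra_axioms A.A.algebra_axioms hl]])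
    show "counit K X \<in> linear_maps K (sha_module K (forget X)) X" using X.counit_linear by (simp add: sha_forget)
    show "counit K ?F \<in> linear_maps K (sha_module K (forget ?F)) ?F" using F.counit_linear by (simp add: sha_forget)
    show "counit K X \<in> linear_maps K ?F X" by (rule dif_homsD(1)[OF hd])
    fix w assume w: "w \<in> words (forget ?F)"
    then have "map (counit K X) w \<in> words X" using map_words[OF hl] by (simp add: sha_forget)
    then show "counit K X (T_map K (forget ?F) (forget X) (counit K X) (pure K (forget ?F) w)) =
        counit K X (counit K ?F (pure K (forget ?F) w))"
      using w T_map(2)[OF TF.A.algebra_axioms A.A.algebra_axioms hl w] counit_word_hom[OF X.counit_drb_hom F.X lam, of w]
      by (simp add: sha_forget X.counit_pure F.counit_pure)
  qed
  moreover have "compose (carrier X) (counit K X) (eta K (forget X)) = (\<lambda>a\<in>carrier X. a)"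
    by (simp add: compose_def eta_def sha_forget X.counit_pure cong: restrict_cong)
  moreover have "counit K X \<in> dif_homs K (forget ?F) (forget X)" using hd by (simp add: dif_homs_forget)
  ultimately show ?thesis
    using A.A by (simp add: comparison_obj_def T_algs_def T T_obj_simps mu_def)
qed

text \<open>The condition on a map of monad algebras, evaluated at \<open>1 \<otimes> x\<close>, is compatibility with the
  Rota-Baxter operators; the converse is naturality of the counit.\<close>

lemma T_homs_comparison:
  assumes X: "X \<in> drb_algs K lam" and Y: "Y \<in> drb_algs K lam" and lam: "lam \<in> carrier K"
  shows "T_homs K lam (comparison_obj K X) (comparison_obj K Y) = drb_homs K X Y"
proof -
  interpret X: weighted_drb_algebra K lam X using X lam by unfold_locales
  interpret Y: weighted_drb_algebra K lam Y using Y lam by unfold_locales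
  interpret A: weighted_dif_algebra K lam "forget X" by (rule X.forget_dif_alg)
  interpret B: weighted_dif_algebra K lam "forget Y" by (rule Y.forget_dif_alg)
  let ?C = "carrier (sha_module K (forget X))"
  have eq: "T_homs K lam (comparison_obj K X) (comparison_obj K Y) =
      {f \<in> dif_homs K X Y. compose ?C f (counit K X) = compose ?C (counit K Y) (T_map K (forget X) (forget Y) f)}"
    by (simp add: T_homs_def comparison_obj_def dif_homs_forget T_obj_simps)
  have fl: "f \<in> linear_maps K (forget X) (forget Y)" if "f \<in> dif_homs K X Y" for f
    using dif_homsD(1)[OF that] by (simp add: linear_maps_def)
  have Tp: "T_map K (forget X) (forget Y) f (pure K X w) = pure K Y (map f w)"
    "map f w \<in> words Y"
    if "f \<in> dif_homs K X Y" "w \<in> words X" for f w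
    using T_map(2)[OF A.A.algebra_axioms B.A.algebra_axioms fl[OF that(1)], of w] map_words[OF fl[OF that(1)], of w] that
    by (simp_all add: sha_forget)
  show ?thesis
    unfolding eq
  proof (intro equalityI subsetI; (elim CollectE conjE)?)
    fix f assume f: "f \<in> dif_homs K X Y"
      and comm: "compose ?C f (counit K X) = compose ?C (counit K Y) (T_map K (forget X) (forget Y) f)"
    have "f (rb X x) = rb Y (f x)" if x: "x \<in> carrier X" for x
    proof -
      have w: "[\<one>\<^bsub>X\<^esub>, x] \<in> words X" using x by simp
      have "f (counit K X (pure K X [\<one>\<^bsub>X\<^esub>, x])) = counit K Y (pure K Y (map f [\<one>\<^bsub>X\<^esub>, x]))"
        using compose_eqD[OF comm, of "pure K X [\<one>\<^bsub>X\<^esub>, x]"] pure_closed[OF X.X_module w] Tp(1)[OF f w]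
        by (simp add: sha_forget)
      then show ?thesis
        using w Tp(2)[OF f w] dif_homsD(3)[OF f] dif_homsD(5)[OF f x] x X.counit_pure[OF w] Y.counit_pure[OF Tp(2)[OF f w]]
        by simp
    qed
    then show "f \<in> drb_homs K X Y" using f by (simp add: drb_homs_def)
  next
    fix f assume f: "f \<in> drb_homs K X Y"
    then have fd: "f \<in> dif_homs K X Y" by (simp add: drb_homs_def)
    have "compose ?C f (counit K X) = compose ?C (counit K Y) (T_map K (forget X) (forget Y) f)"
    proof (rule sha_map_eqI[OF A.A_module Y.X_module _ dif_homsD(1)[OF fd] T_map(1)[OF A.A.algebra_axioms B.A.algebra_axioms fl[OF fd]]])
      show "counit K X \<in> linear_maps K (sha_module K (forget X)) X" using X.counit_linear by (simp add: sha_forget)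
      show "counit K Y \<in> linear_maps K (sha_module K (forget Y)) Y" using Y.counit_linear by (simp add: sha_forget)
      fix w assume "w \<in> words (forget X)"
      then have w: "w \<in> words X" by (simp add: sha_forget)
      then show "f (counit K X (pure K (forget X) w)) =
          counit K Y (T_map K (forget X) (forget Y) f (pure K (forget X) w))"
        using Tp[OF fd w] counit_word_hom[OF f X lam w] by (simp add: sha_forget X.counit_pure Y.counit_pure)
    qed
    then show "f \<in> {f \<in> dif_homs K X Y. compose ?C f (counit K X) = compose ?C (counit K Y) (T_map K (forget X) (forget Y) f)}"
      using fd by simp
  qed
qed

text \<open>The inverse of the comparison functor on objects: as the counit sends \<open>1 \<otimes> x\<close> to \<open>P x\<close>, the operator
  can be recovered from the structure map.\<close>

definition drb_of_T_alg ::
  "('k, 'e) ring_scheme \<Rightarrow> ('k, 'a) dif_alg \<times> (('k, 'a) sha \<Rightarrow> 'a) \<Rightarrow> ('k, 'a) drb_alg" where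
  "drb_of_T_alg K = (\<lambda>(A, h). dif_alg.extend A (drb_alg.fields (\<lambda>x\<in>carrier A. h (pure K A [\<one>\<^bsub>A\<^esub>, x]))))"

lemma drb_of_T_alg_simps [simp]:
  "carrier (drb_of_T_alg K (A, h)) = carrier A" "mult (drb_of_T_alg K (A, h)) = mult A"
  "one (drb_of_T_alg K (A, h)) = one A" "zero (drb_of_T_alg K (A, h)) = zero A"
  "add (drb_of_T_alg K (A, h)) = add A" "smult (drb_of_T_alg K (A, h)) = smult A"
  "der (drb_of_T_alg K (A, h)) = der A"
  "rb (drb_of_T_alg K (A, h)) = (\<lambda>x\<in>carrier A. h (pure K A [\<one>\<^bsub>A\<^esub>, x]))"
  by (simp_all add: drb_of_T_alg_def dif_alg.extend_def drb_alg.fields_def)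

lemma forget_drb_of_T_alg [simp]: "forget (drb_of_T_alg K (A, h)) = A"
  by (simp add: forget_def dif_alg.truncate_def)

lemma drb_of_comparison:
  assumes X: "X \<in> drb_algs K lam" and lam: "lam \<in> carrier K"
  shows "drb_of_T_alg K (comparison_obj K X) = X"
proof -
  interpret X: weighted_drb_algebra K lam X using X lam by unfold_locales
  have "rb X \<in> extensional (carrier X)" using linear_mapsD(1)[OF X.rb_linear] by (simp add: PiE_def)
  then have "(\<lambda>x\<in>carrier X. counit K X (pure K X [\<one>\<^bsub>X\<^esub>, x])) = rb X"
    by (intro extensionalityI[OF restrict_extensional]) (simp_all add: X.counit_pure)
  then show ?thesis
    by (intro drb_alg.equality) (simp_all add: comparison_obj_def sha_forget)
qed

locale T_algebra = weighted_dif_algebra K lam A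
  for K :: "('k, 'e) ring_scheme" and lam :: 'k and A :: "('k, 'a) dif_alg" +
  fixes h assumes T_alg: "(A, h) \<in> T_algs K lam"
begin

abbreviation Q where "Q \<equiv> drb_of_T_alg K (A, h)"

lemma h_dif_hom: "h \<in> dif_homs K F A"
  using T_alg by (simp add: T_algs_def T_obj_def dif_homs_forget)

lemma h_linear: "h \<in> linear_maps K S A"
  using dif_homsD(1)[OF h_dif_hom] by (simp add: linear_maps_def F_simps)

lemmas h_simps [simp] = linear_mapsD(2-4)[OF h_linear]

lemma h_mult: "x \<in> carrier S \<Longrightarrow> y \<in> carrier S \<Longrightarrow> h (x \<diamondop> y) = h x \<otimes>\<^bsub>A\<^esub> h y"
  and h_dhat: "x \<in> carrier S \<Longrightarrow> h (dhat x) = der A (h x)"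
  using dif_homsD(2,4)[OF h_dif_hom] by (simp_all add: F_simps)

lemma h_single [simp]: "a \<in> carrier A \<Longrightarrow> h (pr [a]) = a"
proof -
  assume a: "a \<in> carrier A"
  have "compose (carrier A) h (eta K A) = (\<lambda>a\<in>carrier A. a)" using T_alg by (simp add: T_algs_def)
  from fun_cong[OF this, of a] show ?thesis using a by (simp add: compose_def eta_def)
qed

text \<open>The multiplication law for the word \<open>[1, s]\<close> with letters in \<open>Sha(A)\<close>: one side applies \<open>h\<close> to each
  letter, the other evaluates the word to \<open>1 \<diamondop> P s\<close>.\<close>

lemma h_P: "s \<in> carrier S \<Longrightarrow> h (P s) = h (pr [\<one>\<^bsub>A\<^esub>, h s])"
proof -
  assume s: "s \<in> carrier S"
  interpret F': weighted_drb_algebra K lam F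
    using free_drb_in_drb_algs lam by unfold_locales
  interpret TF: weighted_dif_algebra K lam "forget F" by (rule F'.forget_dif_alg)
  let ?w = "[pr [\<one>\<^bsub>A\<^esub>], s]"
  have w: "?w \<in> words F" using s by (simp add: F_simps)
  have hl: "h \<in> linear_maps K (forget F) A" using h_linear by (simp add: linear_maps_def F_simps)
  have T: "T_obj K lam A = forget F" by (simp add: T_obj_def)
  have "compose (carrier (sha_module K (forget F))) h (T_map K (forget F) A h) =
      compose (carrier (sha_module K (forget F))) h (counit K F)"
    using T_alg by (simp add: T_algs_def T T_obj_simps mu_def)
  from compose_eqD[OF this, of "pure K F ?w"]
  have "h (T_map K (forget F) A h (pure K F ?w)) = h (counit K F (pure K F ?w))"
    using pure_closed[OF F'.X_module w] by (simp add: sha_forget)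
  then have "h (pr (map h ?w)) = h (counit_word F ?w)"
    using w T_map(2)[OF TF.A.algebra_axioms A.algebra_axioms hl, of ?w] F'.counit_pure[OF w]
    by (simp add: sha_forget)
  then show ?thesis using s by (simp add: F_simps)
qed

lemma Q_rb: "s \<in> carrier S \<Longrightarrow> rb Q (h s) = h (P s)"
  by (simp add: h_P)

text \<open>Every \<open>x \<in> A\<close> is \<open>h [x]\<close>, so by \<open>Q_rb\<close> the identities for \<open>P\<close> and the derivation on \<open>Sha(A)\<close> carry over
  to \<open>Q\<close> along \<open>h\<close>.\<close>

lemma Q_in_drb_algs: "Q \<in> drb_algs K lam"
proof -
  have rb: "rb Q x = h (P (pr [x]))" if "x \<in> carrier A" for x using that by simp
  have cl: "pr [x] \<in> carrier S" "P (pr [x]) \<in> carrier S" if "x \<in> carrier A" for x using that by auto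
  have "algebra K Q" by (rule algebra_cong[OF A.algebra_axioms]) simp_all
  moreover have "is_derivation K lam Q (der Q)"
    using der by (simp add: is_derivation_def linear_maps_def)
  moreover have "is_rota_baxter K lam Q (rb Q)"
    unfolding is_rota_baxter_def
  proof (intro conjI ballI)
    show "rb Q \<in> linear_maps K Q Q"
    proof (rule linear_mapsI)
      show "rb Q \<in> carrier Q \<rightarrow>\<^sub>E carrier Q" by auto
    next
      fix x y assume "x \<in> carrier Q" "y \<in> carrier Q"
      then show "rb Q (x \<oplus>\<^bsub>Q\<^esub> y) = rb Q x \<oplus>\<^bsub>Q\<^esub> rb Q y"
        using pure_single(2)[of x y] by (simp add: rb F_simps del: prepend_pure drb_of_T_alg_simps(8))
    next
      fix c x assume "c \<in> carrier K" "x \<in> carrier Q"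
      then show "rb Q (c \<odot>\<^bsub>Q\<^esub> x) = c \<odot>\<^bsub>Q\<^esub> rb Q x"
        using pure_single(3)[of x x c] by (simp add: rb F_simps del: prepend_pure drb_of_T_alg_simps(8))
    qed
  next
    fix x y assume "x \<in> carrier Q" "y \<in> carrier Q"
    then have xy: "x \<in> carrier A" "y \<in> carrier A" by simp_all
    let ?x = "pr [x]" and ?y = "pr [y]"
    have "rb Q x \<otimes>\<^bsub>A\<^esub> rb Q y = h (P ?x \<diamondop> P ?y)" by (simp only: rb xy h_mult cl)
    also have "\<dots> = h (P (?x \<diamondop> P ?y)) \<oplus>\<^bsub>A\<^esub> h (P (P ?x \<diamondop> ?y)) \<oplus>\<^bsub>A\<^esub> lam \<odot>\<^bsub>A\<^esub> h (P (?x \<diamondop> ?y))"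
      using xy cl by (simp add: P_mul del: prepend_pure pure_mul)
    also have "\<dots> = rb Q (h (?x \<diamondop> P ?y)) \<oplus>\<^bsub>A\<^esub> rb Q (h (P ?x \<diamondop> ?y)) \<oplus>\<^bsub>A\<^esub> lam \<odot>\<^bsub>A\<^esub> rb Q (h (?x \<diamondop> ?y))"
      using xy cl by (simp only: Q_rb mul_left_simps)
    also have "\<dots> = rb Q (x \<otimes>\<^bsub>A\<^esub> rb Q y) \<oplus>\<^bsub>A\<^esub> rb Q (rb Q x \<otimes>\<^bsub>A\<^esub> y) \<oplus>\<^bsub>A\<^esub> lam \<odot>\<^bsub>A\<^esub> rb Q (x \<otimes>\<^bsub>A\<^esub> y)"
      by (simp only: h_mult cl xy h_single rb)
    finally show "rb Q x \<otimes>\<^bsub>Q\<^esub> rb Q y =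
        rb Q (x \<otimes>\<^bsub>Q\<^esub> rb Q y) \<oplus>\<^bsub>Q\<^esub> rb Q (y \<otimes>\<^bsub>Q\<^esub> rb Q x) \<oplus>\<^bsub>Q\<^esub> lam \<odot>\<^bsub>Q\<^esub> rb Q (x \<otimes>\<^bsub>Q\<^esub> y)"
      using xy cl by (simp add: A.m_comm[of y])
  qed
  moreover have "der Q (rb Q x) = x" if "x \<in> carrier Q" for x
  proof -
    have x: "x \<in> carrier A" using that by simp
    have "der A (h (P (pr [x]))) = h (dhat (P (pr [x])))" by (simp only: h_dhat cl x)
    also have "\<dots> = x" by (simp only: dhat_P cl x h_single)
    finally show ?thesis using x rb[OF x] by (simp only: drb_of_T_alg_simps(7))
  qed
  ultimately show ?thesis by (simp add: drb_algs_def)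
qed

text \<open>By \<open>Q_rb\<close> and multiplicativity, \<open>h\<close> satisfies the recursion that defines the counit on words.\<close>

lemma comparison_Q: "comparison_obj K Q = (A, h)"
proof -
  interpret Q: weighted_drb_algebra K lam Q
    using Q_in_drb_algs lam by unfold_locales
  have sQ: "sha_module K Q = S" "pure K Q = pr" "words Q = words A"
    using sha_forget[where X = Q, symmetric] by simp_all
  have "counit K Q = h"
  proof (rule linear_map_eqI[OF A_module A_module])
    show "counit K Q \<in> linear_maps K S A" using Q.counit_linear by (simp add: sQ linear_maps_def)
    show "h \<in> linear_maps K S A" by (rule h_linear)
    fix w assume "w \<in> words A"
    then show "counit K Q (pr w) = h (pr w)"
    proof (induction w)
      case (Cons a w)
      then have wQ: "a # w \<in> words Q" by (simp add: sQ)
      show ?case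
      proof (cases "w = []")
        case True
        then show ?thesis using Cons Q.counit_pure[OF wQ] by (simp add: sQ)
      next
        case False
        then have w: "w \<in> words A" "w \<in> words Q" "a \<in> carrier A" using Cons.prems by (auto simp: words_def)
        have "counit K Q (pr (a # w)) = a \<otimes>\<^bsub>A\<^esub> rb Q (h (pr w))"
          using Q.counit_pure[OF wQ] Q.counit_pure[OF w(2)] Cons.IH[OF w(1)] False
          by (simp add: sQ Q.counit_word_Cons del: drb_of_T_alg_simps(8))
        also have "\<dots> = h (pr [a]) \<otimes>\<^bsub>A\<^esub> h (P (pr w))" using w by (simp only: Q_rb h_single pure_closed')
        also have "\<dots> = h (pr [a] \<diamondop> P (pr w))"
          by (rule h_mult[symmetric]) (use w in \<open>simp_all del: prepend_pure\<close>)
        also have "pr [a] \<diamondop> P (pr w) = pre a (pr w)" using w by (simp del: prepend_pure)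
        also have "\<dots> = pr (a # w)" using w by simp
        finally show ?thesis .
      qed
    qed (simp add: words_def)
  qed
  then show ?thesis by (simp add: comparison_obj_def)
qed

end

lemma T_alg_comparison:
  assumes "Z \<in> T_algs K lam" "lam \<in> carrier K"
  shows "drb_of_T_alg K Z \<in> drb_algs K lam" "comparison_obj K (drb_of_T_alg K Z) = Z"
proof -
  obtain A h where Z: "Z = (A, h)" by (cases Z)
  then interpret T_algebra K lam A h
    using assms by unfold_locales (auto simp: T_algs_def)
  show "drb_of_T_alg K Z \<in> drb_algs K lam" "comparison_obj K (drb_of_T_alg K Z) = Z"
    using Q_in_drb_algs comparison_Q by (simp_all add: Z)
qed


section \<open>The isomorphism of categories\<close>

lemma compose_drb_homs:
  assumes X: "X \<in> drb_algs K lam" and f: "f \<in> drb_homs K X Y" and g: "g \<in> drb_homs K Y Z"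
  shows "compose (carrier X) g f \<in> drb_homs K X Z"
proof -
  have "compose (carrier (forget X)) g f \<in> dif_homs K (forget X) Z"
    by (rule compose_dif_homs[OF forget_in_dif_algs[OF X], of _ Y])
      (use f g in \<open>simp_all add: drb_homs_def dif_homs_forget\<close>)
  moreover have "rb X x \<in> carrier X" if "x \<in> carrier X" for x
    using X that by (auto simp: drb_algs_def is_rota_baxter_def linear_maps_def)
  ultimately show ?thesis
    using f g dif_homsD(5)[of f K X Y] by (simp add: drb_homs_def dif_homs_forget compose_def)
qed

lemma id_drb_hom:
  assumes X: "X \<in> drb_algs K lam" and lam: "lam \<in> carrier K"
  shows "(\<lambda>x\<in>carrier X. x) \<in> drb_homs K X X"
proof -
  interpret X: weighted_drb_algebra K lam X using X lam by unfold_locales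
  show ?thesis using X.id_dif_hom by (simp add: drb_homs_def dif_homs_forget)
qed

lemma drb_homs_extensional:
  "f \<in> drb_homs K X Y \<Longrightarrow> f \<in> extensional (carrier X) \<and> (\<forall>x\<in>carrier X. f x \<in> carrier Y)"
  using dif_homsD(5,8)[of f K X Y] by (auto simp: drb_homs_def PiE_def)

lemma drb_homs_id:
  assumes "f \<in> drb_homs K X Y"
  shows "compose (carrier X) f (\<lambda>x\<in>carrier X. x) = f" "compose (carrier X) (\<lambda>x\<in>carrier Y. x) f = f"
proof -
  note f = drb_homs_extensional[OF assms]
  show "compose (carrier X) f (\<lambda>x\<in>carrier X. x) = f"
    by (rule extensionalityI[OF compose_extensional]) (use f in \<open>simp_all add: compose_def\<close>)
  show "compose (carrier X) (\<lambda>x\<in>carrier Y. x) f = f"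
    by (rule extensionalityI[OF compose_extensional]) (use f in \<open>simp_all add: compose_def\<close>)
qed

lemma drb_homs_assoc:
  "f \<in> drb_homs K W X \<Longrightarrow>
    compose (carrier W) (compose (carrier X) h g) f = compose (carrier W) h (compose (carrier W) g f)"
  using drb_homs_extensional[of f K W X] by (simp add: compose_def cong: restrict_cong)

lemma DIF_T_simps:
  "Ob (DIF_T K lam) = T_algs K lam" "Hom (DIF_T K lam) = T_homs K lam"
  "idm (DIF_T K lam) Z = (\<lambda>x\<in>carrier (fst Z). x)"
  "cmp (DIF_T K lam) Z Z' Z'' g f = compose (carrier (fst Z)) g f"
  by (simp_all add: DIF_T_def split: prod.split)

lemma DRB_simps:
  "Ob (DRB K lam) = drb_algs K lam" "Hom (DRB K lam) = drb_homs K"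
  "idm (DRB K lam) X = (\<lambda>x\<in>carrier X. x)" "cmp (DRB K lam) X Y Z g f = compose (carrier X) g f"
  by (simp_all add: DRB_def)

lemma fst_comparison [simp]: "carrier (fst (comparison_obj K X)) = carrier X"
  by (simp add: comparison_obj_def)

text \<open>Every monad algebra is a comparison object, so its hom-sets, and with them the category axioms, are
  those of differential Rota-Baxter algebras.\<close>

lemma T_homs_drb:
  assumes "Z \<in> T_algs K lam" "Z' \<in> T_algs K lam" "lam \<in> carrier K"
  shows "T_homs K lam Z Z' = drb_homs K (drb_of_T_alg K Z) (drb_of_T_alg K Z')"
  using T_homs_comparison[OF T_alg_comparison(1)[OF assms(1,3)] T_alg_comparison(1)[OF assms(2,3)] assms(3)]
    T_alg_comparison(2)[OF assms(1,3)] T_alg_comparison(2)[OF assms(2,3)] by simp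

lemma carrier_drb_of_T_alg: "carrier (drb_of_T_alg K Z) = carrier (fst Z)"
  by (cases Z) simp

lemma DRB_category:
  assumes lam: "lam \<in> carrier K" shows "is_category (DRB K lam)"
  unfolding is_category_def DRB_simps
  by (intro conjI ballI)
    (simp_all add: id_drb_hom[OF _ lam] compose_drb_homs drb_homs_id drb_homs_assoc)

lemma DIF_T_category:
  assumes lam: "lam \<in> carrier K" shows "is_category (DIF_T K lam)"
  unfolding is_category_def DIF_T_simps carrier_drb_of_T_alg[of K, symmetric]
  by (intro conjI ballI)
    (simp_all add: T_homs_drb[OF _ _ lam] T_alg_comparison(1)[OF _ lam]
      id_drb_hom[OF _ lam] compose_drb_homs[where lam = lam] drb_homs_id drb_homs_assoc)

theorem comparison_iso:
  assumes lam: "lam \<in> carrier K"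
  shows "is_cat_iso (DRB K lam) (DIF_T K lam) (comparison_obj K) comparison_map"
  unfolding is_cat_iso_def
proof (intro conjI exI)
  show "is_functor (DRB K lam) (DIF_T K lam) (comparison_obj K) comparison_map"
    unfolding is_functor_def DRB_simps DIF_T_simps comparison_map_def
    by (intro conjI ballI)
      (simp_all add: DRB_category[OF lam] DIF_T_category[OF lam] comparison_obj_T_alg[OF _ lam]
        T_homs_comparison[OF _ _ lam])
  show "is_functor (DIF_T K lam) (DRB K lam) (drb_of_T_alg K) (\<lambda>_ _ f. f)"
    unfolding is_functor_def DRB_simps DIF_T_simps
    by (intro conjI ballI)
      (simp_all add: DRB_category[OF lam] DIF_T_category[OF lam] T_alg_comparison(1)[OF _ lam]
        T_homs_drb[OF _ _ lam] carrier_drb_of_T_alg)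
qed (use drb_of_comparison[OF _ lam] T_alg_comparison(2)[OF _ lam] in
    \<open>auto simp: DRB_simps DIF_T_simps comparison_map_def\<close>)

theorem theorem5p8:
  fixes K :: "('k, 'e) ring_scheme" and lam :: 'k
  assumes "cring K" and "lam \<in> carrier K"
  shows
    "(\<forall>A \<in> (dif_algs K lam :: ('k, 'a) dif_alg set).
        free_drb K lam A \<in> drb_algs K lam \<and>
        eta K A \<in> dif_homs K A (forget (free_drb K lam A)) \<and>
        (\<forall>X \<in> (drb_algs K lam :: ('k, 'b) drb_alg set).
          bij_betw (\<lambda>g. compose (carrier A) g (eta K A))
            (drb_homs K (free_drb K lam A) X) (dif_homs K A (forget X)))) \<and>
     is_cat_iso (DRB K lam :: (('k, 'a) drb_alg, 'a \<Rightarrow> 'a) cat) (DIF_T K lam)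
       (comparison_obj K) comparison_map"
proof (intro conjI ballI)
  fix A :: "('k, 'a) dif_alg" assume "A \<in> dif_algs K lam"
  with assms(2) interpret A: weighted_dif_algebra K lam A by unfold_locales
  show "free_drb K lam A \<in> drb_algs K lam" by (rule A.free_drb_in_drb_algs)
  show "eta K A \<in> dif_homs K A (forget (free_drb K lam A))"
    using A.eta_dif_hom by (simp add: dif_homs_forget)
  fix X :: "('k, 'b) drb_alg" assume "X \<in> drb_algs K lam"
  with assms(2) interpret drb_target K lam A X by unfold_locales
  show "bij_betw (\<lambda>g. compose (carrier A) g (eta K A))
      (drb_homs K (free_drb K lam A) X) (dif_homs K A (forget X))"
    by (rule universal_property)
qed (rule comparison_iso[OF assms(2)])

end
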